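(* Let $f:\mathbb{B}^n\to\mathbb{B}^N$ be a rational proper map. Then $\Gamma_f$ is a Lie subgroup of $\mathrm{Aut}(\mathbb{B}^n)$ with finitely many connected components.
   Context: $\mathbb{B}^n$ is the open unit ball of $\mathbb{C}^n$, and $\mathrm{Aut}(\mathbb{B}^n)$ is its group of holomorphic automorphisms, a Lie group which is the quotient of $\mathbf{SU}(n,1)$ by its center. A rational proper map $f:\mathbb{B}^n\to\mathbb{B}^N$ is a proper holomorphic map whose components are rational functions. The Hermitian invariant group of $f$ is $$\Gamma_f=\{\gamma\in\mathrm{Aut}(\mathbb{B}^n):\ \text{there is } \psi\in\mathrm{Aut}(\mathbb{B}^N)\text{ with } f\circ\gamma=\psi\circ f\}.$$ *)

theory Defs
  imports "HOL-Analysis.Analysis" "HOL-Algebra.Bij"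
begin

subsection \<open>Holomorphic maps and automorphisms of the unit ball\<close>

abbreviation unit_ball :: "(complex^'n) set"  (\<open>\<bbbB>\<close>)
  where "\<bbbB> \<equiv> ball 0 1"

text \<open>Holomorphic in several variables: the real Frechet derivative is given by a complex matrix.\<close>

definition holomorphic_map_on :: "(complex^'n \<Rightarrow> complex^'m) \<Rightarrow> (complex^'n) set \<Rightarrow> bool"
  where "holomorphic_map_on f S \<longleftrightarrow>
    (\<forall>z\<in>S. \<exists>A :: complex^'n^'m. (f has_derivative (\<lambda>h. A *v h)) (at z))"

text \<open>As in \<^const>\<open>BijGroup\<close>, the elements are extensional functions, so that an automorphism is
  determined by its values on the ball.\<close>

definition ball_aut :: "(complex^'n \<Rightarrow> complex^'n) set"
  where "ball_aut = {g \<in> Bij \<bbbB>. holomorphic_map_on g \<bbbB> \<and> holomorphic_map_on (inv_into \<bbbB> g) \<bbbB>}"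

definition Ball_Aut :: "(complex^'n \<Rightarrow> complex^'n) monoid"
  where "Ball_Aut = BijGroup \<bbbB> \<lparr>carrier := ball_aut\<rparr>"

subsection \<open>Rational proper maps and the Hermitian invariant group\<close>

definition complex_polynomial :: "(complex^'n \<Rightarrow> complex) \<Rightarrow> bool"
  where "complex_polynomial p \<longleftrightarrow>
    (\<exists>(I :: ('n \<Rightarrow> nat) set) c. finite I \<and> p = (\<lambda>z. \<Sum>\<alpha>\<in>I. c \<alpha> * (\<Prod>i\<in>UNIV. z $ i ^ \<alpha> i)))"

text \<open>The denominator is only required not to be the zero polynomial; that it can be chosen
  without zeros in the ball when \<open>g\<close> is holomorphic there is a theorem and not part of
  the definition.\<close>

definition rational_on_ball :: "(complex^'n \<Rightarrow> complex) \<Rightarrow> bool"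
  where "rational_on_ball g \<longleftrightarrow>
    (\<exists>p q. complex_polynomial p \<and> complex_polynomial q \<and> (\<exists>z. q z \<noteq> 0) \<and>
           (\<forall>z\<in>\<bbbB>. q z \<noteq> 0 \<longrightarrow> g z = p z / q z))"

definition rational_proper_map :: "(complex^'n \<Rightarrow> complex^'m) \<Rightarrow> bool"
  where "rational_proper_map f \<longleftrightarrow>
    holomorphic_map_on f \<bbbB> \<and>
    proper_map (top_of_set \<bbbB>) (top_of_set \<bbbB>) f \<and>
    (\<forall>j. rational_on_ball (\<lambda>z. f z $ j))"

definition hermitian_invariant_group ::
    "(complex^'n \<Rightarrow> complex^'m) \<Rightarrow> (complex^'n \<Rightarrow> complex^'n) set"
  where "hermitian_invariant_group f =
    {\<gamma> \<in> carrier Ball_Aut. \<exists>\<psi> \<in> carrier Ball_Aut. \<forall>z\<in>\<bbbB>. f (\<gamma> z) = \<psi> (f z)}"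

subsection \<open>Smooth maps between subsets of Euclidean spaces\<close>

text \<open>\<open>k\<close>-fold continuous differentiability on an open set: all directional derivatives are
  \<open>(k - 1)\<close>-fold continuously differentiable.\<close>

primrec Ck_on :: "nat \<Rightarrow> 'a::euclidean_space set \<Rightarrow> ('a \<Rightarrow> 'b::euclidean_space) \<Rightarrow> bool"
  where
    "Ck_on 0 W f \<longleftrightarrow> continuous_on W f"
  | "Ck_on (Suc k) W f \<longleftrightarrow>
       (\<forall>x\<in>W. f differentiable (at x)) \<and> (\<forall>v. Ck_on k W (\<lambda>x. frechet_derivative f (at x) v))"

text \<open>On an arbitrary set, smooth means: locally the restriction of a smooth map defined on an
  open set of the ambient space.\<close>

definition smooth_on :: "'a::euclidean_space set \<Rightarrow> ('a \<Rightarrow> 'b::euclidean_space) \<Rightarrow> bool"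
  where "smooth_on S f \<longleftrightarrow>
    (\<forall>x\<in>S. \<exists>W g. open W \<and> x \<in> W \<and> (\<forall>k. Ck_on k W g) \<and> (\<forall>y\<in>S \<inter> W. g y = f y))"

definition diffeomorphism_on ::
    "'a::euclidean_space set \<Rightarrow> 'b::euclidean_space set \<Rightarrow> ('a \<Rightarrow> 'b) \<Rightarrow> bool"
  where "diffeomorphism_on S T f \<longleftrightarrow>
    bij_betw f S T \<and> smooth_on S f \<and> smooth_on T (inv_into S f)"

subsection \<open>The Lie group structure of the automorphism group of the ball\<close>

text \<open>Homogeneous coordinates on the projective space containing the ball are indexed by
  \<open>'n option\<close>; the index \<open>None\<close> belongs to the additional (negative) direction.\<close>

type_synonym 'n hmat = "complex^('n option)^('n option)"

definition adjoint_mat :: "'n::finite hmat \<Rightarrow> 'n hmat"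
  where "adjoint_mat A = (\<chi> i j. cnj (A $ j $ i))"

definition sig_mat :: "'n::finite hmat"
  where "sig_mat = (\<chi> i j. if i = j then (if i = None then -1 else 1) else 0)"

definition SU_n1 :: "'n::finite hmat set"
  where "SU_n1 = {A. det A = 1 \<and> adjoint_mat A ** sig_mat ** A = sig_mat}"

text \<open>The Lie algebra of \<^term>\<open>SU_n1\<close>; it serves as the model vector space of all charts.\<close>

definition su_n1 :: "'n::finite hmat set"
  where "su_n1 = {X. trace X = 0 \<and> adjoint_mat X ** sig_mat + sig_mat ** X = 0}"

definition homog :: "complex^'n \<Rightarrow> complex^('n option)"
  where "homog z = (\<chi> i. case i of None \<Rightarrow> 1 | Some k \<Rightarrow> z $ k)"

text \<open>The linear fractional action. On \<^term>\<open>SU_n1\<close> this is the surjective homomorphism onto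
  \<^term>\<open>Ball_Aut\<close> whose kernel is the (finite) center, so it identifies the automorphism group
  with the quotient of \<^term>\<open>SU_n1\<close> by its center.\<close>

definition ball_action :: "'n::finite hmat \<Rightarrow> complex^'n \<Rightarrow> complex^'n"
  where "ball_action A = restrict
    (\<lambda>z. \<chi> k. (A *v homog z) $ Some k / (A *v homog z) $ None) \<bbbB>"

text \<open>The quotient topology.\<close>

definition Ball_Aut_topology :: "(complex^'n \<Rightarrow> complex^'n) topology"
  where "Ball_Aut_topology = topology (\<lambda>U. U \<subseteq> carrier Ball_Aut \<and>
    openin (top_of_set SU_n1) {A \<in> SU_n1. ball_action A \<in> U})"

definition SU_charts :: "('n::finite hmat set \<times> ('n hmat \<Rightarrow> 'n hmat)) set"
  where "SU_charts = {(U, \<phi>). openin (top_of_set SU_n1) U \<and>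
    openin (top_of_set su_n1) (\<phi> ` U) \<and> diffeomorphism_on U (\<phi> ` U) \<phi>}"

text \<open>The maximal atlas of the unique smooth structure for which the quotient map
  \<^const>\<open>ball_action\<close>, a covering with finite fibres, is a local diffeomorphism.\<close>

definition Ball_Aut_charts ::
    "((complex^'n \<Rightarrow> complex^'n) set \<times> ((complex^'n \<Rightarrow> complex^'n) \<Rightarrow> 'n hmat)) set"
  where "Ball_Aut_charts = {(U, \<phi>). openin Ball_Aut_topology U \<and> inj_on \<phi> U \<and>
    (\<forall>A\<in>SU_n1. ball_action A \<in> U \<longrightarrow>
      (\<exists>V. A \<in> V \<and> ball_action ` V \<subseteq> U \<and> (V, \<phi> \<circ> ball_action) \<in> SU_charts))}"

text \<open>Embedded submanifolds, by slice charts; \<open>E\<close> is the model space of the atlas \<open>\<A>\<close>.\<close>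

definition embedded_submanifold ::
    "'e::euclidean_space set \<Rightarrow> ('a set \<times> ('a \<Rightarrow> 'e)) set \<Rightarrow> 'a set \<Rightarrow> bool"
  where "embedded_submanifold E \<A> S \<longleftrightarrow>
    (\<exists>d. \<forall>p\<in>S. \<exists>(U, \<phi>)\<in>\<A>. p \<in> U \<and>
      (\<exists>L. subspace L \<and> L \<subseteq> E \<and> dim L = d \<and> \<phi> ` (U \<inter> S) = \<phi> ` U \<inter> L))"

text \<open>Lie subgroup in the embedded sense, so the manifold topology of the subgroup is the
  subspace topology.\<close>

definition Lie_subgroup_of_Ball_Aut :: "(complex^'n \<Rightarrow> complex^'n) set \<Rightarrow> bool"
  where "Lie_subgroup_of_Ball_Aut H \<longleftrightarrow>
    subgroup H Ball_Aut \<and> embedded_submanifold su_n1 Ball_Aut_charts H"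

subsection \<open>Well-definedness\<close>

lemma holomorphic_map_on_compose:
  assumes "holomorphic_map_on f S" "holomorphic_map_on g T" "f ` S \<subseteq> T"
  shows "holomorphic_map_on (g \<circ> f) S"
  unfolding holomorphic_map_on_def
proof
  fix z assume z: "z \<in> S"
  obtain A where A: "(f has_derivative (\<lambda>h. A *v h)) (at z)"
    using assms(1) z unfolding holomorphic_map_on_def by blast
  obtain B where B: "(g has_derivative (\<lambda>h. B *v h)) (at (f z))"
    using assms(2,3) z unfolding holomorphic_map_on_def by blast
  have "(g \<circ> f has_derivative (\<lambda>h. (B ** A) *v h)) (at z)"
    using diff_chain_at[OF A B] by (simp add: o_def matrix_vector_mul_assoc)
  then show "\<exists>C. (g \<circ> f has_derivative (\<lambda>h. C *v h)) (at z)" by blast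
qed

lemma holomorphic_map_on_cong:
  assumes "open S" "holomorphic_map_on f S" "\<And>z. z \<in> S \<Longrightarrow> f z = g z"
  shows "holomorphic_map_on g S"
  unfolding holomorphic_map_on_def
proof
  fix z assume z: "z \<in> S"
  then obtain A where "(f has_derivative (\<lambda>h. A *v h)) (at z)"
    using assms(2) unfolding holomorphic_map_on_def by blast
  then have "(g has_derivative (\<lambda>h. A *v h)) (at z)"
    using assms(1) z assms(3) by (rule has_derivative_transform_within_open)
  then show "\<exists>A. (g has_derivative (\<lambda>h. A *v h)) (at z)" by blast
qed

lemma group_Ball_Aut: "group (Ball_Aut :: (complex^'n \<Rightarrow> complex^'n) monoid)"
proof -
  let ?B = "\<bbbB> :: (complex^'n) set"
  let ?G = "BijGroup ?B"
  have op: "open ?B" by simp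
  interpret group ?G by (rule group_BijGroup)
  have inv_eq: "inv\<^bsub>?G\<^esub> g = restrict (inv_into ?B g) ?B" if "g \<in> Bij ?B" for g
  proof (rule inv_equality)
    show "restrict (inv_into ?B g) ?B \<otimes>\<^bsub>?G\<^esub> g = \<one>\<^bsub>?G\<^esub>"
      using that by (simp add: BijGroup_def restrict_inv_into_Bij Bij_compose_restrict_eq)
  qed (use that in \<open>simp_all add: BijGroup_def restrict_inv_into_Bij\<close>)
  have holo_id: "holomorphic_map_on (\<lambda>z. z) ?B"
    unfolding holomorphic_map_on_def
  proof (intro ballI exI)
    fix z :: "complex^'n"
    have "(*v) (mat 1 :: complex^'n^'n) = (\<lambda>h. h)" by (rule ext) simp
    then show "((\<lambda>z. z) has_derivative (*v) (mat 1 :: complex^'n^'n)) (at z)" by simp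
  qed
  have "subgroup ball_aut ?G"
  proof
    show "ball_aut \<subseteq> carrier ?G" by (auto simp: ball_aut_def BijGroup_def)
    have "holomorphic_map_on (restrict (\<lambda>z. z) ?B) ?B"
      by (rule holomorphic_map_on_cong[OF op holo_id]) simp
    moreover have "holomorphic_map_on (inv_into ?B (restrict (\<lambda>z. z) ?B)) ?B"
      by (rule holomorphic_map_on_cong[OF op holo_id])
        (rule inv_into_f_eq[symmetric], auto simp: inj_on_def)
    ultimately show "\<one>\<^bsub>?G\<^esub> \<in> ball_aut" by (simp add: ball_aut_def BijGroup_def id_Bij)
  next
    fix g h :: "complex^'n \<Rightarrow> complex^'n" assume gh: "g \<in> ball_aut" "h \<in> ball_aut"
    then have b: "g \<in> Bij ?B" "h \<in> Bij ?B"
      and hol: "holomorphic_map_on g ?B" "holomorphic_map_on (inv_into ?B g) ?B"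
        "holomorphic_map_on h ?B" "holomorphic_map_on (inv_into ?B h) ?B"
      by (simp_all add: ball_aut_def)
    then have bb: "bij_betw g ?B ?B" "bij_betw h ?B ?B" by (auto simp: Bij_def)
    have c: "bij_betw (compose ?B g h) ?B ?B" using compose_Bij[OF b] by (simp add: Bij_def)
    have "holomorphic_map_on (g \<circ> h) ?B"
      using hol bij_betw_imp_surj_on[OF bb(2)]
      by (intro holomorphic_map_on_compose[of _ _ _ ?B]) (simp_all only: order_refl)
    then have 1: "holomorphic_map_on (compose ?B g h) ?B"
      by (rule holomorphic_map_on_cong[OF op]) (simp add: compose_def)
    have "holomorphic_map_on (inv_into ?B h \<circ> inv_into ?B g) ?B"
      using hol bij_betw_imp_surj_on[OF bij_betw_inv_into[OF bb(1)]]
      by (intro holomorphic_map_on_compose[of _ _ _ ?B]) (simp_all only: order_refl)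
    then have 2: "holomorphic_map_on (inv_into ?B (compose ?B g h)) ?B"
    proof (rule holomorphic_map_on_cong[OF op])
      fix z assume z: "z \<in> ?B"
      note m1 = Bij_inv_into_mem[OF b(1) z]
      note m = m1 Bij_inv_into_mem[OF b(2) m1]
      have "compose ?B g h (inv_into ?B h (inv_into ?B g z)) = z"
        using m z bb by (simp add: compose_def bij_betw_inv_into_right del: mem_ball)
      then show "(inv_into ?B h \<circ> inv_into ?B g) z = inv_into ?B (compose ?B g h) z"
        using inv_into_f_eq[OF bij_betw_imp_inj_on[OF c] m(2)] by simp
    qed
    show "g \<otimes>\<^bsub>?G\<^esub> h \<in> ball_aut"
      using 1 2 b by (simp add: ball_aut_def BijGroup_def compose_Bij)
  next
    fix g :: "complex^'n \<Rightarrow> complex^'n" assume g: "g \<in> ball_aut"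
    then have b: "g \<in> Bij ?B" by (auto simp: ball_aut_def)
    let ?k = "restrict (inv_into ?B g) ?B"
    have k: "?k \<in> Bij ?B" by (rule restrict_inv_into_Bij[OF b])
    have bg: "bij_betw g ?B ?B" and bk: "bij_betw ?k ?B ?B"
      using b k unfolding Bij_def by blast+
    have hol: "holomorphic_map_on g ?B" "holomorphic_map_on (inv_into ?B g) ?B"
      using g by (simp_all add: ball_aut_def)
    have 1: "holomorphic_map_on ?k ?B"
      by (rule holomorphic_map_on_cong[OF op hol(2)]) (simp only: restrict_apply')
    have 2: "holomorphic_map_on (inv_into ?B ?k) ?B"
    proof (rule holomorphic_map_on_cong[OF op hol(1)])
      fix z assume z: "z \<in> ?B"
      have gz: "g z \<in> ?B" using funcset_mem[OF Bij_imp_funcset[OF b] z] .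
      have "?k (g z) = z"
        using bij_betw_inv_into_left[OF bg z] by (simp only: restrict_apply'[OF gz])
      then show "g z = inv_into ?B ?k z"
        using inv_into_f_eq[OF bij_betw_imp_inj_on[OF bk] gz] by simp
    qed
    show "inv\<^bsub>?G\<^esub> g \<in> ball_aut"
      using 1 2 k b by (simp add: ball_aut_def inv_eq)
  qed
  then show ?thesis
    unfolding Ball_Aut_def by (rule subgroup.subgroup_is_group[OF _ group_BijGroup])
qed

lemma openin_Ball_Aut_topology:
  fixes U :: "(complex^'n \<Rightarrow> complex^'n) set"
  shows "openin Ball_Aut_topology U \<longleftrightarrow>
    U \<subseteq> carrier Ball_Aut \<and> openin (top_of_set SU_n1) {A \<in> SU_n1. ball_action A \<in> U}"
proof -
  let ?P = "\<lambda>U :: (complex^'n \<Rightarrow> complex^'n) set. {A \<in> SU_n1. ball_action A \<in> U}"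
  have "istopology (\<lambda>U. U \<subseteq> carrier Ball_Aut \<and> openin (top_of_set SU_n1) (?P U))"
    unfolding istopology_def
  proof (intro conjI allI impI)
    fix S T :: "(complex^'n \<Rightarrow> complex^'n) set"
    assume S: "S \<subseteq> carrier Ball_Aut \<and> openin (top_of_set SU_n1) (?P S)"
      and T: "T \<subseteq> carrier Ball_Aut \<and> openin (top_of_set SU_n1) (?P T)"
    then show "S \<inter> T \<subseteq> carrier Ball_Aut" by blast
    have "?P (S \<inter> T) = ?P S \<inter> ?P T" by blast
    then show "openin (top_of_set SU_n1) (?P (S \<inter> T))" using S T by (simp add: openin_Int)
  next
    fix K :: "(complex^'n \<Rightarrow> complex^'n) set set"
    assume K: "\<forall>S\<in>K. S \<subseteq> carrier Ball_Aut \<and> openin (top_of_set SU_n1) (?P S)"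
    then show "\<Union>K \<subseteq> carrier Ball_Aut" by blast
    have "?P (\<Union>K) = \<Union>(?P ` K)" by blast
    then show "openin (top_of_set SU_n1) (?P (\<Union>K))" using K by (auto intro!: openin_Union)
  qed
  then show ?thesis
    unfolding Ball_Aut_topology_def by (simp add: topology_inverse')
qed

end

theory Submission
  imports Defs "HOL-Complex_Analysis.Complex_Analysis"
begin

text \<open>
  Let \<open>\<Gamma>\<close> be the invariant group of \<open>f\<close>, and let \<open>G\<close> be the set of all matrices \<open>A\<close> in
  \<^term>\<open>SU_n1\<close> whose action on the ball lies in \<open>\<Gamma>\<close>. The theorem holds because \<open>G\<close> is the zero
  set of a single real polynomial on the space of matrices.

  This algebraicity (\<open>invariant_group_algebraic\<close>) rests on two facts. Every automorphism of the ball
  is linear fractional (\<open>ball_aut_eq\<close>), by the Schwarz lemma. And two families \<open>g\<close>, \<open>h\<close> of points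
  of the ball satisfy \<open>g = \<psi> \<circ> h\<close> for some automorphism \<open>\<psi>\<close> if and only if they have the same cross
  ratios with respect to the kernel \<open>1 - \<langle>a, b\<rangle>\<close> (\<open>cross_ratio_imp_automorphism\<close>): after a base
  point has been moved to the origin, equal cross ratios mean equal Gram matrices, and families with
  equal Gram matrices differ by a unitary map. So the existence of \<open>\<psi>\<close> with \<open>f \<circ> \<gamma> = \<psi> \<circ> f\<close> amounts
  to one equation for each triple of points of the ball. As \<open>f\<close> is rational, each equation
  becomes polynomial in the entries of the matrix of \<open>\<gamma>\<close> and their conjugates once denominators are
  cleared. All these polynomials lie in a space of finite dimension, so finitely many of them imply
  the others, and a sum of squares turns these into one.

  A real algebraic set is a finite union of connected sets
  (\<open>finite_connected_cover_of_algebraic_set\<close>): if \<open>{x. T x = 0}\<close> with \<open>T \<ge> 0\<close> is split into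
  disjoint closed parts, then for a large factor \<open>l\<close> the function \<open>x \<mapsto> \<bar>x - a\<bar>\<^sup>2 + l T x\<close> has a critical
  point near each part, and for generic \<open>a\<close> the number of critical points is bounded by the degree of
  \<open>T\<close> and the dimension alone. Applied to \<open>G\<close> this gives a finite cover of \<open>\<Gamma>\<close> by connected
  sets, namely their images under the continuous map \<^const>\<open>ball_action\<close>.

  The slice charts come from the exponential map. Let \<open>p\<close> be the polynomial that defines \<open>G\<close>, and let
  \<open>Z\<close> be a small matrix with \<open>exp Z\<close> in \<open>G\<close>. The entire function \<open>t \<mapsto> p (exp (t Z))\<close> vanishes at all
  natural numbers, since \<open>G\<close> is closed under multiplication, and it is of small exponential type,
  hence it is zero (\<open>zero_if_small_type\<close>). So near the origin \<open>exp Z\<close> lies in \<open>G\<close> exactly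
  if \<open>Z\<close> lies in the set \<open>L\<close> of generators of one-parameter groups in \<open>G\<close>, and \<open>L\<close> is a linear
  space by the Lie product formula (\<open>one_parameter_sum\<close>). In the charts
  \<open>ball_action (A0 exp X) \<mapsto> X\<close> with \<open>A0\<close> in \<open>G\<close> (\<open>Ball_Aut_exponential_chart\<close>) the group \<open>\<Gamma>\<close> is
  therefore the slice \<open>L\<close>.
\<close>

unbundle no fps_syntax

section \<open>Polynomials of bounded degree\<close>

definition exponents :: "'b set \<Rightarrow> nat \<Rightarrow> ('b \<Rightarrow> nat) set"
  where "exponents B d = PiE B (\<lambda>_. {..d})"

definition monomial :: "('a::euclidean_space \<Rightarrow> nat) \<Rightarrow> 'a \<Rightarrow> real"
  where "monomial \<alpha> x = (\<Prod>b\<in>Basis. (x \<bullet> b) ^ \<alpha> b)"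

text \<open>The degree is bounded in each coordinate separately: there are then exactly
  \<open>(d + 1) ^ DIM('a)\<close> monomials, which keeps the dimension counts explicit, and the bounds still add
  up under multiplication.\<close>

definition deg_le :: "nat \<Rightarrow> ('a::euclidean_space \<Rightarrow> real) \<Rightarrow> bool"
  where "deg_le d g \<longleftrightarrow> (\<exists>c. \<forall>x. g x = (\<Sum>\<alpha>\<in>exponents Basis d. c \<alpha> * monomial \<alpha> x))"

lemma finite_exponents: "finite B \<Longrightarrow> finite (exponents B d)"
  by (simp add: exponents_def finite_PiE)

lemma card_exponents: "finite B \<Longrightarrow> card (exponents B d) = (d + 1) ^ card B"
  by (simp add: exponents_def card_PiE)

lemma exponents_mono: "d \<le> e \<Longrightarrow> exponents B d \<subseteq> exponents B e"
  by (auto simp: exponents_def PiE_iff intro: order_trans)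

lemma deg_le_mono:
  assumes "deg_le d g" "d \<le> e"
  shows "deg_le e g"
proof -
  obtain c where c: "\<And>x. g x = (\<Sum>\<alpha>\<in>exponents Basis d. c \<alpha> * monomial \<alpha> x)"
    using assms unfolding deg_le_def by blast
  have "(\<Sum>\<alpha>\<in>exponents Basis d. c \<alpha> * monomial \<alpha> x) =
    (\<Sum>\<alpha>\<in>exponents Basis e. (if \<alpha> \<in> exponents Basis d then c \<alpha> else 0) * monomial \<alpha> x)" for x
    using exponents_mono[OF assms(2)]
    by (intro sum.mono_neutral_cong_left) (auto simp: finite_exponents)
  then show ?thesis unfolding deg_le_def c
    by (intro exI[of _ "\<lambda>\<alpha>. if \<alpha> \<in> exponents Basis d then c \<alpha> else 0"]) blast
qed

lemma deg_le_add: "deg_le d f \<Longrightarrow> deg_le d g \<Longrightarrow> deg_le d (\<lambda>x. f x + g x)"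
  unfolding deg_le_def
proof (elim exE)
  fix a b assume "\<forall>x. f x = (\<Sum>\<alpha>\<in>exponents Basis d. a \<alpha> * monomial \<alpha> x)"
    "\<forall>x. g x = (\<Sum>\<alpha>\<in>exponents Basis d. b \<alpha> * monomial \<alpha> x)"
  then show "\<exists>c. \<forall>x. f x + g x = (\<Sum>\<alpha>\<in>exponents Basis d. c \<alpha> * monomial \<alpha> x)"
    by (intro exI[of _ "\<lambda>\<alpha>. a \<alpha> + b \<alpha>"]) (simp add: algebra_simps sum.distrib)
qed

lemma deg_le_cmul: "deg_le d f \<Longrightarrow> deg_le d (\<lambda>x. r * f x)"
  unfolding deg_le_def
proof (elim exE)
  fix a assume "\<forall>x. f x = (\<Sum>\<alpha>\<in>exponents Basis d. a \<alpha> * monomial \<alpha> x)"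
  then show "\<exists>c. \<forall>x. r * f x = (\<Sum>\<alpha>\<in>exponents Basis d. c \<alpha> * monomial \<alpha> x)"
    by (intro exI[of _ "\<lambda>\<alpha>. r * a \<alpha>"]) (simp add: sum_distrib_left mult_ac)
qed

lemma deg_le_monomial:
  assumes "\<And>b. b \<in> Basis \<Longrightarrow> \<alpha> b \<le> d"
  shows "deg_le d (monomial \<alpha>)"
proof -
  let ?\<alpha> = "restrict \<alpha> Basis"
  have m: "?\<alpha> \<in> exponents Basis d" using assms by (auto simp: exponents_def)
  have "monomial \<alpha> x = (\<Sum>\<beta>\<in>exponents Basis d. (if \<beta> = ?\<alpha> then 1 else 0) * monomial \<beta> x)" for x
  proof -
    have "(\<Sum>\<beta>\<in>exponents Basis d. (if \<beta> = ?\<alpha> then 1 else 0) * monomial \<beta> x) =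
      (\<Sum>\<beta>\<in>exponents Basis d. if \<beta> = ?\<alpha> then monomial \<beta> x else 0)"
      by (rule sum.cong) auto
    also have "\<dots> = monomial ?\<alpha> x" using m by (simp add: finite_exponents)
    also have "\<dots> = monomial \<alpha> x" unfolding monomial_def by (rule prod.cong) auto
    finally show ?thesis by simp
  qed
  then show ?thesis unfolding deg_le_def by (intro exI[of _ "\<lambda>\<beta>. if \<beta> = ?\<alpha> then 1 else 0"]) blast
qed

lemma deg_le_const: "deg_le d (\<lambda>x. r)"
proof -
  have "deg_le d (\<lambda>x::'a. r * monomial (\<lambda>_. 0) x)" by (intro deg_le_cmul deg_le_monomial) simp
  then show ?thesis by (simp add: monomial_def)
qed

lemma deg_le_sum: "(\<And>i. i \<in> I \<Longrightarrow> deg_le d (f i)) \<Longrightarrow> deg_le d (\<lambda>x. \<Sum>i\<in>I. f i x)"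
  by (induction I rule: infinite_finite_induct) (auto intro: deg_le_const deg_le_add)

lemma deg_le_coordinate:
  assumes "b \<in> Basis"
  shows "deg_le 1 (\<lambda>x. x \<bullet> b)"
proof -
  have "monomial (\<lambda>c. if c = b then 1 else 0) x = x \<bullet> b" for x :: 'a
  proof -
    have "monomial (\<lambda>c. if c = b then 1 else 0) x = (\<Prod>c\<in>Basis. if c = b then x \<bullet> c else 1)"
      unfolding monomial_def by (rule prod.cong) auto
    then show ?thesis using assms by simp
  qed
  moreover have "deg_le 1 (monomial (\<lambda>c. if c = b then 1 else 0) :: 'a \<Rightarrow> real)"
    by (rule deg_le_monomial) simp
  ultimately show ?thesis unfolding deg_le_def by presburger
qed

lemma monomial_mult: "monomial \<alpha> x * monomial \<beta> x = monomial (\<lambda>b. \<alpha> b + \<beta> b) x"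
  by (simp add: monomial_def power_add prod.distrib)

lemma deg_le_mult:
  assumes "deg_le d f" "deg_le e g"
  shows "deg_le (d + e) (\<lambda>x. f x * g x)"
proof -
  obtain a where a: "\<And>x. f x = (\<Sum>\<alpha>\<in>exponents Basis d. a \<alpha> * monomial \<alpha> x)"
    using assms unfolding deg_le_def by blast
  obtain b where b: "\<And>x. g x = (\<Sum>\<alpha>\<in>exponents Basis e. b \<alpha> * monomial \<alpha> x)"
    using assms unfolding deg_le_def by blast
  have "f x * g x = (\<Sum>\<alpha>\<in>exponents Basis d. \<Sum>\<beta>\<in>exponents Basis e.
      (a \<alpha> * b \<beta>) * monomial (\<lambda>b. \<alpha> b + \<beta> b) x)" for x
    unfolding a b sum_product monomial_mult[symmetric] by (simp add: mult_ac)
  moreover have "deg_le (d + e) (\<lambda>x. \<Sum>\<alpha>\<in>exponents Basis d. \<Sum>\<beta>\<in>exponents Basis e.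
      (a \<alpha> * b \<beta>) * monomial (\<lambda>b. \<alpha> b + \<beta> b) x)"
    by (intro deg_le_sum deg_le_cmul deg_le_monomial) (auto simp: exponents_def PiE_iff intro: add_mono)
  ultimately show ?thesis by simp
qed

lemma deg_le_power: "deg_le d f \<Longrightarrow> deg_le (k * d) (\<lambda>x. f x ^ k)"
  by (induction k) (auto intro: deg_le_const deg_le_mult)

lemma deg_le_prod:
  "(\<And>i. i \<in> I \<Longrightarrow> deg_le (d i) (f i)) \<Longrightarrow> deg_le (\<Sum>i\<in>I. d i) (\<lambda>x. \<Prod>i\<in>I. f i x)"
  by (induction I rule: infinite_finite_induct) (auto intro: deg_le_const deg_le_mult)

lemma real_polynomial_function_deg_le:
  fixes p :: "'a::euclidean_space \<Rightarrow> real"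
  assumes "real_polynomial_function p"
  shows "\<exists>d. deg_le d p"
  using assms
proof induction
  case (linear f)
  have f: "f = (\<lambda>x. \<Sum>b\<in>Basis. f b * (x \<bullet> b))"
  proof
    fix x
    have "f x = f (\<Sum>b\<in>Basis. (x \<bullet> b) *\<^sub>R b)" by (simp add: euclidean_representation)
    also have "\<dots> = (\<Sum>b\<in>Basis. (x \<bullet> b) *\<^sub>R f b)"
      using linear by (simp add: bounded_linear.linear linear_sum linear_scale)
    finally show "f x = (\<Sum>b\<in>Basis. f b * (x \<bullet> b))" by (simp add: mult.commute)
  qed
  have "deg_le 1 f"
    by (subst f) (intro deg_le_sum deg_le_cmul deg_le_coordinate)
  then show ?case by blast
next
  case (const c) show ?case using deg_le_const by blast
next
  case (add f g)
  then obtain d e where "deg_le d f" "deg_le e g" by blast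
  then have "deg_le (max d e) (\<lambda>x. f x + g x)" by (intro deg_le_add) (auto elim: deg_le_mono)
  then show ?case by blast
next
  case (mult f g) then show ?case using deg_le_mult by blast
qed

section \<open>Fibres of polynomial maps\<close>

text \<open>Gaussian elimination: an unknown \<open>i0\<close> with nonzero coefficient in the equation \<open>\<beta>\<close> is
  eliminated, which removes one unknown and one equation.\<close>

lemma underdetermined_system:
  fixes m :: "'i \<Rightarrow> 'b \<Rightarrow> 'c::field"
  assumes "finite B" "finite I" "card B < card I"
  shows "\<exists>c. (\<exists>i\<in>I. c i \<noteq> 0) \<and> (\<forall>\<beta>\<in>B. (\<Sum>i\<in>I. c i * m i \<beta>) = 0)"
  using assms
proof (induction B arbitrary: I m rule: finite_induct)
  case empty
  then have "I \<noteq> {}" by auto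
  then show ?case by (intro exI[of _ "\<lambda>_. 1"]) auto
next
  case (insert \<beta> B)
  show ?case
  proof (cases "\<forall>i\<in>I. m i \<beta> = 0")
    case True
    have "card B < card I" using insert by simp
    from insert.IH[OF \<open>finite I\<close> this, of m] True show ?thesis by auto
  next
    case False
    then obtain i0 where i0: "i0 \<in> I" "m i0 \<beta> \<noteq> 0" by auto
    let ?I = "I - {i0}"
    have "card B < card ?I" using insert i0 by simp
    from insert.IH[OF _ this, of "\<lambda>i \<gamma>. m i \<gamma> - (m i \<beta> / m i0 \<beta>) * m i0 \<gamma>"] insert.prems
    obtain c where c: "\<exists>i\<in>?I. c i \<noteq> 0"
      "\<And>\<gamma>. \<gamma> \<in> B \<Longrightarrow> (\<Sum>i\<in>?I. c i * (m i \<gamma> - (m i \<beta> / m i0 \<beta>) * m i0 \<gamma>)) = 0" by auto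
    define s where "s = (\<Sum>i\<in>?I. c i * m i \<beta>)"
    define c' where "c' = c(i0 := - (s / m i0 \<beta>))"
    have split: "(\<Sum>i\<in>I. c' i * m i \<gamma>) = (\<Sum>i\<in>?I. c i * m i \<gamma>) - s / m i0 \<beta> * m i0 \<gamma>" for \<gamma>
    proof -
      have "(\<Sum>i\<in>?I. c' i * m i \<gamma>) = (\<Sum>i\<in>?I. c i * m i \<gamma>)" unfolding c'_def by (rule sum.cong) auto
      then show ?thesis using insert.prems i0 by (simp add: sum.remove c'_def)
    qed
    have "(\<Sum>i\<in>I. c' i * m i \<gamma>) = 0" if "\<gamma> \<in> insert \<beta> B" for \<gamma>
    proof (cases "\<gamma> = \<beta>")
      case True then show ?thesis using i0 unfolding split by (simp add: s_def)
    next
      case False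
      with that have "\<gamma> \<in> B" by simp
      have "(\<Sum>i\<in>?I. c i * (m i \<gamma> - (m i \<beta> / m i0 \<beta>) * m i0 \<gamma>)) =
        (\<Sum>i\<in>?I. c i * m i \<gamma>) - (\<Sum>i\<in>?I. (c i * m i \<beta>) * (m i0 \<gamma> / m i0 \<beta>))"
        by (simp add: algebra_simps sum_subtractf)
      also have "(\<Sum>i\<in>?I. (c i * m i \<beta>) * (m i0 \<gamma> / m i0 \<beta>)) = s * (m i0 \<gamma> / m i0 \<beta>)"
        unfolding s_def sum_distrib_right ..
      finally show ?thesis using c(2)[OF \<open>\<gamma> \<in> B\<close>] unfolding split by simp
    qed
    moreover have "\<exists>i\<in>I. c' i \<noteq> 0" using c(1) by (auto simp: c'_def)
    ultimately show ?thesis by blast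
  qed
qed

text \<open>Sorting by powers of one coordinate gives a polynomial in one variable with infinitely many
  zeros. Its coefficients vanish, and they are polynomials in the remaining coordinates.\<close>

lemma coefficients_zero_if_zero_on_box:
  fixes c :: "('b \<Rightarrow> nat) \<Rightarrow> real"
  assumes "finite B" "\<And>b. b \<in> B \<Longrightarrow> infinite (V b)"
    and "\<And>y. (\<And>b. b \<in> B \<Longrightarrow> y b \<in> V b) \<Longrightarrow>
      (\<Sum>\<alpha>\<in>exponents B d. c \<alpha> * (\<Prod>b\<in>B. y b ^ \<alpha> b)) = 0"
    and "\<alpha> \<in> exponents B d"
  shows "c \<alpha> = 0"
  using assms
proof (induction B arbitrary: c \<alpha> rule: finite_induct)
  case empty
  then show ?case by (simp add: exponents_def)
next
  case (insert b B)
  have ex: "exponents (insert b B) d = (\<lambda>(k, \<alpha>). \<alpha>(b := k)) ` ({..d} \<times> exponents B d)"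
    unfolding exponents_def by (rule PiE_insert_eq)
  have inj: "inj_on (\<lambda>(k, \<alpha>). \<alpha>(b := k)) ({..d} \<times> exponents B d)"
    unfolding exponents_def by (rule inj_combinator[OF \<open>b \<notin> B\<close>])
  have coeff: "(\<Sum>\<alpha>\<in>exponents B d. c (\<alpha>(b := k)) * (\<Prod>b\<in>B. y b ^ \<alpha> b)) = 0"
    if y: "\<And>b. b \<in> B \<Longrightarrow> y b \<in> V b" and k: "k \<le> d" for y k
  proof -
    define e where "e k = (\<Sum>\<alpha>\<in>exponents B d. c (\<alpha>(b := k)) * (\<Prod>b\<in>B. y b ^ \<alpha> b))" for k
    have "(\<Sum>k\<le>d. e k * v ^ k) = 0" if v: "v \<in> V b" for v
    proof -
      have "0 = (\<Sum>\<alpha>\<in>exponents (insert b B) d. c \<alpha> * (\<Prod>b'\<in>insert b B. (y(b := v)) b' ^ \<alpha> b'))"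
        using y v by (intro insert.prems(2)[symmetric]) auto
      also have "\<dots> = (\<Sum>(k, \<alpha>)\<in>{..d} \<times> exponents B d.
          c (\<alpha>(b := k)) * (\<Prod>b'\<in>insert b B. (y(b := v)) b' ^ (\<alpha>(b := k)) b'))"
        unfolding ex by (subst sum.reindex[OF inj]) (simp add: case_prod_unfold)
      also have "\<dots> = (\<Sum>(k, \<alpha>)\<in>{..d} \<times> exponents B d.
          c (\<alpha>(b := k)) * (\<Prod>b'\<in>B. y b' ^ \<alpha> b') * v ^ k)"
      proof (rule sum.cong[OF refl], clarify)
        fix k \<alpha>
        have "(\<Prod>b'\<in>B. (y(b := v)) b' ^ (\<alpha>(b := k)) b') = (\<Prod>b'\<in>B. y b' ^ \<alpha> b')"
          using \<open>b \<notin> B\<close> by (intro prod.cong) auto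
        then show "c (\<alpha>(b := k)) * (\<Prod>b'\<in>insert b B. (y(b := v)) b' ^ (\<alpha>(b := k)) b') =
          c (\<alpha>(b := k)) * (\<Prod>b'\<in>B. y b' ^ \<alpha> b') * v ^ k"
          by (subst prod.insert[OF insert.hyps(1,2)]) simp
      qed
      also have "\<dots> = (\<Sum>k\<le>d. e k * v ^ k)"
        unfolding e_def sum_distrib_right sum.cartesian_product by simp
      finally show ?thesis by simp
    qed
    then have "V b \<subseteq> {v. (\<Sum>k\<le>d. e k * v ^ k) = 0}" by auto
    then have "infinite {v. (\<Sum>k\<le>d. e k * v ^ k) = 0}"
      using insert.prems(1)[of b] finite_subset by auto
    then have "e k = 0" using polyfun_roots_finite[of e k d] k by blast
    then show ?thesis by (simp add: e_def)
  qed
  from insert.prems(3) obtain k \<alpha>' where \<alpha>: "\<alpha> = \<alpha>'(b := k)" "k \<le> d" "\<alpha>' \<in> exponents B d"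
    unfolding ex by auto
  have "c (\<alpha>'(b := k)) = 0"
    by (rule insert.IH[of "\<lambda>\<alpha>. c (\<alpha>(b := k))" \<alpha>', OF insert.prems(1) coeff[OF _ \<alpha>(2)] \<alpha>(3)]) blast+
  then show ?case by (simp only: \<alpha>(1))
qed

lemma polynomial_nonzero_on_open:
  fixes c :: "('a::euclidean_space \<Rightarrow> nat) \<Rightarrow> real"
  assumes "open S" "S \<noteq> {}" "\<alpha> \<in> exponents Basis d" "c \<alpha> \<noteq> 0"
  shows "\<exists>a\<in>S. (\<Sum>\<alpha>\<in>exponents Basis d. c \<alpha> * monomial \<alpha> a) \<noteq> 0"
proof (rule ccontr)
  assume "\<not> ?thesis"
  then have z: "\<And>a. a \<in> S \<Longrightarrow> (\<Sum>\<alpha>\<in>exponents Basis d. c \<alpha> * monomial \<alpha> a) = 0" by blast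
  obtain x where "x \<in> S" using assms by blast
  then obtain l u where lu: "x \<in> box l u" "box l u \<subseteq> S" using open_contains_box assms(1) by metis
  have "c \<alpha> = 0"
  proof (rule coefficients_zero_if_zero_on_box[where V = "\<lambda>b. {l \<bullet> b<..<u \<bullet> b}" and B = Basis and d = d])
    show "infinite {l \<bullet> b<..<u \<bullet> b}" if "b \<in> Basis" for b
      using lu(1) that by (force simp: mem_box intro!: infinite_Ioo)
    fix y :: "'a \<Rightarrow> real" assume y: "\<And>b. b \<in> Basis \<Longrightarrow> y b \<in> {l \<bullet> b<..<u \<bullet> b}"
    let ?x = "\<Sum>b\<in>Basis. y b *\<^sub>R b"
    have "?x \<in> box l u" using y by (auto simp: mem_box)
    with z[of ?x] lu have "(\<Sum>\<alpha>\<in>exponents Basis d. c \<alpha> * monomial \<alpha> ?x) = 0" by blast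
    moreover have "monomial \<alpha> ?x = (\<Prod>b\<in>Basis. y b ^ \<alpha> b)" for \<alpha>
      unfolding monomial_def by (rule prod.cong) auto
    ultimately show "(\<Sum>\<alpha>\<in>exponents Basis d. c \<alpha> * (\<Prod>b\<in>Basis. y b ^ \<alpha> b)) = 0" by simp
  qed (use assms in auto)
  with assms show False by simp
qed

text \<open>The \<open>DIM('a)\<close> components of \<open>E\<close> and one further coordinate are more polynomials than there are
  variables, so they satisfy an algebraic relation. It is found by counting: the
  \<open>(D + 1) ^ (DIM('a) + 1)\<close> products of powers with exponents at most \<open>D\<close> lie in a space of dimension
  \<open>(q + 1) ^ DIM('a)\<close>, and \<open>D\<close> is chosen so that this dimension is smaller.\<close>

lemma algebraic_dependence:
  fixes E :: "'a::euclidean_space \<Rightarrow> 'a"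
  assumes E: "\<And>b. b \<in> Basis \<Longrightarrow> deg_le d (\<lambda>x. E x \<bullet> b)" and d: "d \<ge> 1" and e: "e \<in> Basis"
    and D: "D = ((DIM('a) + 1) * d) ^ DIM('a)"
  shows "\<exists>c. (\<exists>\<alpha>\<in>exponents Basis D. \<exists>j\<le>D. c \<alpha> j \<noteq> 0) \<and>
    (\<forall>x. (\<Sum>j\<le>D. (\<Sum>\<alpha>\<in>exponents Basis D. c \<alpha> j * monomial \<alpha> (E x)) * (x \<bullet> e) ^ j) = 0)"
proof -
  let ?M = "DIM('a)"
  define q where "q = (?M + 1) * D * d"
  define I where "I = exponents (Basis :: 'a set) D \<times> {..D}"
  have deg: "deg_le q (\<lambda>x. monomial \<alpha> (E x) * (x \<bullet> e) ^ j)"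
    if "\<alpha> \<in> exponents Basis D" "j \<le> D" for \<alpha> j
  proof (rule deg_le_mono)
    show "deg_le ((\<Sum>b\<in>(Basis::'a set). \<alpha> b * d) + j * 1) (\<lambda>x. monomial \<alpha> (E x) * (x \<bullet> e) ^ j)"
      unfolding monomial_def
      by (intro deg_le_mult deg_le_prod deg_le_power E deg_le_coordinate e)
    have "(\<Sum>b\<in>(Basis::'a set). \<alpha> b * d) \<le> (\<Sum>b\<in>(Basis::'a set). D * d)"
      using that by (intro sum_mono mult_right_mono) (auto simp: exponents_def PiE_iff)
    moreover have "j \<le> D * d" using that d by (metis le_trans mult.right_neutral mult_le_mono2)
    ultimately show "(\<Sum>b\<in>(Basis::'a set). \<alpha> b * d) + j * 1 \<le> q"
      by (simp add: q_def algebra_simps)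
  qed
  then have "\<forall>i\<in>I. \<exists>m. \<forall>x. monomial (fst i) (E x) * (x \<bullet> e) ^ snd i =
      (\<Sum>\<beta>\<in>exponents Basis q. m \<beta> * monomial \<beta> x)"
    unfolding deg_le_def I_def by auto
  then obtain m where m: "\<And>i x. i \<in> I \<Longrightarrow> monomial (fst i) (E x) * (x \<bullet> e) ^ snd i =
      (\<Sum>\<beta>\<in>exponents Basis q. m i \<beta> * monomial \<beta> x)"
    by metis
  have finI: "finite I" by (simp add: I_def finite_exponents)
  \<comment> \<open>The choice of \<open>D\<close> enters here: \<open>((DIM('a) + 1) * d) ^ DIM('a) = D\<close> is less than \<open>D + 1\<close>.\<close>
  have "(q + 1) ^ ?M \<le> ((?M + 1) * d * (D + 1)) ^ ?M"
    using d by (intro power_mono) (auto simp: q_def algebra_simps)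
  also have "\<dots> = D * (D + 1) ^ ?M" by (simp only: power_mult_distrib D)
  also have "\<dots> < (D + 1) * (D + 1) ^ ?M" by simp
  finally have "card (exponents (Basis::'a set) q) < card I"
    by (simp add: I_def card_exponents card_cartesian_product mult.commute)
  from underdetermined_system[OF finite_exponents finI this, of m] obtain c where
    c: "\<exists>i\<in>I. c i \<noteq> 0" "\<And>\<beta>. \<beta> \<in> exponents Basis q \<Longrightarrow> (\<Sum>i\<in>I. c i * m i \<beta>) = 0" by auto
  have "(\<Sum>j\<le>D. (\<Sum>\<alpha>\<in>exponents Basis D. c (\<alpha>, j) * monomial \<alpha> (E x)) * (x \<bullet> e) ^ j) = 0" for x
  proof -
    have "(\<Sum>j\<le>D. (\<Sum>\<alpha>\<in>exponents Basis D. c (\<alpha>, j) * monomial \<alpha> (E x)) * (x \<bullet> e) ^ j) =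
      (\<Sum>i\<in>I. c i * (monomial (fst i) (E x) * (x \<bullet> e) ^ snd i))"
      unfolding I_def sum_distrib_right
      by (subst sum.swap) (simp add: sum.cartesian_product case_prod_unfold mult.assoc)
    also have "\<dots> = (\<Sum>i\<in>I. \<Sum>\<beta>\<in>exponents Basis q. c i * m i \<beta> * monomial \<beta> x)"
      by (intro sum.cong) (auto simp: m sum_distrib_left mult.assoc)
    also have "\<dots> = (\<Sum>\<beta>\<in>exponents Basis q. (\<Sum>i\<in>I. c i * m i \<beta>) * monomial \<beta> x)"
      by (subst sum.swap) (simp add: sum_distrib_right)
    also have "\<dots> = 0" by (simp add: c(2))
    finally show ?thesis .
  qed
  then show ?thesis using c(1) unfolding I_def
    by (intro exI[of _ "\<lambda>\<alpha> j. c (\<alpha>, j)"]) auto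
qed

text \<open>If \<open>a\<close> avoids the zeros of one nonzero coefficient of each relation in \<open>algebraic_dependence\<close>, then
  these relations become nontrivial equations of degree at most \<open>D\<close> for the coordinates of the points
  in the fibre over \<open>a\<close>.\<close>

lemma generic_fibre_bound:
  fixes E :: "'a::euclidean_space \<Rightarrow> 'a"
  assumes E: "\<And>b. b \<in> Basis \<Longrightarrow> deg_le d (\<lambda>x. E x \<bullet> b)" and d: "d \<ge> 1"
    and S: "open S" "S \<noteq> {}"
  shows "\<exists>a\<in>S. finite {x. E x = a} \<and>
    card {x. E x = a} \<le> (((DIM('a) + 1) * d) ^ DIM('a)) ^ DIM('a)"
proof -
  define D where "D = ((DIM('a) + 1) * d) ^ DIM('a)"
  have "\<forall>e\<in>Basis. \<exists>c. (\<exists>\<alpha>\<in>exponents Basis D. \<exists>j\<le>D. c \<alpha> j \<noteq> 0) \<and>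
    (\<forall>x. (\<Sum>j\<le>D. (\<Sum>\<alpha>\<in>exponents Basis D. c \<alpha> j * monomial \<alpha> (E x)) * (x \<bullet> e) ^ j) = 0)"
    using algebraic_dependence[OF E d _ D_def] by blast
  from bchoice[OF this] obtain c where c: "\<And>e. e \<in> Basis \<Longrightarrow> \<exists>\<alpha>\<in>exponents Basis D. \<exists>j\<le>D. c e \<alpha> j \<noteq> 0"
    "\<And>e x. e \<in> Basis \<Longrightarrow>
      (\<Sum>j\<le>D. (\<Sum>\<alpha>\<in>exponents Basis D. c e \<alpha> j * monomial \<alpha> (E x)) * (x \<bullet> e) ^ j) = 0"
    by blast
  from c(1) obtain \<alpha> j where \<alpha>: "\<And>e. e \<in> Basis \<Longrightarrow> \<alpha> e \<in> exponents Basis D"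
    and j: "\<And>e. e \<in> Basis \<Longrightarrow> j e \<le> D" and nz: "\<And>e. e \<in> Basis \<Longrightarrow> c e (\<alpha> e) (j e) \<noteq> 0"
    by metis
  define \<Psi> where "\<Psi> e k a = (\<Sum>\<alpha>\<in>exponents Basis D. c e \<alpha> k * monomial \<alpha> a)" for e k a
  have contm: "continuous_on UNIV (\<lambda>a. \<Psi> e k a)" for e k
    unfolding \<Psi>_def monomial_def by (intro continuous_intros)
  \<comment> \<open>The point \<open>a\<close> is found by shrinking \<open>S\<close> once for each coordinate.\<close>
  have "\<exists>T. open T \<and> T \<noteq> {} \<and> T \<subseteq> S \<and> (\<forall>e\<in>F. \<forall>a\<in>T. \<Psi> e (j e) a \<noteq> 0)" if "finite F" "F \<subseteq> Basis" for F
    using that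
  proof (induction F rule: finite_induct)
    case empty show ?case using S by blast
  next
    case (insert e F)
    then obtain T where T: "open T" "T \<noteq> {}" "T \<subseteq> S" "\<forall>e\<in>F. \<forall>a\<in>T. \<Psi> e (j e) a \<noteq> 0" by auto
    have e: "e \<in> Basis" using insert by simp
    let ?T = "T \<inter> {a. \<Psi> e (j e) a \<noteq> 0}"
    have "open ?T" using T(1) contm by (intro open_Int open_Collect_neq) auto
    moreover have "?T \<noteq> {}"
      using polynomial_nonzero_on_open[where c = "\<lambda>\<alpha>. c e \<alpha> (j e)", OF T(1,2) \<alpha>[OF e] nz[OF e]]
      unfolding \<Psi>_def by auto
    ultimately show ?case using T by (intro exI[of _ ?T]) auto
  qed
  from this[OF finite_Basis order_refl] obtain a where a: "a \<in> S"
    "\<And>e. e \<in> Basis \<Longrightarrow> \<Psi> e (j e) a \<noteq> 0" by auto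
  define R where "R e = {v. (\<Sum>k\<le>D. \<Psi> e k a * v ^ k) = 0}" for e
  have R: "finite (R e)" "card (R e) \<le> D" if "e \<in> Basis" for e
    unfolding R_def
    using polyfun_roots_finite[of "\<lambda>k. \<Psi> e k a" "j e" D]
      polyfun_roots_card[of "\<lambda>k. \<Psi> e k a" "j e" D] a(2)[OF that] j[OF that] by auto
  let ?X = "{x. E x = a}"
  let ?r = "\<lambda>x. restrict (\<lambda>e. x \<bullet> e) Basis"
  have sub: "?r ` ?X \<subseteq> PiE Basis R"
    using c(2) by (auto simp: R_def \<Psi>_def)
  have finP: "finite (PiE Basis R)" using R by (simp add: finite_PiE)
  have inj: "inj_on ?r ?X"
  proof (rule inj_onI)
    fix x y assume "?r x = ?r y"
    then have "x \<bullet> e = y \<bullet> e" if "e \<in> Basis" for e using that by (metis restrict_apply')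
    then show "x = y" by (rule euclidean_eqI)
  qed
  have "card ?X \<le> card (PiE Basis R)" by (rule card_inj_on_le[OF inj sub finP])
  also have "\<dots> = (\<Prod>e\<in>Basis. card (R e))" by (simp add: card_PiE)
  also have "\<dots> \<le> (\<Prod>e\<in>(Basis::'a set). D)" using R by (intro prod_mono) auto
  also have "\<dots> = D ^ DIM('a)" by simp
  finally have "card ?X \<le> D ^ DIM('a)" .
  moreover have "finite ?X" by (rule inj_on_finite[OF inj sub finP])
  ultimately show ?thesis using a(1) unfolding D_def by blast
qed

section \<open>Connected pieces of real algebraic sets\<close>

lemma real_polynomial_directional_derivative:
  fixes p :: "'a::euclidean_space \<Rightarrow> real"
  assumes "real_polynomial_function p"
  shows "\<exists>p'. (\<forall>x. (p has_derivative p' x) (at x)) \<and> (\<forall>v. real_polynomial_function (\<lambda>x. p' x v))"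
  using assms
proof induction
  case (linear f)
  then show ?case
    by (intro exI[of _ "\<lambda>_. f"]) (auto intro: bounded_linear_imp_has_derivative)
next
  case (const c) show ?case by (intro exI[of _ "\<lambda>_ _. 0"]) auto
next
  case (add f g)
  then obtain f' g' where "\<And>x. (f has_derivative f' x) (at x)" "\<And>x. (g has_derivative g' x) (at x)"
    "\<And>v. real_polynomial_function (\<lambda>x. f' x v)" "\<And>v. real_polynomial_function (\<lambda>x. g' x v)" by blast
  then show ?case
    by (intro exI[of _ "\<lambda>x v. f' x v + g' x v"]) (auto intro: has_derivative_add)
next
  case (mult f g)
  then obtain f' g' where "\<And>x. (f has_derivative f' x) (at x)" "\<And>x. (g has_derivative g' x) (at x)"
    "\<And>v. real_polynomial_function (\<lambda>x. f' x v)" "\<And>v. real_polynomial_function (\<lambda>x. g' x v)" by blast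
  note fg' = this
  have "real_polynomial_function (\<lambda>x. f x * g' x v + f' x v * g x)" for v
    by (rule real_polynomial_function.intros(3); rule real_polynomial_function.intros(4))
      (use fg' mult.hyps in simp_all)
  then show ?case using fg'
    by (intro exI[of _ "\<lambda>x v. f x * g' x v + f' x v * g x"]) (simp add: has_derivative_mult)
qed

text \<open>For a partition \<open>P\<close> the function \<open>F x = \<bar>x - a\<bar>\<^sup>2 + l T x\<close> has a local minimum near each part, if \<open>a\<close>
  is small and \<open>l\<close> is large. Its critical points are the solutions of \<open>E x = a\<close> with
  \<open>E x = x + (l / 2) grad T x\<close>, and their number is bounded for generic \<open>a\<close>. The factor \<open>l\<close> depends on
  the partition but does not enter the degree of \<open>E\<close>, so the bound is the same for all partitions.\<close>

lemma bounded_partitions_of_zero_set: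
  fixes T :: "'a::euclidean_space \<Rightarrow> real"
  assumes T: "real_polynomial_function T" and nonneg: "\<And>x. T x \<ge> 0"
  shows "\<exists>N. \<forall>P. finite P \<and> disjoint P \<and> (\<forall>C\<in>P. closed C \<and> C \<noteq> {}) \<and> \<Union>P = {x. T x = 0} \<longrightarrow> card P \<le> N"
proof -
  obtain T' where T': "\<And>x. (T has_derivative T' x) (at x)"
    and rp: "\<And>v. real_polynomial_function (\<lambda>x. T' x v)"
    using real_polynomial_directional_derivative[OF T] by blast
  have "\<forall>b. \<exists>d. deg_le d (\<lambda>x. T' x b)" using rp real_polynomial_function_deg_le by blast
  then obtain db where db: "\<And>b. deg_le (db b) (\<lambda>x. T' x b)" by metis
  define d where "d = Max (insert 1 (db ` (Basis :: 'a set)))"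
  have d1: "d \<ge> 1" by (simp add: d_def)
  have d: "deg_le d (\<lambda>x. T' x b)" if "b \<in> Basis" for b
    by (rule deg_le_mono[OF db], unfold d_def, rule Max_ge) (use that in auto)
  define N where "N = (((DIM('a) + 1) * d) ^ DIM('a)) ^ DIM('a)"
  have contT: "continuous_on S T" for S
    using T' by (meson continuous_at_imp_continuous_on has_derivative_continuous)
  have "card P \<le> N" if finP: "finite P" and disj: "disjoint P"
    and clo: "\<And>C. C \<in> P \<Longrightarrow> closed C" and ne: "\<And>C. C \<in> P \<Longrightarrow> C \<noteq> {}" and U: "\<Union>P = {x. T x = 0}" for P
  proof -
    have "\<forall>C\<in>P. \<exists>z. z \<in> C" using ne by auto
    then obtain z where z: "\<And>C. C \<in> P \<Longrightarrow> z C \<in> C" by metis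
    define s where "s = Max (insert 0 ((\<lambda>C. norm (z C)) ` P))"
    have s0: "s \<ge> 0" unfolding s_def using finP by simp
    have s: "norm (z C) \<le> s" if "C \<in> P" for C
      unfolding s_def using finP that by (intro Max_ge) auto
    let ?B = "cball (0::'a) (s + 1)"
    \<comment> \<open>Voronoi cells: disjoint open neighbourhoods of the parts.\<close>
    define Op where "Op C = {x. \<forall>D\<in>P - {C}. infdist x C < infdist x D}" for C
    have Op_open: "open (Op C)" for C
    proof -
      have "Op C = (\<Inter>D\<in>P - {C}. {x. infdist x C < infdist x D})" unfolding Op_def by auto
      moreover have "open {x. infdist x C < infdist x D}" for D
        by (intro open_Collect_less continuous_intros)
      ultimately show ?thesis using finP by auto
    qed
    have Op_disj: "Op C \<inter> Op D = {}" if "C \<in> P" "D \<in> P" "C \<noteq> D" for C D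
    proof (rule ccontr)
      assume "Op C \<inter> Op D \<noteq> {}"
      then obtain x where x: "x \<in> Op C" "x \<in> Op D" by blast
      have "infdist x C < infdist x D" using x(1) that unfolding Op_def by blast
      moreover have "infdist x D < infdist x C" using x(2) that unfolding Op_def by blast
      ultimately show False by linarith
    qed
    have C_Op: "C \<subseteq> Op C" if C: "C \<in> P" for C
    proof
      fix x assume x: "x \<in> C"
      have "infdist x C < infdist x D" if "D \<in> P - {C}" for D
      proof -
        have "x \<notin> D" using disj C that x unfolding disjoint_def by blast
        then have "infdist x D > 0" using that clo ne by (simp add: infdist_pos_not_in_closed)
        then show ?thesis using x by simp
      qed
      then show "x \<in> Op C" by (simp add: Op_def)
    qed
    \<comment> \<open>The rest of a large ball, where \<open>T\<close> is bounded below by a positive number.\<close>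
    define S where "S = ?B - (\<Union>C\<in>P. Op C)"
    have "compact S" unfolding S_def using Op_open by (intro compact_diff) auto
    have Spos: "T x > 0" if "x \<in> S" for x
    proof -
      have "x \<notin> \<Union>P" using that C_Op unfolding S_def by blast
      then show ?thesis using nonneg[of x] U by (simp add: order_less_le)
    qed
    obtain t where t: "t > 0" "\<And>x. x \<in> S \<Longrightarrow> T x \<ge> t"
    proof (cases "S = {}")
      case True then show ?thesis using that[of 1] by auto
    next
      case False
      from continuous_attains_inf[OF \<open>compact S\<close> this contT] obtain x where "x \<in> S" "\<And>y. y \<in> S \<Longrightarrow> T x \<le> T y"
        by blast
      then show ?thesis using that[of "T x"] Spos by blast
    qed
    \<comment> \<open>On \<open>S\<close> the term \<open>l T\<close> alone exceeds the values of \<open>F\<close> at the points \<open>z C\<close> of the parts.\<close>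
    define l where "l = ((s + 1)\<^sup>2 + 1) / t"
    have l0: "l > 0" unfolding l_def using t by (simp add: add_nonneg_pos)
    define E where "E x = x + (l / 2) *\<^sub>R (\<Sum>b\<in>Basis. T' x b *\<^sub>R b)" for x
    have Eb: "E x \<bullet> b = x \<bullet> b + (l / 2) * T' x b" if "b \<in> Basis" for x b
      unfolding E_def using that by (simp add: inner_left_distrib)
    have "deg_le d (\<lambda>x. E x \<bullet> b)" if "b \<in> Basis" for b
    proof -
      have "deg_le d (\<lambda>x. x \<bullet> b + (l / 2) * T' x b)"
        using that by (intro deg_le_add deg_le_cmul d deg_le_mono[OF deg_le_coordinate d1])
      then show ?thesis using that by (simp add: Eb)
    qed
    from generic_fibre_bound[OF this d1, of "ball 0 (1/4)"]
    obtain a where a: "norm a < 1 / 4" "finite {x. E x = a}" "card {x. E x = a} \<le> N"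
      by (auto simp: N_def)
    have "\<exists>x\<in>Op C. E x = a" if C: "C \<in> P" for C
    proof -
      define F where "F x = (x - a) \<bullet> (x - a) + l * T x" for x
      \<comment> \<open>The minimum of \<open>F\<close> on the closed set \<open>Y\<close> lies inside the cell of \<open>C\<close>, by the choice of \<open>l\<close>,
        and inside the ball, by its distance to \<open>a\<close>; so it is a critical point.\<close>
      define Y where "Y = ?B - (\<Union>D\<in>P - {C}. Op D)"
      have "compact Y" unfolding Y_def using Op_open by (intro compact_diff) auto
      have "z C \<in> Y"
        using s[OF C] z[OF C] C_Op[OF C] Op_disj[OF C] unfolding Y_def by auto
      have contF: "continuous_on Y F" unfolding F_def by (intro continuous_intros contT)
      obtain x where x: "x \<in> Y" "\<And>y. y \<in> Y \<Longrightarrow> F x \<le> F y"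
        using continuous_attains_inf[OF \<open>compact Y\<close> _ contF] \<open>z C \<in> Y\<close> by blast
      have "T (z C) = 0" using z[OF C] C U by blast
      then have "F (z C) = (norm (z C - a))\<^sup>2" by (simp add: F_def power2_norm_eq_inner)
      also have "\<dots> \<le> (s + 1 / 4)\<^sup>2"
        using norm_triangle_ineq4[of "z C" a] s[OF C] a(1) by (intro power_mono) auto
      finally have Fx: "F x \<le> (s + 1 / 4)\<^sup>2" using x(2)[OF \<open>z C \<in> Y\<close>] by linarith
      have "x \<notin> S"
      proof
        assume "x \<in> S"
        then have "l * t \<le> l * T x" using t(2) l0 by simp
        moreover have "l * t = (s + 1)\<^sup>2 + 1" using t(1) by (simp add: l_def)
        moreover have "l * T x \<le> F x" by (simp add: F_def)
        moreover have "(s + 1 / 4)\<^sup>2 \<le> (s + 1)\<^sup>2" using s0 by (intro power_mono) auto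
        ultimately show False using Fx by linarith
      qed
      then have xO: "x \<in> Op C" using x(1) unfolding S_def Y_def by auto
      have xb: "x \<in> ball 0 (s + 1)"
      proof (rule ccontr)
        assume "x \<notin> ball 0 (s + 1)"
        then have "norm (x - a) \<ge> s + 3 / 4" using norm_triangle_ineq2[of x a] a(1) by auto
        then have "(s + 3 / 4)\<^sup>2 \<le> (norm (x - a))\<^sup>2" using s0 by (intro power_mono) auto
        also have "\<dots> \<le> F x" using nonneg[of x] l0 by (simp add: F_def power2_norm_eq_inner)
        finally have "(s + 3 / 4)\<^sup>2 \<le> (s + 1 / 4)\<^sup>2" using Fx by linarith
        then show False using s0 by (simp add: power2_eq_square algebra_simps)
      qed
      have der: "(F has_derivative (\<lambda>v. 2 * ((x - a) \<bullet> v) + l * T' x v)) (at x)"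
        unfolding F_def using T'
        by (auto intro!: derivative_eq_intros simp: inner_commute algebra_simps)
      have "(\<lambda>v. 2 * ((x - a) \<bullet> v) + l * T' x v) = (\<lambda>v. 0)"
      proof (rule differential_zero_maxmin[OF _ _ der])
        show "x \<in> ball 0 (s + 1) \<inter> Op C" using xb xO by blast
        show "open (ball 0 (s + 1) \<inter> Op C)" using Op_open by blast
        have "ball 0 (s + 1) \<inter> Op C \<subseteq> Y" using Op_disj[OF C] unfolding Y_def by auto
        then show "(\<forall>y\<in>ball 0 (s + 1) \<inter> Op C. F y \<le> F x) \<or> (\<forall>y\<in>ball 0 (s + 1) \<inter> Op C. F x \<le> F y)"
          using x(2) by blast
      qed
      then have crit: "2 * ((x - a) \<bullet> v) + l * T' x v = 0" for v by metis
      have "E x \<bullet> b = a \<bullet> b" if "b \<in> Basis" for b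
        using crit[of b] unfolding Eb[OF that] by (simp add: inner_diff_left)
      then show ?thesis using xO euclidean_eqI by blast
    qed
    then obtain x where x: "\<And>C. C \<in> P \<Longrightarrow> x C \<in> Op C \<and> E (x C) = a" by metis
    have "inj_on x P" using x Op_disj by (intro inj_onI) (metis disjoint_iff)
    then have "card P \<le> card {x. E x = a}"
      using x by (intro card_inj_on_le[OF _ _ a(2)]) auto
    then show ?thesis using a(3) by linarith
  qed
  then show ?thesis by (intro exI[of _ N]) blast
qed

text \<open>In a partition with the greatest possible number of parts every part is connected, since it could
  otherwise be split further.\<close>

lemma connected_cover_if_bounded_partitions:
  fixes S :: "'a::topological_space set"
  assumes S: "closed S" "S \<noteq> {}"
    and bound: "\<And>P. finite P \<Longrightarrow> disjoint P \<Longrightarrow> (\<And>C. C \<in> P \<Longrightarrow> closed C \<and> C \<noteq> {}) \<Longrightarrow> \<Union>P = S \<Longrightarrow> card P \<le> N"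
  shows "\<exists>P. finite P \<and> (\<forall>C\<in>P. connected C) \<and> \<Union>P = S"
proof -
  let ?Q = "\<lambda>P. finite P \<and> disjoint P \<and> (\<forall>C\<in>P. closed C \<and> C \<noteq> {}) \<and> \<Union>P = S"
  have 1: "?Q {S}" using S by (simp add: disjoint_def)
  have 2: "\<forall>P. ?Q P \<longrightarrow> card P < Suc N"
  proof (intro allI impI)
    fix P assume "?Q P"
    then have "card P \<le> N" by (intro bound) simp_all
    then show "card P < Suc N" by simp
  qed
  from ex_has_greatest_nat[of ?Q, OF 1 2]
  obtain P where "?Q P \<and> (\<forall>P'. ?Q P' \<longrightarrow> card P' \<le> card P)" by (rule exE)
  then have P: "?Q P" and max: "\<And>P'. ?Q P' \<Longrightarrow> card P' \<le> card P" by simp_all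
  have "connected C" if C: "C \<in> P" for C
  proof (rule ccontr)
    assume "\<not> connected C"
    then obtain A B where AB: "closed A" "closed B" "C \<subseteq> A \<union> B" "A \<inter> B \<inter> C = {}" "A \<inter> C \<noteq> {}" "B \<inter> C \<noteq> {}"
      unfolding connected_closed by blast
    let ?P = "insert (A \<inter> C) (insert (B \<inter> C) (P - {C}))"
    have other: "D \<inter> C = {}" if "D \<in> P - {C}" for D
      using P C that unfolding disjoint_def by blast
    have "A \<inter> C \<notin> P - {C}" "B \<inter> C \<notin> P - {C}" "A \<inter> C \<noteq> B \<inter> C" using AB other by blast+
    moreover have fin: "finite (P - {C})" using P by blast
    ultimately have "card ?P = card (P - {C}) + 2" by (simp add: card_insert_disjoint del: insert_Diff_single)
    moreover have "card P = Suc (card (P - {C}))" using P C by (intro card.remove) blast+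
    ultimately have card: "card ?P = card P + 1" by linarith
    have PU: "\<Union>P = S" and cl: "closed C" using P C by simp_all
    have "(A \<inter> C) \<union> (B \<inter> C) = C" using AB(3) by blast
    moreover have "\<Union>?P = ((A \<inter> C) \<union> (B \<inter> C)) \<union> \<Union>(P - {C})" by auto
    ultimately have "\<Union>?P = S" using C unfolding PU[symmetric] by auto
    moreover have "disjoint ?P"
    proof -
      have "disjoint (P - {C})" using P pairwise_subset by blast
      then show ?thesis using other AB(4) unfolding disjoint_def by auto
    qed
    ultimately have "?Q ?P" using fin P AB(1,2,5,6) cl by (simp add: closed_Int Int_commute)
    from max[OF this] card show False by simp
  qed
  then show ?thesis using P by blast
qed

text \<open>Replacing polynomials by the sum of their squares writes every real algebraic set in this form. The
  members of \<open>P\<close> need not be the components; a finite connected cover is what survives under a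
  continuous map.\<close>

theorem finite_connected_cover_of_algebraic_set:
  fixes T :: "'a::euclidean_space \<Rightarrow> real"
  assumes T: "real_polynomial_function T" and nonneg: "\<And>x. T x \<ge> 0"
  shows "\<exists>P. finite P \<and> (\<forall>C\<in>P. connected C) \<and> \<Union>P = {x. T x = 0}"
proof (cases "{x. T x = 0} = {}")
  case True then show ?thesis by (intro exI[of _ "{}"]) simp
next
  case False
  obtain N where N: "\<And>P. finite P \<and> disjoint P \<and> (\<forall>C\<in>P. closed C \<and> C \<noteq> {}) \<and> \<Union>P = {x. T x = 0} \<Longrightarrow> card P \<le> N"
    using bounded_partitions_of_zero_set[OF assms] by blast
  have "continuous_on UNIV T"
    by (simp add: T continuous_on_polymonial_function flip: real_polynomial_function_eq)
  then have "closed {x. T x = 0}" by (intro closed_Collect_eq continuous_on_const)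
  then show ?thesis
    by (rule connected_cover_if_bounded_partitions[OF _ False, of N]) (rule N, blast)
qed

section \<open>Hermitian forms and isometries\<close>

lemma has_derivative_vec:
  fixes f :: "'a::real_normed_vector \<Rightarrow> ('b::real_normed_vector)^'n"
  assumes "\<And>i. ((\<lambda>x. f x $ i) has_derivative (\<lambda>h. f' h $ i)) F"
  shows "(f has_derivative f') F"
proof -
  have ax: "(\<Sum>i\<in>UNIV. axis i (v $ i)) = v" for v :: "'b^'n"
    by (simp add: vec_eq_iff axis_def if_distrib cong: if_cong)
  have "bounded_linear (axis i :: 'b \<Rightarrow> 'b^'n)" for i
  proof (rule bounded_linear_intro[where K = 1])
    fix x :: 'b
    have "(\<Sum>k\<in>UNIV. (norm (axis i x $ k))\<^sup>2) = (\<Sum>k\<in>UNIV. if k = i then (norm x)\<^sup>2 else 0)"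
      by (rule sum.cong) (auto simp: axis_def)
    then show "norm (axis i x) \<le> norm x * 1" by (simp add: norm_vec_def L2_set_def)
  qed (auto simp: axis_def vec_eq_iff)
  then have "((\<lambda>x. axis i (f x $ i)) has_derivative (\<lambda>h. axis i (f' h $ i))) F" for i
    using assms by (rule bounded_linear.has_derivative)
  then have "((\<lambda>x. \<Sum>i\<in>UNIV. axis i (f x $ i)) has_derivative (\<lambda>h. \<Sum>i\<in>UNIV. axis i (f' h $ i))) F"
    by (rule has_derivative_sum)
  then show ?thesis by (simp add: ax)
qed

lemma sum_option: "(\<Sum>i\<in>UNIV. g i) = g None + (\<Sum>k\<in>UNIV. g (Some k))"
  for g :: "'n::finite option \<Rightarrow> 'b::comm_monoid_add"
  by (simp add: UNIV_option_conv sum.reindex o_def)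

text \<open>Two forms of this kind occur: all signs \<open>1\<close> give the inner product of complex Euclidean space, and
  one negative sign gives the form that defines the group \<^const>\<open>SU_n1\<close>.\<close>

definition herm :: "('a \<Rightarrow> real) \<Rightarrow> complex^'a \<Rightarrow> complex^'a \<Rightarrow> complex"
  where "herm s x y = (\<Sum>i\<in>UNIV. of_real (s i) * x $ i * cnj (y $ i))"

definition herm_isometry :: "('a \<Rightarrow> real) \<Rightarrow> complex^'a^'a \<Rightarrow> bool"
  where "herm_isometry s A \<longleftrightarrow> (\<forall>x y. herm s (A *v x) (A *v y) = herm s x y)"

lemma herm_simps [simp]:
  "herm s (x + x') y = herm s x y + herm s x' y"
  "herm s (x - x') y = herm s x y - herm s x' y"
  "herm s (c *s x) y = c * herm s x y"
  "herm s x (y + y') = herm s x y + herm s x y'"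
  "herm s x (y - y') = herm s x y - herm s x y'"
  "herm s x (c *s y) = cnj c * herm s x y"
  "herm s 0 y = 0" "herm s x 0 = 0"
  by (simp_all add: herm_def algebra_simps sum.distrib sum_subtractf sum_distrib_left)

lemma cnj_herm: "cnj (herm s x y) = herm s y x"
  by (simp add: herm_def mult_ac)

text \<open>The map is \<open>x \<mapsto> x - (\<langle>x, a - b\<rangle> / \<langle>a, a - b\<rangle>) (a - b)\<close>. It is isometric because vectors \<open>a\<close> and \<open>b\<close>
  of the same length satisfy \<open>\<langle>a - b, a - b\<rangle> = 2 Re \<langle>a, a - b\<rangle>\<close>. For the definite form it serves to
  extend isometries, for the indefinite form it moves points of the ball.\<close>

lemma herm_reflection:
  fixes a b :: "complex^'a"
  assumes ab: "herm s a a = herm s b b" and z: "herm s a (a - b) \<noteq> 0"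
  shows "\<exists>A. herm_isometry s A \<and> A *v a = b \<and> (\<forall>x. herm s x (a - b) = 0 \<longrightarrow> A *v x = x)"
proof -
  define w where "w = a - b"
  define z where "z = herm s a w"
  have z0: "z \<noteq> 0" using z by (simp add: z_def w_def)
  define A :: "complex^'a^'a" where
    "A = (\<chi> i j. (if i = j then 1 else 0) - of_real (s j) * cnj (w $ j) * w $ i / z)"
  have Av: "A *v x = x - (herm s x w / z) *s w" for x
  proof -
    have "(A *v x) $ i = x $ i - herm s x w / z * w $ i" for i
    proof -
      have "(A *v x) $ i = (\<Sum>j\<in>UNIV. (if i = j then x $ j else 0) - of_real (s j) * x $ j * cnj (w $ j) * (w $ i / z))"
        unfolding A_def matrix_vector_mult_def by (simp, rule sum.cong) (auto simp: algebra_simps)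
      also have "\<dots> = x $ i - herm s x w * (w $ i / z)"
        by (simp only: sum_subtractf herm_def sum_distrib_right) simp
      finally show ?thesis by simp
    qed
    then show ?thesis by (simp add: vec_eq_iff)
  qed
  have wa: "herm s w a = cnj z" by (simp add: z_def cnj_herm)
  have ww: "herm s w w = z + cnj z"
  proof -
    have "herm s w w = z - herm s b w" unfolding z_def by (simp add: w_def)
    moreover have "herm s b w = - cnj z" unfolding wa[symmetric] by (simp add: w_def ab)
    ultimately show ?thesis by simp
  qed
  have "herm s (A *v x) (A *v y) = herm s x y" for x y
  proof -
    have yw: "cnj (herm s y w) = herm s w y" by (rule cnj_herm)
    have "herm s (x - c *s w) (y - d *s w) = herm s x y - cnj d * herm s x w - c * herm s w y
        + c * cnj d * (z + cnj z)" for c d by (simp add: ww algebra_simps)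
    then have "herm s (A *v x) (A *v y) = herm s x y
        - cnj (herm s y w / z) * herm s x w - herm s x w / z * herm s w y
        + herm s x w / z * cnj (herm s y w / z) * (z + cnj z)"
      unfolding Av .
    also have "\<dots> = herm s x y"
    proof -
      have "H - q / z' * p - p / z * q + p / z * (q / z') * (z + z') = H" if "z' \<noteq> 0" for p q H z' :: complex
        using z0 that by (simp add: field_simps)
      then show ?thesis unfolding complex_cnj_divide yw using z0 complex_cnj_zero_iff by blast
    qed
    finally show ?thesis .
  qed
  moreover have "A *v a = b"
  proof -
    have "herm s a w / z = 1" using z0 by (simp add: z_def)
    then show ?thesis unfolding Av by (simp add: w_def)
  qed
  moreover have "A *v x = x" if "herm s x (a - b) = 0" for x
    using that unfolding Av w_def[symmetric] by simp
  ultimately show ?thesis unfolding herm_isometry_def by blast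
qed

lemma herm_isometry_mat1 [simp]: "herm_isometry s (mat 1)"
  by (simp add: herm_isometry_def)

lemma herm_isometry_mult: "herm_isometry s A \<Longrightarrow> herm_isometry s B \<Longrightarrow> herm_isometry s (A ** B)"
  by (simp add: herm_isometry_def matrix_vector_mul_assoc[symmetric])

lemma herm_axis_right: "herm s x (axis j 1) = of_real (s j) * x $ j"
proof -
  have "herm s x (axis j 1) = (\<Sum>i\<in>UNIV. if i = j then of_real (s i) * x $ i else 0)"
    unfolding herm_def by (rule sum.cong) (auto simp: axis_def)
  then show ?thesis by simp
qed

lemma matrix_vector_axis: "(A *v axis j 1) $ i = (A $ i $ j :: 'c::comm_semiring_1)"
proof -
  have "(A *v axis j 1) $ i = (\<Sum>k\<in>UNIV. if k = j then A $ i $ k else 0)"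
    unfolding matrix_vector_mult_def vec_lambda_beta by (rule sum.cong) (auto simp: axis_def)
  then show ?thesis by simp
qed

lemma herm_isometry_inverse:
  fixes A :: "complex^'a^'a"
  assumes A: "herm_isometry s A" and s: "\<And>i. s i \<noteq> 0"
  shows "\<exists>B. herm_isometry s B \<and> A ** B = mat 1 \<and> B ** A = mat 1"
proof -
  have "x = 0" if "A *v x = 0" for x
  proof -
    have "herm s x (axis j 1) = herm s (A *v x) (A *v axis j 1)" for j
      using A by (simp add: herm_isometry_def)
    then have "of_real (s j) * x $ j = 0" for j using that by (simp add: herm_axis_right)
    then show ?thesis using s by (simp add: vec_eq_iff)
  qed
  then obtain B where B: "B ** A = mat 1" using matrix_left_invertible_ker[of A] by blast
  then have AB: "A ** B = mat 1" by (simp add: matrix_left_right_inverse)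
  have "herm s (B *v x) (B *v y) = herm s x y" for x y
  proof -
    have "herm s (B *v x) (B *v y) = herm s (A *v (B *v x)) (A *v (B *v y))"
      using A by (simp add: herm_isometry_def)
    then show ?thesis by (simp add: matrix_vector_mul_assoc AB)
  qed
  then show ?thesis using B AB unfolding herm_isometry_def by blast
qed

subsection \<open>Unitary extension\<close>

abbreviation cinner :: "complex^'a \<Rightarrow> complex^'a \<Rightarrow> complex"
  where "cinner \<equiv> herm (\<lambda>_. 1)"

lemma cinner_self: "cinner x x = of_real ((norm x)\<^sup>2)"
  unfolding herm_def norm_vec_def L2_set_def
  by (simp add: real_sqrt_pow2 sum_nonneg complex_norm_square del: of_real_power)

lemma Re_cinner: "Re (cinner x y) = x \<bullet> y"
  by (simp add: herm_def inner_vec_def inner_complex_def)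

text \<open>The vectors are matched one after the other. A reflection that moves the next vector to its place
  fixes the vectors that are already matched: equality of the Gram matrices makes them orthogonal to
  the difference.\<close>

lemma finite_gram_unitary:
  fixes g h :: "'i \<Rightarrow> complex^'m"
  assumes "finite I" "\<And>x y. cinner (g x) (g y) = cinner (h x) (h y)"
  shows "\<exists>U. herm_isometry (\<lambda>_. 1) U \<and> (\<forall>x\<in>I. U *v h x = g x)"
  using assms(1)
proof induction
  case empty show ?case by (intro exI[of _ "mat 1"]) simp
next
  case (insert k I)
  then obtain U where U: "herm_isometry (\<lambda>_. 1) U" "\<And>x. x \<in> I \<Longrightarrow> U *v h x = g x" by blast
  let ?a = "U *v h k" and ?b = "g k"
  have iso: "cinner (U *v x) (U *v y) = cinner x y" for x y using U(1) by (simp add: herm_isometry_def)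
  show ?case
  proof (cases "?a = ?b")
    case True then show ?thesis using U by auto
  next
    case False
    have ab: "cinner ?a ?a = cinner ?b ?b" by (simp add: iso assms(2))
    have "cinner ?a (?a - ?b) \<noteq> 0"
    proof
      assume 0: "cinner ?a (?a - ?b) = 0"
      then have 1: "cinner ?a ?a = cinner ?a ?b" by simp
      then have "cinner ?b ?a = cinner ?a ?a" by (metis cnj_herm)
      with 0 1 ab have "cinner (?a - ?b) (?a - ?b) = 0" by simp
      then show False using False by (simp add: cinner_self del: herm_simps)
    qed
    from herm_reflection[OF ab this] obtain V where
      V: "herm_isometry (\<lambda>_. 1) V" "V *v ?a = ?b" "\<And>x. cinner x (?a - ?b) = 0 \<Longrightarrow> V *v x = x"
      by blast
    have "V *v g x = g x" if "x \<in> I" for x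
    proof (rule V(3))
      have "cinner (g x) ?a = cinner (h x) (h k)" using U(2)[OF that, symmetric] by (simp add: iso)
      then show "cinner (g x) (?a - ?b) = 0" by (simp add: assms(2))
    qed
    then have "(V ** U) *v h x = g x" if "x \<in> insert k I" for x
      using that V(2) U(2) by (auto simp: matrix_vector_mul_assoc[symmetric])
    then show ?thesis using herm_isometry_mult[OF V(1) U(1)] by blast
  qed
qed

lemma compact_unitary: "compact {U :: complex^'m^'m. herm_isometry (\<lambda>_. 1) U}"
proof -
  have "norm U \<le> real CARD('m)" if U: "herm_isometry (\<lambda>_. 1) U" for U :: "complex^'m^'m"
  proof -
    have row: "norm (U $ i $ j) \<le> 1" for i j
    proof -
      have "cinner (U *v axis j 1) (U *v axis j 1) = cinner (axis j 1) (axis j 1)"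
        using U by (simp add: herm_isometry_def)
      also have "\<dots> = 1" by (simp only: herm_axis_right) (simp add: axis_def)
      finally have "norm (U *v axis j 1) = 1" unfolding cinner_self
        by (metis of_real_eq_1_iff norm_ge_zero power2_eq_1_iff zero_le_one abs_of_nonneg abs_minus_cancel abs_1)
      then show ?thesis using component_le_norm_cart norm_nth_le
        by (metis matrix_vector_axis Finite_Cartesian_Product.norm_nth_le)
    qed
    have "(norm U)\<^sup>2 = (\<Sum>i\<in>UNIV. \<Sum>j\<in>UNIV. (norm (U $ i $ j))\<^sup>2)"
      unfolding norm_vec_def L2_set_def by (simp add: sum_nonneg)
    also have "\<dots> \<le> (\<Sum>i\<in>(UNIV::'m set). \<Sum>j\<in>(UNIV::'m set). 1)"
      using row by (intro sum_mono) (simp add: power_le_one)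
    also have "\<dots> = (real CARD('m))\<^sup>2" by (simp add: power2_eq_square)
    finally show ?thesis by (rule power2_le_imp_le) simp
  qed
  then have "bounded {U :: complex^'m^'m. herm_isometry (\<lambda>_. 1) U}"
    unfolding bounded_iff by blast
  moreover have "closed {U :: complex^'m^'m. herm_isometry (\<lambda>_. 1) U}"
    unfolding herm_isometry_def herm_def matrix_vector_mult_def
    by (intro closed_Collect_all closed_Collect_eq continuous_intros)
  ultimately show ?thesis by (simp add: compact_eq_bounded_closed)
qed

text \<open>By compactness of the unitary group, solutions for all finite subfamilies give a common solution.\<close>

lemma gram_unitary:
  fixes g h :: "'i \<Rightarrow> complex^'m"
  assumes "\<And>x y. cinner (g x) (g y) = cinner (h x) (h y)"
  shows "\<exists>U. herm_isometry (\<lambda>_. 1) U \<and> (\<forall>x. U *v h x = g x)"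
proof -
  have "{U :: complex^'m^'m. herm_isometry (\<lambda>_. 1) U} \<inter> (\<Inter>x\<in>UNIV. {U. U *v h x = g x}) \<noteq> {}"
  proof (rule compact_imp_fip_image[OF compact_unitary])
    show "closed {U. U *v h x = g x}" for x
      unfolding matrix_vector_mult_def by (intro closed_Collect_eq continuous_intros)
    show "{U :: complex^'m^'m. herm_isometry (\<lambda>_. 1) U} \<inter> (\<Inter>x\<in>I'. {U. U *v h x = g x}) \<noteq> {}" if "finite I'" for I'
      using finite_gram_unitary[OF that, of g h] assms by blast
  qed
  then show ?thesis by blast
qed

subsection \<open>The linear fractional action\<close>

definition sg :: "'n option \<Rightarrow> real" where "sg i = (if i = None then -1 else 1)"

abbreviation lform :: "complex^('n::finite option) \<Rightarrow> complex^('n option) \<Rightarrow> complex"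
  where "lform \<equiv> herm sg"

lemma sg_nonzero [simp]: "sg i \<noteq> 0" by (simp add: sg_def)

lemma adjoint_sig_iff:
  fixes A :: "'n::finite hmat"
  shows "adjoint_mat A ** sig_mat ** A = sig_mat \<longleftrightarrow> herm_isometry sg A"
proof -
  have lf: "lform x (B *v y) = (\<Sum>i\<in>UNIV. \<Sum>j\<in>UNIV. x $ i * (of_real (sg i) * cnj (B $ i $ j)) * cnj (y $ j))"
    for x y :: "complex^('n option)" and B
    unfolding herm_def matrix_vector_mult_def
    by (simp add: sum_distrib_left mult_ac)
  have entry: "(adjoint_mat A ** sig_mat ** A) $ i $ j = lform (A *v axis j 1) (A *v axis i 1)" for i j
  proof -
    have "(adjoint_mat A ** sig_mat ** A) $ i $ j =
      (\<Sum>k\<in>UNIV. (\<Sum>l\<in>UNIV. if l = k then cnj (A $ l $ i) * of_real (sg l) else 0) * A $ k $ j)"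
      unfolding matrix_matrix_mult_def adjoint_mat_def sig_mat_def sg_def
      by (simp, intro sum.cong) (auto simp: if_distrib cong: if_cong)
    also have "\<dots> = (\<Sum>k\<in>UNIV. cnj (A $ k $ i) * of_real (sg k) * A $ k $ j)" by simp
    also have "\<dots> = lform (A *v axis j 1) (A *v axis i 1)"
      by (simp add: herm_def matrix_vector_axis mult_ac)
    finally show ?thesis .
  qed
  have sig: "sig_mat $ i $ j = lform (axis j 1) (axis i 1)" for i j :: "'n option"
    by (simp only: herm_axis_right) (auto simp: sig_mat_def sg_def axis_def)
  have exp: "x = (\<Sum>i\<in>UNIV. x $ i *s axis i 1)" for x :: "complex^('n option)"
    by (simp add: vec_eq_iff axis_def if_distrib cong: if_cong)
  have hsum: "lform (\<Sum>i\<in>I. c i *s u i) y = (\<Sum>i\<in>I. c i * lform (u i) y)"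
    "lform y (\<Sum>i\<in>I. c i *s u i) = (\<Sum>i\<in>I. cnj (c i) * lform y (u i))"
    for I c y and u :: "_ \<Rightarrow> complex^('n option)"
    by (induction I rule: infinite_finite_induct) auto
  have Asum: "A *v x = (\<Sum>i\<in>UNIV. x $ i *s (A *v axis i 1))" for x
  proof -
    have "A *v x = (\<Sum>i\<in>UNIV. A *v (x $ i *s axis i 1))"
      by (subst exp) (simp add: vec.linear_sum)
    then show ?thesis by (simp add: vector_scalar_commute)
  qed
  show ?thesis
  proof
    assume e: "adjoint_mat A ** sig_mat ** A = sig_mat"
    have ax: "lform (A *v axis j 1) (A *v axis i 1) = lform (axis j 1) (axis i 1)" for i j
      using entry[of i j] sig[of i j] e by simp
    show "herm_isometry sg A" unfolding herm_isometry_def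
    proof (intro allI)
      fix x y
      have "lform (A *v x) (A *v y) =
        (\<Sum>j\<in>UNIV. cnj (y $ j) * (\<Sum>i\<in>UNIV. x $ i * lform (A *v axis i 1) (A *v axis j 1)))"
        unfolding Asum[of x] Asum[of y] hsum ..
      also have "\<dots> = lform (\<Sum>i\<in>UNIV. x $ i *s axis i 1) (\<Sum>i\<in>UNIV. y $ i *s axis i 1)"
        unfolding hsum ax ..
      finally show "lform (A *v x) (A *v y) = lform x y" by (simp flip: exp)
    qed
  next
    assume "herm_isometry sg A"
    then show "adjoint_mat A ** sig_mat ** A = sig_mat"
      using entry sig by (simp add: herm_isometry_def vec_eq_iff)
  qed
qed

lemma SU_n1_iff: "A \<in> SU_n1 \<longleftrightarrow> det A = 1 \<and> herm_isometry sg A"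
  by (simp add: SU_n1_def adjoint_sig_iff)

lemma lform_homog: "lform (homog a) (homog b) = cinner a b - 1"
  by (simp add: herm_def sum_option homog_def sg_def)

text \<open>On the diagonal this is the defining function of the ball. Up to the factors in
  \<open>kform_ball_action\<close> it is invariant under the action.\<close>

definition kform :: "complex^'n \<Rightarrow> complex^'n \<Rightarrow> complex"
  where "kform a b = 1 - cinner a b"

lemma norm_cinner_le: "norm (cinner x y) \<le> norm x * norm y"
proof (cases "cinner x y = 0")
  case False
  define c where "c = cnj (sgn (cinner x y))"
  have "norm c = 1" using False by (simp add: c_def norm_sgn)
  then have cc: "cnj c * c = 1" "c * cnj c = 1"
    using complex_norm_square[of c] by (simp_all add: mult.commute)
  have "cinner x y * cnj (cinner x y) = of_real (norm (cinner x y)) * of_real (norm (cinner x y))"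
    unfolding complex_norm_square[symmetric] by (simp add: power2_eq_square)
  then have "cinner (c *s x) y = of_real (norm (cinner x y))"
    using False by (simp add: c_def sgn_eq mult.commute divide_simps)
  then have "norm (cinner x y) = (c *s x) \<bullet> y" using Re_cinner[of "c *s x" y] by simp
  also have "\<dots> \<le> norm (c *s x) * norm y" by (rule norm_cauchy_schwarz)
  also have "norm (c *s x) = norm x"
  proof -
    have "complex_of_real ((norm (c *s x))\<^sup>2) = of_real ((norm x)\<^sup>2)"
      unfolding cinner_self[symmetric] using cc by (simp add: mult.assoc[symmetric])
    then show ?thesis using power2_eq_imp_eq by (metis norm_ge_zero of_real_eq_iff)
  qed
  finally show ?thesis .
qed simp

text \<open>On the ball the form is negative at \<^term>\<open>homog z\<close>, hence at its image, and a vector on which the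
  form is negative is a nonzero multiple of the homogeneous coordinates of a point of the ball.\<close>

lemma isometry_denominator:
  fixes A :: "'n::finite hmat"
  assumes A: "herm_isometry sg A" and z: "z \<in> \<bbbB>"
  shows "(A *v homog z) $ None \<noteq> 0"
    and "(\<chi> k. (A *v homog z) $ Some k / (A *v homog z) $ None) \<in> \<bbbB>"
proof -
  let ?y = "A *v homog z"
  have "lform ?y ?y = lform (homog z) (homog z)" using A by (simp add: herm_isometry_def)
  also have "\<dots> = of_real ((norm z)\<^sup>2 - 1)" by (simp add: lform_homog cinner_self)
  finally have 1: "lform ?y ?y = of_real ((norm z)\<^sup>2 - 1)" .
  have 2: "lform ?y ?y = of_real ((\<Sum>k\<in>UNIV. (norm (?y $ Some k))\<^sup>2) - (norm (?y $ None))\<^sup>2)"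
    by (simp add: herm_def sum_option sg_def complex_norm_square del: of_real_power)
  have "(norm z)\<^sup>2 < 1" using z by (simp add: power_less_one_iff abs_square_less_1)
  with 1 2 have lt: "(\<Sum>k\<in>UNIV. (norm (?y $ Some k))\<^sup>2) < (norm (?y $ None))\<^sup>2"
    by (metis of_real_eq_iff diff_less_0_iff_less)
  then have pos: "(norm (?y $ None))\<^sup>2 > 0" by (meson le_less_trans sum_nonneg zero_le_power2)
  then show ne: "?y $ None \<noteq> 0" by auto
  have "(norm (\<chi> k. ?y $ Some k / ?y $ None))\<^sup>2 = (\<Sum>k\<in>UNIV. (norm (?y $ Some k))\<^sup>2) / (norm (?y $ None))\<^sup>2"
    by (simp add: norm_vec_def L2_set_def sum_nonneg norm_divide power_divide sum_divide_distrib)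
  also have "\<dots> < 1" using lt pos by simp
  finally have "norm (\<chi> k. ?y $ Some k / ?y $ None) < 1" by (simp add: power_less_one_iff abs_square_less_1)
  then show "(\<chi> k. ?y $ Some k / ?y $ None) \<in> \<bbbB>" by simp
qed

lemma ball_action_mem:
  "herm_isometry sg A \<Longrightarrow> z \<in> \<bbbB> \<Longrightarrow> ball_action A z \<in> \<bbbB>"
  unfolding ball_action_def using isometry_denominator(2) by simp

lemma homog_ball_action:
  assumes "herm_isometry sg A" "z \<in> \<bbbB>"
  shows "A *v homog z = (A *v homog z) $ None *s homog (ball_action A z)"
proof -
  have "(A *v homog z) $ i = (A *v homog z) $ None * homog (ball_action A z) $ i" for i
  proof (cases i)
    case None then show ?thesis by (simp add: homog_def)
  next
    case (Some k)
    have "ball_action A z $ k = (A *v homog z) $ Some k / (A *v homog z) $ None"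
      using assms(2) by (simp add: ball_action_def)
    moreover have "homog w $ Some k = w $ k" for w :: "complex^'a" by (simp add: homog_def)
    ultimately show ?thesis using isometry_denominator(1)[OF assms] unfolding Some by (simp only:) simp
  qed
  then show ?thesis unfolding vec_eq_iff vector_smult_component by (rule allI)
qed

lemma ball_action_eqI:
  assumes "A *v homog z = c *s homog w" "c \<noteq> 0" "z \<in> \<bbbB>"
  shows "ball_action A z = w"
proof -
  have "(A *v homog z) $ None = c" "(A *v homog z) $ Some k = c * w $ k" for k
    unfolding assms(1) by (simp_all add: homog_def)
  then show ?thesis using assms(2,3) by (simp add: ball_action_def vec_eq_iff)
qed

lemma ball_action_mult:
  assumes "herm_isometry sg A" "herm_isometry sg B" "z \<in> \<bbbB>"
  shows "ball_action (A ** B) z = ball_action A (ball_action B z)"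
proof (rule ball_action_eqI[OF _ _ assms(3)])
  let ?w = "ball_action B z"
  let ?c = "(B *v homog z) $ None" and ?d = "(A *v homog ?w) $ None"
  have w: "?w \<in> \<bbbB>" by (rule ball_action_mem[OF assms(2,3)])
  show "?c * ?d \<noteq> 0"
    using isometry_denominator(1)[OF assms(1) w] isometry_denominator(1)[OF assms(2,3)] by simp
  have "(A ** B) *v homog z = A *v (?c *s homog ?w)"
    unfolding matrix_vector_mul_assoc[symmetric]
    by (rule arg_cong[where f = "(*v) A", OF homog_ball_action[OF assms(2,3)]])
  also have "\<dots> = ?c *s (A *v homog ?w)" by (simp add: vector_scalar_commute)
  also have "A *v homog ?w = ?d *s homog (ball_action A ?w)" by (rule homog_ball_action[OF assms(1) w])
  finally show "(A ** B) *v homog z = (?c * ?d) *s homog (ball_action A ?w)" by simp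
qed

lemma ball_action_mat1: "z \<in> \<bbbB> \<Longrightarrow> ball_action (mat 1) z = z"
  by (rule ball_action_eqI[where c = 1]) simp_all

lemma mat_scale: "mat c *v v = c *s (v :: 'c::comm_semiring_1^'a)"
proof -
  have "(mat c *v v) $ i = (\<Sum>j\<in>UNIV. if j = i then c * v $ j else 0)" for i
    unfolding matrix_vector_mult_def mat_def vec_lambda_beta by (rule sum.cong) auto
  then show ?thesis by (simp add: vec_eq_iff)
qed

lemma ball_action_scale:
  assumes "c \<noteq> 0"
  shows "ball_action (mat c ** A) = ball_action A"
proof -
  have "((mat c ** A) *v v) = c *s (A *v v)" for v
    by (simp add: matrix_vector_mul_assoc[symmetric] mat_scale)
  then show ?thesis using assms unfolding ball_action_def by (intro restrict_ext) simp
qed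

text \<open>The form is invariant in homogeneous coordinates, and the denominators measure how far the image of
  \<^term>\<open>homog z\<close> is from being normalised.\<close>

lemma kform_ball_action:
  assumes A: "herm_isometry sg A" and ab: "a \<in> \<bbbB>" "b \<in> \<bbbB>"
  shows "kform a b = (A *v homog a) $ None * cnj ((A *v homog b) $ None) * kform (ball_action A a) (ball_action A b)"
proof -
  let ?c = "(A *v homog a) $ None" and ?d = "(A *v homog b) $ None"
  have "lform (homog a) (homog b) = lform (A *v homog a) (A *v homog b)"
    using A by (simp add: herm_isometry_def)
  also have "\<dots> = lform (?c *s homog (ball_action A a)) (?d *s homog (ball_action A b))"
    by (rule arg_cong2[where f = lform, OF homog_ball_action[OF A ab(1)] homog_ball_action[OF A ab(2)]])
  finally show ?thesis by (simp add: lform_homog kform_def algebra_simps)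
qed

lemma sig_entry: "(sig_mat ** A) $ i $ j = of_real (sg i) * A $ i $ j" "(A ** sig_mat) $ i $ j = A $ i $ j * of_real (sg j)"
proof -
  have "(sig_mat ** A) $ i $ j = (\<Sum>k\<in>UNIV. if k = i then of_real (sg i) * A $ k $ j else 0)"
    unfolding matrix_matrix_mult_def sig_mat_def sg_def vec_lambda_beta by (rule sum.cong) auto
  then show "(sig_mat ** A) $ i $ j = of_real (sg i) * A $ i $ j" by simp
  have "(A ** sig_mat) $ i $ j = (\<Sum>k\<in>UNIV. if k = j then A $ i $ k * of_real (sg j) else 0)"
    unfolding matrix_matrix_mult_def sig_mat_def sg_def vec_lambda_beta by (rule sum.cong) auto
  then show "(A ** sig_mat) $ i $ j = A $ i $ j * of_real (sg j)" by simp
qed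

lemma sig_sig: "sig_mat ** sig_mat = (mat 1 :: 'n::finite hmat)"
  by (simp add: vec_eq_iff sig_entry) (simp add: sig_mat_def mat_def sg_def)

lemma det_mat: "det (mat c :: complex^'a^'a) = c ^ CARD('a)"
  by (subst det_diagonal) (auto simp: mat_def)

lemma herm_isometry_unit_scalar:
  assumes "norm c = 1" "herm_isometry s A"
  shows "herm_isometry s (mat c ** A)"
proof -
  have "cnj c * c = 1" using assms(1) complex_norm_square[of c] by (simp add: mult.commute)
  then show ?thesis using assms(2)
    by (simp add: herm_isometry_def matrix_vector_mul_assoc[symmetric] mat_scale mult.assoc[symmetric])
qed

text \<open>The determinant has absolute value one, and dividing by a root of it changes neither the form nor the
  action.\<close>

lemma isometry_to_SU:
  fixes A :: "'n::finite hmat"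
  assumes A: "herm_isometry sg A"
  shows "\<exists>B\<in>SU_n1. ball_action B = ball_action A"
proof -
  let ?N = "CARD('n option)" and ?d = "det A"
  have adj: "det (adjoint_mat A) = cnj ?d"
  proof -
    have "adjoint_mat A = transpose (\<chi> i j. cnj (A $ i $ j))"
      by (simp add: adjoint_mat_def transpose_def)
    then have "det (adjoint_mat A) = det (\<chi> i j. cnj (A $ i $ j))" by (simp add: det_transpose)
    also have "\<dots> = cnj ?d" by (simp add: det_def)
    finally show ?thesis .
  qed
  have "det (sig_mat :: 'n hmat) * det (sig_mat :: 'n hmat) = 1"
    by (metis det_I det_mul sig_sig)
  then have sig0: "det (sig_mat :: 'n hmat) \<noteq> 0" by auto
  have "det (adjoint_mat A ** sig_mat ** A) = det (sig_mat :: 'n hmat)"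
    using A by (simp add: adjoint_sig_iff[symmetric])
  then have "cnj ?d * det (sig_mat :: 'n hmat) * ?d = det (sig_mat :: 'n hmat)"
    by (simp only: det_mul adj)
  then have "det (sig_mat :: 'n hmat) * (?d * cnj ?d) = det (sig_mat :: 'n hmat) * 1"
    by (simp add: mult_ac)
  then have dd: "?d * cnj ?d = 1" using sig0 mult_left_cancel by blast
  then have d0: "?d \<noteq> 0" by auto
  define c where "c = exp (Ln (1 / ?d) / of_nat ?N)"
  have cN: "c ^ ?N = 1 / ?d"
  proof -
    have "c ^ ?N = exp (of_nat ?N * (Ln (1 / ?d) / of_nat ?N))" unfolding c_def by (rule exp_of_nat_mult[symmetric])
    also have "of_nat ?N * (Ln (1 / ?d) / of_nat ?N) = Ln (1 / ?d)"
    proof -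
      have "of_nat ?N \<noteq> (0 :: complex)" unfolding of_nat_eq_0_iff by simp
      then show ?thesis by (subst times_divide_eq_right) (rule nonzero_mult_div_cancel_left)
    qed
    finally show ?thesis using d0 by simp
  qed
  have "of_real ((norm ?d)\<^sup>2) = complex_of_real 1" using dd by (simp add: complex_norm_square del: of_real_power)
  then have "(norm ?d)\<^sup>2 = 1" by (simp only: of_real_eq_iff)
  then have "norm ?d = 1 \<or> norm ?d = -1" by (simp only: power2_eq_1_iff)
  then have "norm ?d = 1" using norm_ge_zero[of ?d] by linarith
  then have "norm c ^ ?N = 1 ^ ?N" unfolding norm_power[symmetric] cN by (simp add: norm_divide)
  then have nc: "norm c = 1" by (rule power_eq_imp_eq_base) simp_all
  have "det (mat c ** A) = 1" using cN d0 unfolding det_mul det_mat by simp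
  moreover have "herm_isometry sg (mat c ** A)" by (rule herm_isometry_unit_scalar[OF nc A])
  moreover have "c \<noteq> 0" using nc by auto
  ultimately show ?thesis using ball_action_scale unfolding Bex_def SU_n1_iff by blast
qed

section \<open>Automorphisms of the ball are linear fractional\<close>

lemma homog_affine: "(A *v homog z) $ i = A $ i $ None + (\<Sum>j\<in>UNIV. A $ i $ Some j * z $ j)"
  by (simp add: matrix_vector_mult_def sum_option homog_def)

lemma homog_affine_derivative:
  "((\<lambda>z. (A *v homog z) $ i) has_derivative (\<lambda>h. \<Sum>j\<in>UNIV. A $ i $ Some j * h $ j)) (at z)"
  unfolding homog_affine
  by (auto intro!: derivative_eq_intros bounded_linear_imp_has_derivative bounded_linear_vec_nth)

lemma ball_action_holomorphic:
  fixes A :: "'n::finite hmat"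
  assumes A: "herm_isometry sg A"
  shows "holomorphic_map_on (ball_action A) \<bbbB>"
  unfolding holomorphic_map_on_def
proof
  fix z :: "complex^'n" assume z: "z \<in> \<bbbB>"
  let ?L = "\<lambda>i (h :: complex^'n). \<Sum>j\<in>UNIV. A $ i $ Some j * h $ j"
  let ?y = "\<lambda>z i. (A *v homog z) $ i"
  have y0: "?y z None \<noteq> 0" by (rule isometry_denominator(1)[OF A z])
  define M :: "complex^'n^'n" where
    "M = (\<chi> k j. A $ Some k $ Some j / ?y z None - ?y z (Some k) * A $ None $ Some j / (?y z None * ?y z None))"
  have Mh: "(M *v h) $ k = ?L (Some k) h / ?y z None - ?y z (Some k) * ?L None h / (?y z None * ?y z None)" for h k
  proof -
    have "(\<Sum>j\<in>UNIV. (a j / y - c * b j / d) * h $ j) = (\<Sum>j\<in>UNIV. a j * h $ j) / y - c * (\<Sum>j\<in>UNIV. b j * h $ j) / d"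
      for a b :: "'n \<Rightarrow> complex" and c d y
      by (simp add: sum_subtractf sum_divide_distrib sum_distrib_left algebra_simps)
    then show ?thesis unfolding M_def matrix_vector_mult_def vec_lambda_beta .
  qed
  have "((\<lambda>z. \<chi> k. ?y z (Some k) / ?y z None) has_derivative (*v) M) (at z)"
  proof (rule has_derivative_vec)
    fix k
    have "((\<lambda>z. ?y z (Some k) / ?y z None) has_derivative
        (\<lambda>h. (?L (Some k) h * ?y z None - ?y z (Some k) * ?L None h) / (?y z None * ?y z None))) (at z)"
      by (rule has_derivative_divide'[OF homog_affine_derivative homog_affine_derivative y0])
    moreover have "(?L (Some k) h * ?y z None - ?y z (Some k) * ?L None h) / (?y z None * ?y z None) = (M *v h) $ k" for h
      unfolding Mh using y0 by (simp add: diff_divide_distrib)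
    ultimately show "((\<lambda>z. (\<chi> k. ?y z (Some k) / ?y z None) $ k) has_derivative (\<lambda>h. (M *v h) $ k)) (at z)"
      by simp
  qed
  then have "(ball_action A has_derivative (*v) M) (at z)"
    by (rule has_derivative_transform_within_open[OF _ _ z]) (simp_all add: ball_action_def)
  then show "\<exists>M. (ball_action A has_derivative (*v) M) (at z)" by blast
qed

lemma ball_action_aut:
  assumes A: "herm_isometry sg A"
  shows "ball_action A \<in> ball_aut"
proof -
  obtain B where B: "herm_isometry sg B" "A ** B = mat 1" "B ** A = mat 1"
    using herm_isometry_inverse[OF A] by auto
  have AB: "ball_action A (ball_action B z) = z" "ball_action B (ball_action A z) = z" if "z \<in> \<bbbB>" for z
    using ball_action_mult[OF A B(1) that] ball_action_mult[OF B(1) A that] ball_action_mat1[OF that]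
    by (simp_all add: B)
  have bij: "bij_betw (ball_action A) \<bbbB> \<bbbB>"
    by (rule bij_betw_byWitness[where f' = "ball_action B"])
      (use AB ball_action_mem[OF A] ball_action_mem[OF B(1)] in auto)
  have "holomorphic_map_on (inv_into \<bbbB> (ball_action A)) \<bbbB>"
  proof (rule holomorphic_map_on_cong[OF open_ball ball_action_holomorphic[OF B(1)]])
    fix z :: "complex^'a" assume z: "z \<in> \<bbbB>"
    show "ball_action B z = inv_into \<bbbB> (ball_action A) z"
      by (rule inv_into_f_eq[symmetric, OF bij_betw_imp_inj_on[OF bij] ball_action_mem[OF B(1) z] AB(1)[OF z]])
  qed
  moreover have "ball_action A \<in> Bij \<bbbB>" using bij by (simp add: Bij_def ball_action_def)
  ultimately show ?thesis using ball_action_holomorphic[OF A] by (simp add: ball_aut_def)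
qed

text \<open>The multiple \<open>?v\<close> of \<^term>\<open>homog a\<close> is scaled to have the same length as \<^term>\<open>homog 0\<close>; a reflection
  moves the one to the other.\<close>

lemma isometry_moving_zero:
  fixes a :: "complex^'n"
  assumes a: "a \<in> \<bbbB>"
  shows "\<exists>A. herm_isometry sg A \<and> ball_action A 0 = a"
proof (cases "a = 0")
  case True
  then show ?thesis by (intro exI[of _ "mat 1"]) (simp add: ball_action_mat1)
next
  case False
  define s where "s = 1 / sqrt (1 - (norm a)\<^sup>2)"
  have n1: "0 < 1 - (norm a)\<^sup>2" "1 - (norm a)\<^sup>2 < 1"
    using a False by (simp_all add: abs_square_less_1)
  then have "sqrt (1 - (norm a)\<^sup>2) > 0" "sqrt (1 - (norm a)\<^sup>2) < 1" by simp_all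
  then have s1: "s > 1" by (simp add: s_def)
  have ss: "s * s * (1 - (norm a)\<^sup>2) = 1" using n1 by (simp add: s_def)
  let ?v = "of_real s *s homog a"
  have hv: "lform (homog 0) ?v = - of_real s" by (simp add: lform_homog)
  have vv: "lform ?v ?v = - 1"
  proof -
    have "lform ?v ?v = of_real (s * s * ((norm a)\<^sup>2 - 1))" by (simp add: lform_homog cinner_self)
    also have "s * s * ((norm a)\<^sup>2 - 1) = - (s * s * (1 - (norm a)\<^sup>2))"
      by (simp only: mult_minus_right[symmetric] minus_diff_eq)
    also have "\<dots> = - 1" by (simp only: ss)
    finally show ?thesis by simp
  qed
  have "lform (homog (0 :: complex^'n)) (homog 0) = lform ?v ?v" using vv by (simp add: lform_homog)
  moreover have "lform (homog 0) (homog 0 - ?v) \<noteq> 0"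
  proof -
    have "lform (homog 0) (homog 0 - ?v) = of_real (s - 1)"
      unfolding herm_simps(5) hv by (simp add: lform_homog)
    then show ?thesis using s1 by simp
  qed
  ultimately obtain A where A: "herm_isometry sg A" "A *v homog 0 = ?v"
    using herm_reflection by blast
  then have "ball_action A 0 = a" using s1 by (intro ball_action_eqI[OF A(2)]) auto
  then show ?thesis using A by blast
qed

lemma isometry_moving_to_zero:
  fixes a :: "complex^'n"
  assumes a: "a \<in> \<bbbB>"
  shows "\<exists>A. herm_isometry sg A \<and> ball_action A a = 0"
proof -
  obtain A where A: "herm_isometry sg A" "ball_action A 0 = a" using isometry_moving_zero[OF a] by blast
  obtain B where B: "herm_isometry sg B" "B ** A = mat 1" using herm_isometry_inverse[OF A(1)] by auto
  have "ball_action B a = ball_action (B ** A) 0" unfolding A(2)[symmetric]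
    by (rule ball_action_mult[symmetric, OF B(1) A(1)]) simp
  then have "ball_action B a = 0" using ball_action_mat1[of "0 :: complex^'n"] by (simp add: B(2))
  then show ?thesis using B(1) by blast
qed

text \<open>The unitary maps, embedded as the stabiliser of the origin.\<close>

definition block :: "complex^'n^'n \<Rightarrow> 'n::finite hmat"
  where "block U = (\<chi> i j. case (i, j) of (Some k, Some l) \<Rightarrow> U $ k $ l | (None, None) \<Rightarrow> 1 | _ \<Rightarrow> 0)"

lemma block_mult: "(block U *v v) $ None = v $ None"
  "(block U *v v) $ Some k = (U *v (\<chi> l. v $ Some l)) $ k"
  by (simp_all add: block_def matrix_vector_mult_def sum_option)

lemma block_isometry:
  assumes U: "herm_isometry (\<lambda>_. 1) U"
  shows "herm_isometry sg (block U)"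
proof -
  have l: "lform x y = cinner (\<chi> k. x $ Some k) (\<chi> k. y $ Some k) - x $ None * cnj (y $ None)"
    for x y :: "complex^('a option)"
    by (simp add: herm_def sum_option sg_def)
  have "(\<chi> k. (block U *v v) $ Some k) = U *v (\<chi> l. v $ Some l)" for v
    by (simp add: vec_eq_iff block_mult)
  then show ?thesis using U unfolding herm_isometry_def l block_mult(1) by simp
qed

lemma ball_action_block:
  assumes z: "z \<in> \<bbbB>"
  shows "ball_action (block U) z = U *v z"
proof (rule ball_action_eqI[OF _ _ z, where c = 1])
  have "(\<chi> l. homog z $ Some l) = z" by (simp add: homog_def vec_eq_iff)
  then have "(block U *v homog z) $ i = homog (U *v z) $ i" for i
    by (cases i) (simp_all add: block_mult homog_def)
  then show "block U *v homog z = 1 *s homog (U *v z)" by (simp add: vec_eq_iff)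
qed simp

lemma norm_smult: "norm (c *s v) = norm c * norm (v :: complex^'a)"
  by (simp add: norm_vec_def L2_set_def norm_mult power_mult_distrib sum_distrib_left[symmetric] real_sqrt_mult)

lemma holomorphic_slice:
  fixes g :: "complex^'n \<Rightarrow> complex^'m"
  assumes g: "holomorphic_map_on g \<bbbB>" and e: "norm e \<le> 1"
  shows "(\<lambda>\<zeta>. cinner (g (\<zeta> *s e)) w) holomorphic_on ball 0 1"
  unfolding holomorphic_on_open[OF open_ball]
proof
  fix \<zeta> :: complex assume \<zeta>: "\<zeta> \<in> ball 0 1"
  have "norm (\<zeta> *s e) = norm \<zeta> * norm e" by (rule norm_smult)
  also have "\<dots> \<le> norm \<zeta>" using e by (simp add: mult_left_le)
  finally have "\<zeta> *s e \<in> \<bbbB>" using \<zeta> by simp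
  then obtain A where A: "(g has_derivative (*v) A) (at (\<zeta> *s e))"
    using g unfolding holomorphic_map_on_def by blast
  have lin: "((\<lambda>\<zeta>. \<zeta> *s e) has_derivative (\<lambda>h. h *s e)) (at \<zeta>)"
    by (rule has_derivative_vec) (auto intro!: derivative_eq_intros)
  have "((\<lambda>\<zeta>. g (\<zeta> *s e)) has_derivative (\<lambda>h. A *v (h *s e))) (at \<zeta>)"
    using diff_chain_at[OF lin A] by (simp add: o_def)
  then have "((\<lambda>\<zeta>. g (\<zeta> *s e) $ i) has_derivative (\<lambda>h. (A *v (h *s e)) $ i)) (at \<zeta>)" for i
    by (rule bounded_linear.has_derivative[OF bounded_linear_vec_nth])
  then have "((\<lambda>\<zeta>. g (\<zeta> *s e) $ i) has_field_derivative (A *v e) $ i) (at \<zeta>)" for i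
    by (simp add: has_field_derivative_def vector_scalar_commute mult_commute_abs)
  then have "((\<lambda>\<zeta>. cinner (g (\<zeta> *s e)) w) has_field_derivative cinner (A *v e) w) (at \<zeta>)"
    unfolding herm_def by (auto intro!: derivative_eq_intros simp: mult_ac)
  then show "\<exists>f'. ((\<lambda>\<zeta>. cinner (g (\<zeta> *s e)) w) has_field_derivative f') (at \<zeta>)" by blast
qed

text \<open>The Schwarz lemma in one variable, on the line through \<open>z\<close> and for the component in the direction
  of \<open>g z\<close>.\<close>

lemma holomorphic_norm_le:
  fixes g :: "complex^'n \<Rightarrow> complex^'m"
  assumes g: "holomorphic_map_on g \<bbbB>" and into: "\<And>z. z \<in> \<bbbB> \<Longrightarrow> g z \<in> \<bbbB>" and g0: "g 0 = 0" and z: "z \<in> \<bbbB>"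
  shows "norm (g z) \<le> norm z"
proof (cases "z = 0 \<or> g z = 0")
  case True then show ?thesis using g0 by auto
next
  case False
  define e where "e = of_real (1 / norm z) *s z"
  define w where "w = of_real (1 / norm (g z)) *s g z"
  have ne: "norm e = 1" and nw: "norm w = 1" using False by (simp_all add: e_def w_def norm_smult norm_divide)
  have ze: "of_real (norm z) *s e = z" using False by (simp add: e_def)
  define \<phi> where "\<phi> \<zeta> = cinner (g (\<zeta> *s e)) w" for \<zeta>
  have "norm (\<phi> (of_real (norm z))) \<le> norm (complex_of_real (norm z))"
  proof (rule Schwarz_Lemma(1))
    show "\<phi> holomorphic_on ball 0 1" unfolding \<phi>_def by (rule holomorphic_slice[OF g]) (simp add: ne)
    show "\<phi> 0 = 0" by (simp add: \<phi>_def g0)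
    show "norm (complex_of_real (norm z)) < 1" using z by simp
    fix \<zeta> :: complex assume "norm \<zeta> < 1"
    then have "g (\<zeta> *s e) \<in> \<bbbB>" by (intro into) (simp add: norm_smult ne)
    then show "norm (\<phi> \<zeta>) < 1" using norm_cinner_le[of "g (\<zeta> *s e)" w] by (simp add: \<phi>_def nw)
  qed
  moreover have "\<phi> (of_real (norm z)) = of_real (norm (g z))"
  proof -
    have "\<phi> (of_real (norm z)) = of_real ((norm (g z))\<^sup>2 / norm (g z))"
      unfolding \<phi>_def ze w_def by (simp add: cinner_self)
    then show ?thesis using False by (simp add: power2_eq_square)
  qed
  ultimately show ?thesis by simp
qed

text \<open>Equality in the Schwarz lemma: on the line through \<open>z\<close> the component of \<open>h\<close> in the direction
  of \<open>h z\<close> is linear. It already has the full norm, so the other components vanish.\<close>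

lemma norm_preserving_homogeneous:
  fixes h :: "complex^'n \<Rightarrow> complex^'m"
  assumes h: "holomorphic_map_on h \<bbbB>" and norm: "\<And>z. z \<in> \<bbbB> \<Longrightarrow> norm (h z) = norm z"
    and z: "z \<in> \<bbbB>" and \<tau>: "norm \<tau> \<le> 1"
  shows "h (\<tau> *s z) = \<tau> *s h z"
proof (cases "z = 0")
  case True
  then have "h z = 0" using norm[OF z] by simp
  then show ?thesis using True by simp
next
  case False
  define r where "r = norm z"
  have r: "0 < r" "r < 1" using False z by (simp_all add: r_def)
  define e where "e = of_real (1 / r) *s z"
  have ne: "norm e = 1" using False by (simp add: e_def norm_smult norm_divide r_def)
  have ze: "of_real r *s e = z" using r by (simp add: e_def)
  define \<phi> where "\<phi> \<zeta> = cinner (h (\<zeta> *s e)) (of_real (1 / r) *s h z)" for \<zeta>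
  have nw: "norm (of_real (1 / r) *s h z) = 1" using norm[OF z] r by (simp add: norm_smult norm_divide r_def)
  have hol: "\<phi> holomorphic_on ball 0 1" unfolding \<phi>_def by (rule holomorphic_slice[OF h]) (simp add: ne)
  have le: "norm (\<phi> \<zeta>) \<le> norm \<zeta>" if "norm \<zeta> < 1" for \<zeta>
  proof -
    have "\<zeta> *s e \<in> \<bbbB>" using that by (simp add: norm_smult ne)
    then have "norm (h (\<zeta> *s e)) = norm \<zeta>" using norm by (simp add: norm_smult ne)
    then show ?thesis
      using norm_cinner_le[of "h (\<zeta> *s e)" "of_real (1 / r) *s h z"] by (simp only: \<phi>_def nw mult_1_right)
  qed
  have \<phi>0: "\<phi> 0 = 0" using le[of 0] by simp
  have \<phi>r: "\<phi> (of_real r) = of_real r"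
  proof -
    have "\<phi> (of_real r) = of_real (r\<^sup>2 / r)"
      unfolding \<phi>_def ze using norm[OF z] by (simp add: cinner_self r_def)
    then show ?thesis using r by (simp add: power2_eq_square)
  qed
  have "\<exists>\<alpha>. (\<forall>z. norm z < 1 \<longrightarrow> \<phi> z = \<alpha> * z) \<and> norm \<alpha> = 1"
  proof (rule Schwarz_Lemma(3)[OF hol \<phi>0])
    show "norm (0 :: complex) < 1" by simp
    show "(\<exists>z. norm z < 1 \<and> z \<noteq> 0 \<and> norm (\<phi> z) = norm z) \<or> norm (deriv \<phi> 0) = 1"
      using r \<phi>r by (intro disjI1 exI[of _ "of_real r"]) simp
    show "norm (\<phi> \<zeta>) < 1" if "norm \<zeta> < 1" for \<zeta> using le[OF that] that by linarith
  qed
  then obtain \<alpha> where \<alpha>: "\<And>z. norm z < 1 \<Longrightarrow> \<phi> z = \<alpha> * z" by blast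
  have "\<alpha> = 1" using \<alpha>[of "of_real r"] r \<phi>r by simp
  then have id: "\<phi> \<zeta> = \<zeta>" if "norm \<zeta> < 1" for \<zeta> using \<alpha>[OF that] by simp
  have "norm (\<tau> * of_real r) \<le> r" using mult_left_le_one_le[of r "norm \<tau>"] \<tau> r by (simp add: norm_mult)
  then have tr: "norm (\<tau> * of_real r) < 1" using r by linarith
  have tz: "(\<tau> * of_real r) *s e = \<tau> *s z" unfolding ze[symmetric] by simp
  have "cinner (h (\<tau> *s z)) (of_real (1 / r) *s h z) = \<tau> * of_real r"
    using id[OF tr] unfolding \<phi>_def tz .
  then have c1: "cinner (h (\<tau> *s z)) (h z) = \<tau> * of_real (r\<^sup>2)"
    using r by (simp add: field_simps power2_eq_square)
  then have c2: "cinner (h z) (h (\<tau> *s z)) = cnj \<tau> * of_real (r\<^sup>2)"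
    using cnj_herm[of "\<lambda>_. 1" "h (\<tau> *s z)" "h z"] by simp
  have "\<tau> *s z \<in> \<bbbB>" using tr r by (simp add: norm_smult norm_mult r_def)
  then have c3: "cinner (h (\<tau> *s z)) (h (\<tau> *s z)) = \<tau> * cnj \<tau> * of_real (r\<^sup>2)"
    using norm complex_norm_square[of \<tau>] by (simp add: cinner_self norm_smult r_def power_mult_distrib)
  have c4: "cinner (h z) (h z) = of_real (r\<^sup>2)" using norm[OF z] by (simp add: cinner_self r_def)
  have "cinner (h (\<tau> *s z) - \<tau> *s h z) (h (\<tau> *s z) - \<tau> *s h z) = 0"
    by (simp add: c1 c2 c3 c4)
  then show ?thesis by (simp add: cinner_self del: herm_simps)
qed

lemma of_real_smult: "complex_of_real t *s v = t *\<^sub>R v"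
  by (simp add: vec_eq_iff) (simp add: scaleR_conv_of_real)

text \<open>Along the ray through \<open>z\<close> the map is its own derivative at the origin.\<close>

lemma homogeneous_is_linear:
  fixes h :: "complex^'n \<Rightarrow> complex^'m"
  assumes A: "(h has_derivative (*v) A) (at 0)" and z: "z \<in> \<bbbB>"
    and hom: "\<And>t::real. \<bar>t\<bar> < 1 \<Longrightarrow> h (of_real t *s z) = of_real t *s h z"
  shows "h z = A *v z"
proof -
  note sc = of_real_smult
  have d: "((\<lambda>t. t *\<^sub>R z) has_derivative (\<lambda>t. t *\<^sub>R z)) (at 0)"
    by (auto intro!: derivative_eq_intros)
  have "((\<lambda>t. h (t *\<^sub>R z)) has_derivative (\<lambda>t. A *v (t *\<^sub>R z))) (at 0)"
    using diff_chain_at[OF d, of h "(*v) A"] A by (simp add: o_def)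
  then have "((\<lambda>t. t *\<^sub>R h z) has_derivative (\<lambda>t. A *v (t *\<^sub>R z))) (at 0)"
    by (rule has_derivative_transform_within_open[OF _ open_greaterThanLessThan[of "-1" "1::real"]])
      (use hom in \<open>auto simp: sc abs_less_iff\<close>)
  moreover have "((\<lambda>t. t *\<^sub>R h z) has_derivative (\<lambda>t. t *\<^sub>R h z)) (at 0)"
    by (auto intro!: derivative_eq_intros)
  ultimately have "(\<lambda>t::real. A *v (t *\<^sub>R z)) = (\<lambda>t. t *\<^sub>R h z)" by (rule has_derivative_unique)
  then have "A *v (1 *\<^sub>R z) = 1 *\<^sub>R h z" by metis
  then show ?thesis by simp
qed

text \<open>The norm determines the real inner product by polarisation, and the real inner product determines
  the complex one, with imaginary part \<open>x \<bullet> (\<i> *s y)\<close>.\<close>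

lemma norm_preserving_unitary:
  fixes A :: "complex^'n^'n"
  assumes "\<And>z. norm (A *v z) = norm z"
  shows "herm_isometry (\<lambda>_. 1) A"
proof -
  have inner: "(A *v x) \<bullet> (A *v y) = x \<bullet> y" for x y
  proof -
    have "A *v x + A *v y = A *v (x + y)" by (simp add: matrix_vector_right_distrib)
    then show ?thesis unfolding dot_norm by (simp add: assms)
  qed
  have Im: "Im (cinner x y) = x \<bullet> (\<i> *s y)" for x y :: "complex^'n"
    using Re_cinner[of x "\<i> *s y"] by simp
  have "cinner (A *v x) (A *v y) = cinner x y" for x y
  proof (rule complex_eqI)
    show "Re (cinner (A *v x) (A *v y)) = Re (cinner x y)" by (simp add: Re_cinner inner)
    show "Im (cinner (A *v x) (A *v y)) = Im (cinner x y)"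
      unfolding Im by (simp add: vector_scalar_commute[symmetric] inner)
  qed
  then show ?thesis by (simp add: herm_isometry_def)
qed

lemma carrier_Ball_Aut [simp]: "carrier Ball_Aut = ball_aut"
  by (simp add: Ball_Aut_def)

lemma mult_Ball_Aut: "g \<in> ball_aut \<Longrightarrow> h \<in> ball_aut \<Longrightarrow> g \<otimes>\<^bsub>Ball_Aut\<^esub> h = compose \<bbbB> g h"
  by (simp add: Ball_Aut_def BijGroup_def ball_aut_def)

lemma ball_aut_mem: "g \<in> ball_aut \<Longrightarrow> z \<in> \<bbbB> \<Longrightarrow> g z \<in> \<bbbB>"
  unfolding ball_aut_def Bij_def bij_betw_def by blast

lemma ball_aut_extensional: "g \<in> ball_aut \<Longrightarrow> g \<in> extensional \<bbbB>"
  by (simp add: ball_aut_def Bij_def)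

text \<open>By the Schwarz lemma for \<open>g\<close> and its inverse, \<open>g\<close> preserves the norm; so it is homogeneous, hence
  linear, hence unitary.\<close>

lemma ball_aut_fixing_zero:
  fixes g :: "complex^'n \<Rightarrow> complex^'n"
  assumes g: "g \<in> ball_aut" and g0: "g 0 = 0"
  shows "\<exists>A. herm_isometry sg A \<and> g = ball_action A"
proof -
  let ?k = "inv_into \<bbbB> g"
  have bij: "bij_betw g \<bbbB> \<bbbB>" and hol: "holomorphic_map_on g \<bbbB>" "holomorphic_map_on ?k \<bbbB>"
    using g by (auto simp: ball_aut_def Bij_def)
  have zero: "(0 :: complex^'n) \<in> \<bbbB>" by simp
  have k0: "?k 0 = 0" using bij_betw_inv_into_left[OF bij zero] g0 by simp
  have into: "?k z \<in> \<bbbB>" if "z \<in> \<bbbB>" for z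
    using bij_betw_inv_into[OF bij] that by (rule bij_betw_apply)
  have norm: "norm (g z) = norm z" if z: "z \<in> \<bbbB>" for z
  proof (rule antisym)
    show "norm (g z) \<le> norm z" by (rule holomorphic_norm_le[OF hol(1) ball_aut_mem[OF g] g0 z])
    have "norm (?k (g z)) \<le> norm (g z)"
      by (rule holomorphic_norm_le[OF hol(2) into k0 ball_aut_mem[OF g z]])
    then show "norm z \<le> norm (g z)" using bij_betw_inv_into_left[OF bij z] by simp
  qed
  obtain A where A: "(g has_derivative (*v) A) (at 0)"
    using hol(1) zero unfolding holomorphic_map_on_def by blast
  have lin: "g z = A *v z" if z: "z \<in> \<bbbB>" for z
    by (rule homogeneous_is_linear[OF A z], rule norm_preserving_homogeneous[OF hol(1) norm z]) auto
  have "norm (A *v z) = norm z" for z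
  proof -
    define t where "t = 1 / (2 * (norm z + 1))"
    have p: "norm z + 1 > 0" by (simp add: add_nonneg_pos)
    then have t: "t > 0" by (simp add: t_def)
    have "norm (t *\<^sub>R z) = norm z / (norm z + 1) / 2" using t p by (simp add: t_def)
    also have "\<dots> < 1" using p by (simp add: divide_simps)
    finally have "t *\<^sub>R z \<in> \<bbbB>" by simp
    then have "norm (A *v (t *\<^sub>R z)) = norm (t *\<^sub>R z)" using norm lin by metis
    moreover have "A *v (t *\<^sub>R z) = t *\<^sub>R (A *v z)"
      unfolding of_real_smult[symmetric] by (rule vector_scalar_commute)
    ultimately show ?thesis using t by simp
  qed
  then have U: "herm_isometry (\<lambda>_. 1) A" by (rule norm_preserving_unitary)
  have "g = ball_action (block A)"
  proof (rule extensionalityI[OF ball_aut_extensional[OF g]])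
    show "ball_action (block A) \<in> extensional \<bbbB>" by (simp add: ball_action_def)
    show "g z = ball_action (block A) z" if "z \<in> \<bbbB>" for z
      using lin[OF that] ball_action_block[OF that] by simp
  qed
  then show ?thesis using block_isometry[OF U] by blast
qed

text \<open>The linear fractional maps act transitively, so it suffices to treat automorphisms that fix the
  origin.\<close>

theorem ball_aut_eq: "ball_aut = ball_action ` SU_n1"
proof
  show "ball_action ` SU_n1 \<subseteq> ball_aut" using ball_action_aut SU_n1_iff by blast
  show "ball_aut \<subseteq> ball_action ` SU_n1"
  proof
    fix g :: "complex^'n \<Rightarrow> complex^'n" assume g: "g \<in> ball_aut"
    interpret group "Ball_Aut :: (complex^'n \<Rightarrow> complex^'n) monoid" by (rule group_Ball_Aut)
    have zero: "(0 :: complex^'n) \<in> \<bbbB>" by simp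
    obtain A where A: "herm_isometry sg A" "ball_action A (g 0) = 0"
      using isometry_moving_to_zero[OF ball_aut_mem[OF g zero]] by blast
    obtain B where B: "herm_isometry sg B" "B ** A = mat 1" using herm_isometry_inverse[OF A(1)] by auto
    let ?h = "compose \<bbbB> (ball_action A) g"
    have "?h \<in> ball_aut"
      using m_closed[of "ball_action A" g] ball_action_aut[OF A(1)] g by (simp add: mult_Ball_Aut)
    moreover have h0: "?h 0 = 0" using A(2) zero by (simp only: compose_eq)
    ultimately obtain C where C: "herm_isometry sg C" "?h = ball_action C"
      using ball_aut_fixing_zero[of ?h] by meson
    have "g = ball_action (B ** C)"
    proof (rule extensionalityI[OF ball_aut_extensional[OF g]])
      show "ball_action (B ** C) \<in> extensional \<bbbB>" by (simp add: ball_action_def)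
      fix z :: "complex^'n" assume z: "z \<in> \<bbbB>"
      have gz: "g z \<in> \<bbbB>" by (rule ball_aut_mem[OF g z])
      have "ball_action (B ** C) z = ball_action B (ball_action C z)" by (rule ball_action_mult[OF B(1) C(1) z])
      also have "ball_action C z = ball_action A (g z)" unfolding C(2)[symmetric] by (rule compose_eq[OF z])
      also have "ball_action B \<dots> = ball_action (B ** A) (g z)" by (rule ball_action_mult[symmetric, OF B(1) A(1) gz])
      also have "\<dots> = g z" unfolding B(2) by (rule ball_action_mat1[OF gz])
      finally show "g z = ball_action (B ** C) z" by simp
    qed
    moreover from isometry_to_SU[OF herm_isometry_mult[OF B(1) C(1)]]
    obtain D where D: "D \<in> SU_n1" "ball_action D = ball_action (B ** C)" by (rule bexE)
    ultimately have "g = ball_action D" by simp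
    then show "g \<in> ball_action ` SU_n1" using D(1) by (rule image_eqI)
  qed
qed

section \<open>Maps that differ by an automorphism\<close>

text \<open>After automorphisms have moved \<open>g u\<close> and \<open>h u\<close> to the origin, the condition says that the two
  families have equal Gram matrices, as \<open>kform a 0 = 1\<close>. The equality of cross ratios is multiplied
  out because this is the form that becomes polynomial for rational maps.\<close>

lemma cross_ratio_imp_automorphism:
  fixes g h :: "'i \<Rightarrow> complex^'m"
  assumes g: "\<And>x. x \<in> S \<Longrightarrow> g x \<in> \<bbbB>" and h: "\<And>x. x \<in> S \<Longrightarrow> h x \<in> \<bbbB>" and u: "u \<in> S"
    and cross: "\<And>x y. x \<in> S \<Longrightarrow> y \<in> S \<Longrightarrow>
      kform (g x) (g y) * kform (g u) (g u) * kform (h x) (h u) * kform (h u) (h y) =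
      kform (h x) (h y) * kform (h u) (h u) * kform (g x) (g u) * kform (g u) (g y)"
  shows "\<exists>\<psi>\<in>ball_aut. \<forall>x\<in>S. g x = \<psi> (h x)"
proof -
  obtain P where P: "herm_isometry sg P" "ball_action P (h u) = 0"
    using isometry_moving_to_zero[OF h[OF u]] by blast
  obtain Q where Q: "herm_isometry sg Q" "ball_action Q (g u) = 0"
    using isometry_moving_to_zero[OF g[OF u]] by blast
  obtain R where R: "herm_isometry sg R" "R ** Q = mat 1" using herm_isometry_inverse[OF Q(1)] by auto
  define g' h' where "g' x = ball_action Q (g x)" and "h' x = ball_action P (h x)" for x
  define p q where "p x = (P *v homog (h x)) $ None" and "q x = (Q *v homog (g x)) $ None" for x
  have p0: "p x \<noteq> 0" and q0: "q x \<noteq> 0" if "x \<in> S" for x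
    unfolding p_def q_def using isometry_denominator(1)[OF P(1) h[OF that]] isometry_denominator(1)[OF Q(1) g[OF that]] .
  have kg: "kform (g x) (g y) = q x * cnj (q y) * kform (g' x) (g' y)"
    and kh: "kform (h x) (h y) = p x * cnj (p y) * kform (h' x) (h' y)" if "x \<in> S" "y \<in> S" for x y
    unfolding g'_def h'_def p_def q_def
    by (rule kform_ball_action[OF Q(1) g[OF that(1)] g[OF that(2)]],
        rule kform_ball_action[OF P(1) h[OF that(1)] h[OF that(2)]])
  have zero: "g' u = 0" "h' u = 0" by (simp_all add: g'_def h'_def P Q)
  have k0: "kform a 0 = 1" "kform 0 a = 1" for a :: "complex^'m" by (simp_all add: kform_def)
  have eq: "cinner (g' x) (g' y) = cinner (h' x) (h' y)" if x: "x \<in> S" and y: "y \<in> S" for x y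
  proof -
    define D where "D = q x * cnj (q y) * p x * cnj (p y) * q u * cnj (q u) * p u * cnj (p u)"
    have "D \<noteq> 0" using p0 q0 x y u by (simp add: D_def)
    have "D * kform (g' x) (g' y) = D * kform (h' x) (h' y)"
      using cross[OF x y] unfolding kg[OF x y] kh[OF x y] kg[OF x u] kg[OF u y] kh[OF x u] kh[OF u y] kg[OF u u] kh[OF u u]
      unfolding zero k0 D_def by (simp only: mult_ac mult_1_left mult_1_right)
    then have "kform (g' x) (g' y) = kform (h' x) (h' y)" using \<open>D \<noteq> 0\<close> mult_left_cancel by blast
    then show ?thesis by (simp add: kform_def)
  qed
  obtain U where U: "herm_isometry (\<lambda>_. 1) U"
    "\<And>x. U *v (if x \<in> S then h' x else 0) = (if x \<in> S then g' x else 0)"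
  proof -
    have "cinner (if x \<in> S then g' x else 0) (if y \<in> S then g' y else 0) =
      cinner (if x \<in> S then h' x else 0) (if y \<in> S then h' y else 0)" for x y by (simp add: eq)
    from gram_unitary[of "\<lambda>x. if x \<in> S then g' x else 0", OF this] show ?thesis using that by blast
  qed
  define A where "A = R ** (block U ** P)"
  have iU: "herm_isometry sg (block U)" by (rule block_isometry[OF U(1)])
  have iA: "herm_isometry sg A" unfolding A_def using R(1) iU P(1) by (intro herm_isometry_mult)
  have "g x = ball_action A (h x)" if x: "x \<in> S" for x
  proof -
    have h'x: "h' x \<in> \<bbbB>" unfolding h'_def by (rule ball_action_mem[OF P(1) h[OF x]])
    have "ball_action A (h x) = ball_action R (ball_action (block U ** P) (h x))"
      unfolding A_def by (rule ball_action_mult[OF R(1) herm_isometry_mult[OF iU P(1)] h[OF x]])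
    also have "ball_action (block U ** P) (h x) = ball_action (block U) (h' x)"
      unfolding h'_def by (rule ball_action_mult[OF iU P(1) h[OF x]])
    also have "\<dots> = U *v h' x" by (rule ball_action_block[OF h'x])
    also have "\<dots> = g' x" using U(2)[of x] x by simp
    also have "ball_action R (g' x) = ball_action (R ** Q) (g x)"
      unfolding g'_def by (rule ball_action_mult[symmetric, OF R(1) Q(1) g[OF x]])
    also have "\<dots> = g x" unfolding R(2) by (rule ball_action_mat1[OF g[OF x]])
    finally show ?thesis by simp
  qed
  then show ?thesis using ball_action_aut[OF iA] by blast
qed

text \<open>By \<open>kform_ball_action\<close>, each factor by which the kernel changes occurs equally often on both
  sides.\<close>

lemma automorphism_imp_cross_ratio:
  fixes \<psi> :: "complex^'m \<Rightarrow> complex^'m"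
  assumes \<psi>: "\<psi> \<in> ball_aut" and abc: "a \<in> \<bbbB>" "b \<in> \<bbbB>" "c \<in> \<bbbB>"
  shows "kform (\<psi> a) (\<psi> b) * kform (\<psi> c) (\<psi> c) * kform a c * kform c b =
    kform a b * kform c c * kform (\<psi> a) (\<psi> c) * kform (\<psi> c) (\<psi> b)"
proof -
  obtain A where A: "herm_isometry sg A" "\<psi> = ball_action A"
    using \<psi> unfolding ball_aut_eq using SU_n1_iff by blast
  note k = kform_ball_action[OF A(1)]
  show ?thesis
    unfolding k[OF abc(1,2)] k[OF abc(3,3)] k[OF abc(1,3)] k[OF abc(3,2)] A(2) by (simp only: mult_ac)
qed

section \<open>The invariant group is real algebraic\<close>

text \<open>These are the polynomials in the entries and their complex conjugates; the equations of the group
  involve both.\<close>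

definition cpoly :: "('a::real_normed_vector \<Rightarrow> complex) \<Rightarrow> bool"
  where "cpoly m \<longleftrightarrow> real_polynomial_function (\<lambda>A. Re (m A)) \<and> real_polynomial_function (\<lambda>A. Im (m A))"

lemma cpoly_const: "cpoly (\<lambda>A. c)"
  by (simp add: cpoly_def real_polynomial_function.intros(2))

lemma cpoly_add: "cpoly m \<Longrightarrow> cpoly m' \<Longrightarrow> cpoly (\<lambda>A. m A + m' A)"
  by (simp add: cpoly_def real_polynomial_function.intros(3))

lemma cpoly_mult:
  assumes "cpoly m" "cpoly m'"
  shows "cpoly (\<lambda>A. m A * m' A)"
proof -
  have "real_polynomial_function (\<lambda>A. Re (m A) * Re (m' A) - Im (m A) * Im (m' A))"
    by (rule real_polynomial_function_diff; rule real_polynomial_function.intros(4))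
      (use assms in \<open>simp_all add: cpoly_def\<close>)
  moreover have "real_polynomial_function (\<lambda>A. Re (m A) * Im (m' A) + Im (m A) * Re (m' A))"
    by (rule real_polynomial_function.intros(3); rule real_polynomial_function.intros(4))
      (use assms in \<open>simp_all add: cpoly_def\<close>)
  ultimately show ?thesis by (simp add: cpoly_def)
qed

lemma cpoly_cnj: "cpoly m \<Longrightarrow> cpoly (\<lambda>A. cnj (m A))"
  by (simp add: cpoly_def real_polynomial_function_minus)

lemma cpoly_entry: "cpoly (\<lambda>A :: complex^'a^'b. A $ i $ j)"
proof -
  have "bounded_linear (\<lambda>A :: complex^'a^'b. A $ i $ j)"
    by (rule bounded_linear_compose[OF bounded_linear_vec_nth bounded_linear_vec_nth])
  then show ?thesis unfolding cpoly_def
    using bounded_linear_compose[OF bounded_linear_Re] bounded_linear_compose[OF bounded_linear_Im]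
    by (auto intro!: real_polynomial_function.intros(1))
qed

lemma cpoly_sum: "(\<And>i. i \<in> I \<Longrightarrow> cpoly (m i)) \<Longrightarrow> cpoly (\<lambda>A. \<Sum>i\<in>I. m i A)"
  by (induction I rule: infinite_finite_induct) (auto intro: cpoly_const cpoly_add)

text \<open>A family of polynomials, with an arbitrary index set, whose members lie in the span of finitely many:
  only the coefficients \<open>c\<close> depend on the index and only the polynomials \<open>m\<close> on the point.\<close>

definition poly_family :: "('i \<Rightarrow> 'a::real_normed_vector \<Rightarrow> complex) \<Rightarrow> bool"
  where "poly_family T \<longleftrightarrow>
    (\<exists>(n::nat) m c. (\<forall>k<n. cpoly (m k)) \<and> (\<forall>i A. T i A = (\<Sum>k<n. c i k * m k A)))"

lemma poly_familyI:
  assumes K: "finite K" and m: "\<And>k. k \<in> K \<Longrightarrow> cpoly (m k)"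
    and T: "\<And>i A. T i A = (\<Sum>k\<in>K. c i k * m k A)"
  shows "poly_family T"
proof -
  obtain e where e: "bij_betw e {..<card K} K"
    using ex_bij_betw_nat_finite[OF K] unfolding atLeast0LessThan by blast
  have "T i A = (\<Sum>k<card K. c i (e k) * m (e k) A)" for i A
    unfolding T by (rule sum.reindex_bij_betw[OF e, symmetric])
  moreover have "\<forall>k<card K. cpoly (m (e k))" using m bij_betwE[OF e] by auto
  ultimately show ?thesis unfolding poly_family_def
    by (intro exI[of _ "card K"] exI[of _ "\<lambda>k. m (e k)"] exI[of _ "\<lambda>i k. c i (e k)"]) simp
qed

lemma poly_familyE:
  assumes "poly_family T"
  obtains n :: nat and m c where "\<And>k. k < n \<Longrightarrow> cpoly (m k)" "\<And>i A. T i A = (\<Sum>k<n. c i k * m k A)"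
  using assms unfolding poly_family_def by blast

lemma poly_family_cpoly: "poly_family T \<Longrightarrow> cpoly (T i)"
proof (elim poly_familyE)
  fix n :: nat and m c assume m: "\<And>k. k < n \<Longrightarrow> cpoly (m k)" and T: "\<And>i A. T i A = (\<Sum>k<n. c i k * m k A)"
  have "T i = (\<lambda>A. \<Sum>k<n. c i k * m k A)" by (rule ext) (rule T)
  moreover have "cpoly (\<lambda>A. \<Sum>k<n. c i k * m k A)"
    by (intro cpoly_sum cpoly_mult cpoly_const m) simp
  ultimately show ?thesis by simp
qed

lemma poly_family_const: "poly_family (\<lambda>i A. c i)"
  by (rule poly_familyI[of "{()}" "\<lambda>_ _. 1" _ "\<lambda>i _. c i"]) (auto intro: cpoly_const)

lemma poly_family_single: "cpoly m \<Longrightarrow> poly_family (\<lambda>i A. m A)"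
  by (rule poly_familyI[of "{()}" "\<lambda>_. m" _ "\<lambda>_ _. 1"]) auto

lemma poly_family_finite_index:
  fixes T :: "'i::finite \<Rightarrow> 'a::real_normed_vector \<Rightarrow> complex"
  shows "(\<And>i. cpoly (T i)) \<Longrightarrow> poly_family T"
proof (rule poly_familyI[of UNIV T _ "\<lambda>i k. if k = i then 1 else 0"])
  show "T i A = (\<Sum>k\<in>UNIV. (if k = i then 1 else 0) * T k A)" for i A
    by (simp add: if_distrib if_distribR cong: if_cong)
qed auto

lemma poly_family_reindex: "poly_family T \<Longrightarrow> poly_family (\<lambda>i. T (\<phi> i))"
proof (elim poly_familyE)
  fix n :: nat and m c assume m: "\<And>k. k < n \<Longrightarrow> cpoly (m k)" and T: "\<And>i A. T i A = (\<Sum>k<n. c i k * m k A)"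
  show ?thesis by (rule poly_familyI[of "{..<n}" m _ "\<lambda>i. c (\<phi> i)"]) (use m T in auto)
qed

lemma poly_family_add:
  assumes "poly_family T" "poly_family T'"
  shows "poly_family (\<lambda>i A. T i A + T' i A)"
  using assms
proof (elim poly_familyE)
  fix n m c and n' :: nat and m' c'
  assume m: "\<And>k. k < (n::nat) \<Longrightarrow> cpoly (m k)" and T: "\<And>i A. T i A = (\<Sum>k<n. c i k * m k A)"
    and m': "\<And>k. k < n' \<Longrightarrow> cpoly (m' k)" and T': "\<And>i A. T' i A = (\<Sum>k<n'. c' i k * m' k A)"
  show ?thesis
  proof (rule poly_familyI[of "{..<n} <+> {..<n'}" "case_sum m m'" _ "\<lambda>i. case_sum (c i) (c' i)"])
    show "T i A + T' i A = (\<Sum>k\<in>{..<n} <+> {..<n'}. case_sum (c i) (c' i) k * case_sum m m' k A)" for i A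
      by (simp add: sum.Plus T T')
  qed (use m m' in \<open>auto split: sum.splits\<close>)
qed

lemma poly_family_mult:
  assumes "poly_family T" "poly_family T'"
  shows "poly_family (\<lambda>i A. T i A * T' i A)"
  using assms
proof (elim poly_familyE)
  fix n m c and n' :: nat and m' c'
  assume m: "\<And>k. k < (n::nat) \<Longrightarrow> cpoly (m k)" and T: "\<And>i A. T i A = (\<Sum>k<n. c i k * m k A)"
    and m': "\<And>k. k < n' \<Longrightarrow> cpoly (m' k)" and T': "\<And>i A. T' i A = (\<Sum>k<n'. c' i k * m' k A)"
  show ?thesis
  proof (rule poly_familyI[of "{..<n} \<times> {..<n'}" "\<lambda>k A. m (fst k) A * m' (snd k) A" _ "\<lambda>i k. c i (fst k) * c' i (snd k)"])
    show "T i A * T' i A = (\<Sum>k\<in>{..<n} \<times> {..<n'}. c i (fst k) * c' i (snd k) * (m (fst k) A * m' (snd k) A))" for i A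
      unfolding T T' sum_product sum.cartesian_product by (rule sum.cong) auto
  qed (use m m' in \<open>auto intro: cpoly_mult\<close>)
qed

lemma poly_family_cnj: "poly_family T \<Longrightarrow> poly_family (\<lambda>i A. cnj (T i A))"
proof (elim poly_familyE)
  fix n :: nat and m c assume m: "\<And>k. k < n \<Longrightarrow> cpoly (m k)" and T: "\<And>i A. T i A = (\<Sum>k<n. c i k * m k A)"
  show ?thesis by (rule poly_familyI[of "{..<n}" "\<lambda>k A. cnj (m k A)" _ "\<lambda>i k. cnj (c i k)"]) (use m T in \<open>auto intro: cpoly_cnj\<close>)
qed

lemma poly_family_diff:
  assumes "poly_family T" "poly_family T'"
  shows "poly_family (\<lambda>i A. T i A - T' i A)"
  using poly_family_add[OF assms(1) poly_family_mult[OF poly_family_const[of "\<lambda>_. -1"] assms(2)]] by simp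

lemma poly_family_sum: "(\<And>j. j \<in> J \<Longrightarrow> poly_family (T j)) \<Longrightarrow> poly_family (\<lambda>i A. \<Sum>j\<in>J. T j i A)"
  by (induction J rule: infinite_finite_induct) (auto intro: poly_family_const poly_family_add)

lemma poly_family_prod: "(\<And>j. j \<in> J \<Longrightarrow> poly_family (T j)) \<Longrightarrow> poly_family (\<lambda>i A. \<Prod>j\<in>J. T j i A)"
  by (induction J rule: infinite_finite_induct) (auto intro: poly_family_const poly_family_mult)

lemma poly_family_power: "poly_family T \<Longrightarrow> poly_family (\<lambda>i A. T i A ^ k)"
  by (induction k) (auto intro: poly_family_const poly_family_mult)

text \<open>Elimination: if the unknown \<open>k\<close> occurs in the equation \<open>i0\<close>, this equation is selected and used to
  remove \<open>k\<close> from all the others.\<close>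

lemma finite_subsystem:
  fixes c :: "'i \<Rightarrow> 'k \<Rightarrow> 'c::field"
  assumes "finite K"
  shows "\<exists>I0\<subseteq>I. finite I0 \<and> (\<forall>v. (\<forall>i\<in>I0. (\<Sum>k\<in>K. c i k * v k) = 0) \<longrightarrow> (\<forall>i\<in>I. (\<Sum>k\<in>K. c i k * v k) = 0))"
  using assms
proof (induction K arbitrary: c rule: finite_induct)
  case empty
  then show ?case by (intro exI[of _ "{}"]) auto
next
  case (insert k K)
  show ?case
  proof (cases "\<forall>i\<in>I. c i k = 0")
    case True
    from insert.IH[of c] obtain I0 where I0: "I0 \<subseteq> I" "finite I0"
      "\<And>v. \<forall>i\<in>I0. (\<Sum>k\<in>K. c i k * v k) = 0 \<Longrightarrow> \<forall>i\<in>I. (\<Sum>k\<in>K. c i k * v k) = 0" by blast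
    then show ?thesis using True insert.hyps by (intro exI[of _ I0]) (auto simp: subset_iff)
  next
    case False
    then obtain i0 where i0: "i0 \<in> I" "c i0 k \<noteq> 0" by blast
    define c' where "c' i l = c i l - c i k / c i0 k * c i0 l" for i l
    have red: "(\<Sum>l\<in>K. c' i l * v l) = (\<Sum>l\<in>insert k K. c i l * v l) - c i k / c i0 k * (\<Sum>l\<in>insert k K. c i0 l * v l)" for i v
      using insert.hyps i0 by (simp add: c'_def algebra_simps sum_subtractf sum_distrib_left)
    from insert.IH[of c'] obtain I0 where I0: "I0 \<subseteq> I" "finite I0"
      "\<And>v. \<forall>i\<in>I0. (\<Sum>k\<in>K. c' i k * v k) = 0 \<Longrightarrow> \<forall>i\<in>I. (\<Sum>k\<in>K. c' i k * v k) = 0" by blast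
    have "\<forall>i\<in>I. (\<Sum>l\<in>insert k K. c i l * v l) = 0"
      if v: "\<forall>i\<in>insert i0 I0. (\<Sum>l\<in>insert k K. c i l * v l) = 0" for v
    proof
      fix i assume "i \<in> I"
      have "\<forall>i\<in>I0. (\<Sum>k\<in>K. c' i k * v k) = 0" using v unfolding red by simp
      with I0(3) \<open>i \<in> I\<close> have "(\<Sum>k\<in>K. c' i k * v k) = 0" by blast
      then show "(\<Sum>l\<in>insert k K. c i l * v l) = 0" using v unfolding red by simp
    qed
    then show ?thesis using I0 i0 by (intro exI[of _ "insert i0 I0"]) blast
  qed
qed

text \<open>Finitely many members of the family imply the vanishing of all, whatever the values of the spanning
  polynomials; \<open>p\<close> is the sum of their squared absolute values.\<close>

lemma poly_family_zero_set:
  fixes T :: "'i \<Rightarrow> 'a::real_normed_vector \<Rightarrow> complex"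
  assumes T: "poly_family T"
  shows "\<exists>p. real_polynomial_function p \<and> (\<forall>A. p A \<ge> 0) \<and> (\<forall>A. p A = 0 \<longleftrightarrow> (\<forall>i\<in>I. T i A = 0))"
proof -
  obtain n :: nat and m c where m: "\<And>k. k < n \<Longrightarrow> cpoly (m k)" and Tc: "\<And>i A. T i A = (\<Sum>k<n. c i k * m k A)"
    using T by (rule poly_familyE) blast
  obtain I0 where I0: "I0 \<subseteq> I" "finite I0"
    "\<And>v. \<forall>i\<in>I0. (\<Sum>k<n. c i k * v k) = 0 \<Longrightarrow> \<forall>i\<in>I. (\<Sum>k<n. c i k * v k) = 0"
    using finite_subsystem[of "{..<n}" I c] by auto
  define p where "p A = (\<Sum>i\<in>I0. (Re (T i A))\<^sup>2 + (Im (T i A))\<^sup>2)" for A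
  have "real_polynomial_function p" unfolding p_def
    using poly_family_cpoly[OF T] I0(2)
    by (intro real_polynomial_function_sum real_polynomial_function.intros(3) real_polynomial_function_power)
      (simp_all add: cpoly_def)
  moreover have "p A = 0 \<longleftrightarrow> (\<forall>i\<in>I. T i A = 0)" for A
  proof -
    have "p A = 0 \<longleftrightarrow> (\<forall>i\<in>I0. T i A = 0)"
      unfolding p_def using I0(2) by (subst sum_nonneg_eq_0_iff) (auto simp: complex_eq_iff sum_power2_eq_zero_iff)
    also have "\<dots> \<longleftrightarrow> (\<forall>i\<in>I. T i A = 0)" using I0(1) I0(3)[of "\<lambda>k. m k A"] unfolding Tc by blast
    finally show ?thesis .
  qed
  moreover have "p A \<ge> 0" for A unfolding p_def by (intro sum_nonneg) simp
  ultimately show ?thesis by blast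
qed

subsection \<open>Homogenisation\<close>

text \<open>The value of \<open>q\<close> at the image of \<open>x\<close> under \<open>A\<close> is a rational function of the entries of \<open>A\<close>; a
  power of the denominator of the action, the same for all \<open>x\<close>, makes it the polynomial \<open>H x\<close>.\<close>

definition homogenizable :: "(complex^'n \<Rightarrow> complex) \<Rightarrow> nat \<Rightarrow> bool"
  where "homogenizable q d \<longleftrightarrow> (\<exists>H :: complex^'n \<Rightarrow> 'n::finite hmat \<Rightarrow> complex. poly_family H \<and>
    (\<forall>x A. (A *v homog x) $ None \<noteq> 0 \<longrightarrow>
      H x A = ((A *v homog x) $ None) ^ d * q (\<chi> k. (A *v homog x) $ Some k / (A *v homog x) $ None)))"

lemma poly_family_homog: "poly_family (\<lambda>x (A :: 'n::finite hmat). (A *v homog x) $ i)"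
  unfolding matrix_vector_mult_def vec_lambda_beta
  by (intro poly_family_sum poly_family_mult poly_family_single[OF cpoly_entry] poly_family_const)

lemma homogenizable_mult:
  fixes q r :: "complex^'n \<Rightarrow> complex"
  assumes "homogenizable q d" "homogenizable r e"
  shows "homogenizable (\<lambda>z. q z * r z) (d + e)"
proof -
  obtain H :: "complex^'n \<Rightarrow> 'n hmat \<Rightarrow> complex" where H: "poly_family H" "\<And>x A. (A *v homog x) $ None \<noteq> 0 \<Longrightarrow>
      H x A = ((A *v homog x) $ None) ^ d * q (\<chi> k. (A *v homog x) $ Some k / (A *v homog x) $ None)"
    using assms(1) unfolding homogenizable_def by blast
  obtain H' :: "complex^'n \<Rightarrow> 'n hmat \<Rightarrow> complex" where H': "poly_family H'" "\<And>x A. (A *v homog x) $ None \<noteq> 0 \<Longrightarrow>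
      H' x A = ((A *v homog x) $ None) ^ e * r (\<chi> k. (A *v homog x) $ Some k / (A *v homog x) $ None)"
    using assms(2) unfolding homogenizable_def by blast
  show ?thesis unfolding homogenizable_def
    using poly_family_mult[OF H(1) H'(1)] H(2) H'(2)
    by (intro exI[of _ "\<lambda>x A. H x A * H' x A"]) (simp add: power_add mult_ac)
qed

lemma homogenizable_const: "homogenizable (\<lambda>z. c) d"
  unfolding homogenizable_def
  by (intro exI[of _ "\<lambda>x A. ((A *v homog x) $ None) ^ d * c"] conjI)
    (intro poly_family_mult poly_family_power poly_family_homog poly_family_const, simp)

lemma homogenizable_mono:
  assumes "homogenizable q d" "d \<le> e"
  shows "homogenizable q e"
  using homogenizable_mult[OF assms(1) homogenizable_const[of 1 "e - d"]] assms(2) by simp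

lemma homogenizable_add:
  fixes q r :: "complex^'n \<Rightarrow> complex"
  assumes "homogenizable q d" "homogenizable r d"
  shows "homogenizable (\<lambda>z. q z + r z) d"
proof -
  obtain H :: "complex^'n \<Rightarrow> 'n hmat \<Rightarrow> complex" where H: "poly_family H" "\<And>x A. (A *v homog x) $ None \<noteq> 0 \<Longrightarrow>
      H x A = ((A *v homog x) $ None) ^ d * q (\<chi> k. (A *v homog x) $ Some k / (A *v homog x) $ None)"
    using assms(1) unfolding homogenizable_def by blast
  obtain H' :: "complex^'n \<Rightarrow> 'n hmat \<Rightarrow> complex" where H': "poly_family H'" "\<And>x A. (A *v homog x) $ None \<noteq> 0 \<Longrightarrow>
      H' x A = ((A *v homog x) $ None) ^ d * r (\<chi> k. (A *v homog x) $ Some k / (A *v homog x) $ None)"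
    using assms(2) unfolding homogenizable_def by blast
  show ?thesis unfolding homogenizable_def
    using poly_family_add[OF H(1) H'(1)] H(2) H'(2)
    by (intro exI[of _ "\<lambda>x A. H x A + H' x A"]) (simp add: distrib_left)
qed

lemma homogenizable_coordinate: "homogenizable (\<lambda>z. z $ k) 1"
  unfolding homogenizable_def
  by (intro exI[of _ "\<lambda>x A. (A *v homog x) $ Some k"] conjI poly_family_homog) simp

lemma homogenizable_prod:
  assumes "finite J" "\<And>j. j \<in> J \<Longrightarrow> \<exists>d. homogenizable (q j) d"
  shows "\<exists>d. homogenizable (\<lambda>z. \<Prod>j\<in>J. q j z) d"
  using assms
proof (induction J rule: finite_induct)
  case empty show ?case using homogenizable_const[of 1] by auto
next
  case (insert j J)
  then obtain d e where "homogenizable (q j) d" "homogenizable (\<lambda>z. \<Prod>j\<in>J. q j z) e" by blast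
  from homogenizable_mult[OF this] show ?case using insert.hyps by auto
qed

lemma homogenizable_sum:
  assumes "finite J" "\<And>j. j \<in> J \<Longrightarrow> \<exists>d. homogenizable (q j) d"
  shows "\<exists>d. homogenizable (\<lambda>z. \<Sum>j\<in>J. q j z) d"
  using assms
proof (induction J rule: finite_induct)
  case empty show ?case using homogenizable_const[of 0] by auto
next
  case (insert j J)
  then obtain d e where "homogenizable (q j) d" "homogenizable (\<lambda>z. \<Sum>j\<in>J. q j z) e" by blast
  then have "homogenizable (q j) (max d e)" "homogenizable (\<lambda>z. \<Sum>j\<in>J. q j z) (max d e)"
    using homogenizable_mono by (metis max.cobounded1, metis max.cobounded2)
  from homogenizable_add[OF this] show ?case using insert.hyps by auto
qed

lemma homogenizable_power: "homogenizable q d \<Longrightarrow> homogenizable (\<lambda>z. q z ^ k) (k * d)"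
proof (induction k)
  case 0 show ?case using homogenizable_const[of 1 0] by simp
next
  case (Suc k) then show ?case using homogenizable_mult[of q d "\<lambda>z. q z ^ k" "k * d"] by simp
qed

lemma complex_polynomial_homogenizable:
  assumes "complex_polynomial q"
  shows "\<exists>d. homogenizable q d"
proof -
  obtain I c where I: "finite (I :: ('a \<Rightarrow> nat) set)" and q: "q = (\<lambda>z. \<Sum>\<alpha>\<in>I. c \<alpha> * (\<Prod>i\<in>UNIV. z $ i ^ \<alpha> i))"
    using assms unfolding complex_polynomial_def by blast
  have "\<exists>d. homogenizable (\<lambda>z. c \<alpha> * (\<Prod>i\<in>UNIV. z $ i ^ \<alpha> i)) d" for \<alpha>
  proof -
    obtain d where d: "homogenizable (\<lambda>z. \<Prod>i\<in>UNIV. z $ i ^ \<alpha> i) d"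
      using homogenizable_prod[of UNIV "\<lambda>i z. z $ i ^ \<alpha> i"] homogenizable_power[OF homogenizable_coordinate] by auto
    show ?thesis using homogenizable_mult[OF homogenizable_const d, of "c \<alpha>" 0] by blast
  qed
  then show ?thesis unfolding q by (intro homogenizable_sum[OF I])
qed

lemma complex_polynomial_continuous: "complex_polynomial q \<Longrightarrow> continuous_on S q"
  unfolding complex_polynomial_def by (auto intro!: continuous_intros)

text \<open>The identity theorem on the complex line that joins \<open>z1\<close> to a point of \<open>S\<close>.\<close>

lemma complex_polynomial_nonzero_on_open:
  assumes q: "complex_polynomial q" and z1: "q z1 \<noteq> 0" and S: "open S" "S \<noteq> {}"
  shows "\<exists>z\<in>S. q z \<noteq> 0"
proof (rule ccontr)
  assume "\<not> ?thesis"
  then have 0: "\<And>z. z \<in> S \<Longrightarrow> q z = 0" by blast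
  obtain z0 where z0: "z0 \<in> S" using S by blast
  obtain I c where I: "finite (I :: ('a \<Rightarrow> nat) set)" and qe: "q = (\<lambda>z. \<Sum>\<alpha>\<in>I. c \<alpha> * (\<Prod>i\<in>UNIV. z $ i ^ \<alpha> i))"
    using q unfolding complex_polynomial_def by blast
  define L where "L \<zeta> = z0 + \<zeta> *s (z1 - z0)" for \<zeta>
  have contL: "continuous_on UNIV L"
  proof -
    have "L = (\<lambda>\<zeta>. \<chi> i. z0 $ i + \<zeta> * (z1 - z0) $ i)" by (simp add: L_def fun_eq_iff vec_eq_iff algebra_simps)
    moreover have "continuous_on UNIV (\<lambda>\<zeta>. \<chi> i. z0 $ i + \<zeta> * (z1 - z0) $ i)" by (intro continuous_intros)
    ultimately show ?thesis by simp
  qed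
  have hol: "(\<lambda>\<zeta>. q (L \<zeta>)) holomorphic_on UNIV"
    unfolding qe L_def by (auto intro!: holomorphic_intros)
  have op: "open (L -` S)" using contL S(1) by (simp add: continuous_on_open_vimage)
  have "q (L 1) = (\<lambda>\<zeta>. 0) (1::complex)"
  proof (rule analytic_continuation_open[where f = "\<lambda>\<zeta>. q (L \<zeta>)" and g = "\<lambda>_. 0" and s = "L -` S" and s' = UNIV])
    have "(0::complex) \<in> L -` S" using z0 by (simp add: L_def)
    then show "L -` S \<noteq> {}" by blast
    show "q (L \<zeta>) = 0" if "\<zeta> \<in> L -` S" for \<zeta> using 0 that by simp
  qed (use op hol in auto)
  then show False using z1 by (simp add: L_def)
qed

lemma finite_nonzero_on_open:
  assumes "finite J" "\<And>j. j \<in> J \<Longrightarrow> complex_polynomial (q j) \<and> (\<exists>z. q j z \<noteq> 0)" "open S" "S \<noteq> {}"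
  shows "\<exists>T\<subseteq>S. open T \<and> T \<noteq> {} \<and> (\<forall>z\<in>T. \<forall>j\<in>J. q j z \<noteq> 0)"
  using assms
proof (induction J rule: finite_induct)
  case empty then show ?case by blast
next
  case (insert j J)
  then obtain T where T: "T \<subseteq> S" "open T" "T \<noteq> {}" "\<forall>z\<in>T. \<forall>j\<in>J. q j z \<noteq> 0" by auto
  have qj: "complex_polynomial (q j)" and "\<exists>z. q j z \<noteq> 0" using insert.prems by simp_all
  then obtain z where "z \<in> T" "q j z \<noteq> 0"
    using complex_polynomial_nonzero_on_open[of "q j" _ T] T by blast
  moreover have "open (T \<inter> {z. q j z \<noteq> 0})"
    using T(2) complex_polynomial_continuous[OF qj] by (intro open_Int open_Collect_neq) auto
  ultimately show ?case using T by (intro exI[of _ "T \<inter> {z. q j z \<noteq> 0}"]) auto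
qed

subsection \<open>The equation of the invariant group\<close>

lemma det_cpoly: "cpoly (det :: complex^'a^'a \<Rightarrow> complex)"
proof -
  have "poly_family (\<lambda>(_::unit) A :: complex^'a^'a. det A)"
    unfolding det_def
    by (intro poly_family_sum poly_family_mult poly_family_const poly_family_prod poly_family_single[OF cpoly_entry])
  from poly_family_cpoly[OF this] show ?thesis .
qed

lemma SU_n1_algebraic:
  "\<exists>p. real_polynomial_function p \<and> (\<forall>A. p A \<ge> 0) \<and> (\<forall>A :: 'n::finite hmat. p A = 0 \<longleftrightarrow> A \<in> SU_n1)"
proof -
  have "poly_family (\<lambda>(_::unit) A :: 'n hmat. det A - 1)"
    by (intro poly_family_diff poly_family_const poly_family_single det_cpoly)
  from poly_family_zero_set[OF this, of UNIV] obtain p where p: "real_polynomial_function p" "\<And>A. p A \<ge> 0"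
    "\<And>A :: 'n hmat. p A = 0 \<longleftrightarrow> det A = 1" by auto
  have "poly_family (\<lambda>ij A :: 'n hmat. (adjoint_mat A ** sig_mat ** A) $ fst ij $ snd ij - sig_mat $ fst ij $ snd ij)"
  proof -
    have "poly_family (\<lambda>(_::unit) A :: 'n hmat. (adjoint_mat A ** sig_mat ** A) $ i $ j - sig_mat $ i $ j)" for i j
      unfolding matrix_matrix_mult_def adjoint_mat_def vec_lambda_beta
      by (intro poly_family_diff poly_family_sum poly_family_mult poly_family_cnj poly_family_const poly_family_single[OF cpoly_entry])
    then show ?thesis by (intro poly_family_finite_index) (rule poly_family_cpoly)
  qed
  from poly_family_zero_set[OF this, of UNIV] obtain q where q: "real_polynomial_function q" "\<And>A. q A \<ge> 0"
    "\<And>A :: 'n hmat. q A = 0 \<longleftrightarrow> adjoint_mat A ** sig_mat ** A = sig_mat" by (auto simp: vec_eq_iff)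
  show ?thesis
  proof (intro exI conjI allI)
    show "real_polynomial_function (\<lambda>A. p A + q A)" using p q by (simp add: real_polynomial_function.intros(3))
    show "p A + q A \<ge> 0" for A using p(2)[of A] q(2)[of A] by simp
    show "p A + q A = 0 \<longleftrightarrow> A \<in> SU_n1" for A
      using p(2,3)[of A] q(2,3)[of A] by (simp add: SU_n1_def add_nonneg_eq_0_iff)
  qed
qed

lemma holomorphic_map_continuous: "holomorphic_map_on f S \<Longrightarrow> continuous_on S f"
  unfolding holomorphic_map_on_def
  by (meson continuous_at_imp_continuous_on has_derivative_continuous)

lemma zero_if_zero_on_dense:
  fixes D :: "'a::topological_space \<Rightarrow> complex"
  assumes B: "open B" and cont: "continuous_on B D"
    and dense: "\<And>S. open S \<Longrightarrow> S \<noteq> {} \<Longrightarrow> S \<subseteq> B \<Longrightarrow> \<exists>x\<in>S. D x = 0" and x: "x \<in> B"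
  shows "D x = 0"
proof (rule ccontr)
  assume "D x \<noteq> 0"
  have "open (- {0 :: complex})" by (simp add: open_Compl)
  then have "open (D -` (- {0}) \<inter> B)" using B cont by (simp add: continuous_on_open_vimage)
  moreover have "x \<in> D -` (- {0}) \<inter> B" using x \<open>D x \<noteq> 0\<close> by simp
  ultimately obtain y where "y \<in> D -` (- {0}) \<inter> B" "D y = 0" using dense by blast
  then show False by simp
qed

text \<open>The product \<open>Q\<close> of the denominators may vanish in the ball. The identity \<open>P = Q f\<close> holds where it
  does not, which is a dense set, and everywhere by continuity.\<close>

lemma rational_common_denominator:
  fixes f :: "complex^'n \<Rightarrow> complex^'m"
  assumes cont: "continuous_on \<bbbB> f" and rat: "\<And>j. rational_on_ball (\<lambda>z. f z $ j)"
  obtains Q P d where "homogenizable Q d" "\<And>j. homogenizable (P j) d"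
    "\<And>z j. z \<in> \<bbbB> \<Longrightarrow> P j z = Q z * f z $ j" "continuous_on UNIV Q"
    "\<And>S. open S \<Longrightarrow> S \<noteq> {} \<Longrightarrow> \<exists>z\<in>S. Q z \<noteq> 0"
proof -
  have "\<forall>j. \<exists>p q. complex_polynomial p \<and> complex_polynomial q \<and> (\<exists>z. q z \<noteq> 0) \<and>
           (\<forall>z\<in>\<bbbB>. q z \<noteq> 0 \<longrightarrow> f z $ j = p z / q z)"
    using rat unfolding rational_on_ball_def by blast
  then obtain p q where p: "\<And>j. complex_polynomial (p j)" and q: "\<And>j. complex_polynomial (q j)" "\<And>j. \<exists>z. q j z \<noteq> 0"
    and f: "\<And>j z. z \<in> \<bbbB> \<Longrightarrow> q j z \<noteq> 0 \<Longrightarrow> f z $ j = p j z / q j z" by metis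
  define Q where "Q z = (\<Prod>j\<in>UNIV. q j z)" for z
  define P where "P j z = p j z * (\<Prod>i\<in>UNIV - {j}. q i z)" for j z
  have dense: "\<exists>z\<in>S. \<forall>j. q j z \<noteq> 0" if "open S" "S \<noteq> {}" for S
    using finite_nonzero_on_open[of UNIV q S] q that by fastforce
  have contQ: "continuous_on S Q" for S unfolding Q_def using complex_polynomial_continuous q(1) by (intro continuous_intros) blast
  have contP: "continuous_on S (P j)" for S j unfolding P_def using complex_polynomial_continuous q(1) p by (intro continuous_intros) blast+
  have PQ: "P j z = Q z * f z $ j" if z: "z \<in> \<bbbB>" for z j
  proof -
    have "continuous_on \<bbbB> (\<lambda>z. P j z - Q z * f z $ j)" by (intro continuous_intros contP contQ cont)
    then have "P j z - Q z * f z $ j = 0"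
    proof (rule zero_if_zero_on_dense[OF open_ball _ _ z])
      fix S :: "(complex^'n) set" assume S: "open S" "S \<noteq> {}" "S \<subseteq> \<bbbB>"
      obtain w where w: "w \<in> S" "\<And>j. q j w \<noteq> 0" using dense[OF S(1,2)] by blast
      have "Q w = q j w * (\<Prod>i\<in>UNIV - {j}. q i w)" unfolding Q_def by (rule prod.remove) auto
      then have "P j w = Q w * f w $ j" unfolding P_def f[OF subsetD[OF S(3) w(1)] w(2)] using w(2)[of j] by simp
      then show "\<exists>w\<in>S. P j w - Q w * f w $ j = 0" using w(1) by auto
    qed
    then show ?thesis by simp
  qed
  have hq: "\<exists>d. homogenizable Q d" unfolding Q_def
    by (rule homogenizable_prod) (simp_all add: complex_polynomial_homogenizable q(1))
  have hp: "\<exists>d. homogenizable (P j) d" for j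
  proof -
    obtain d where "homogenizable (p j) d" using complex_polynomial_homogenizable[OF p] by blast
    moreover obtain e where "homogenizable (\<lambda>z. \<Prod>i\<in>UNIV - {j}. q i z) e"
      using homogenizable_prod[of "UNIV - {j}" q] complex_polynomial_homogenizable[OF q(1)] by auto
    ultimately show ?thesis unfolding P_def using homogenizable_mult by blast
  qed
  obtain dq where dq: "homogenizable Q dq" using hq by blast
  obtain dp where dp: "\<And>j. homogenizable (P j) (dp j)" using hp by metis
  define d where "d = dq + (\<Sum>j\<in>UNIV. dp j)"
  have 1: "homogenizable Q d" by (rule homogenizable_mono[OF dq]) (simp add: d_def)
  have 2: "homogenizable (P j) d" for j
    by (rule homogenizable_mono[OF dp]) (simp add: d_def member_le_sum trans_le_add2)
  have 3: "\<exists>z\<in>S. Q z \<noteq> 0" if "open S" "S \<noteq> {}" for S using dense[OF that] by (auto simp: Q_def)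
  show ?thesis by (rule that[OF 1 2 PQ contQ 3])
qed

lemma homogenizable_family: "(\<And>j. homogenizable (P j) d) \<Longrightarrow> \<exists>H. \<forall>j. poly_family (H j) \<and>
    (\<forall>x (A :: 'n::finite hmat). (A *v homog x) $ None \<noteq> 0 \<longrightarrow>
      H j x A = ((A *v homog x) $ None) ^ d * P j (\<chi> k. (A *v homog x) $ Some k / (A *v homog x) $ None))"
  unfolding homogenizable_def by (rule choice) blast

lemma kform_continuous:
  assumes "continuous_on S g" "continuous_on S h"
  shows "continuous_on S (\<lambda>x. kform (g x) (h x))"
  unfolding kform_def herm_def using assms by (intro continuous_intros)

text \<open>The equations say that \<open>f \<circ> \<gamma>\<close> and \<open>f\<close> have the same cross ratios, for all triples \<open>(x, y, u)\<close>. With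
  \<open>f = P / Q\<close> the kernel at \<open>f (\<gamma> x)\<close>, \<open>f (\<gamma> y)\<close> is multiplied by factors \<open>w A x\<close> and \<open>cnj (w A y)\<close>,
  which turns it into the polynomial \<open>N x y\<close> in \<open>A\<close>. Where these factors vanish the equations say
  nothing; but for each \<open>A\<close> they are nonzero at a dense set of points, and cross ratios are continuous.\<close>

theorem invariant_group_algebraic:
  fixes f :: "complex^'n \<Rightarrow> complex^'m"
  assumes contf: "continuous_on \<bbbB> f" and fB: "\<And>z. z \<in> \<bbbB> \<Longrightarrow> f z \<in> \<bbbB>"
    and rat: "\<And>j. rational_on_ball (\<lambda>z. f z $ j)"
  shows "\<exists>p. real_polynomial_function p \<and> (\<forall>A. p A \<ge> 0) \<and>
    {A. p A = 0} = {A \<in> SU_n1. ball_action A \<in> hermitian_invariant_group f}"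
proof (rule rational_common_denominator[OF contf rat])
  let ?B = "\<bbbB> :: (complex^'n) set"
  fix Q P d
  assume Qd: "homogenizable Q d" and Pd: "\<And>j. homogenizable (P j) d"
    and PQ: "\<And>z j. z \<in> ?B \<Longrightarrow> P j z = Q z * f z $ j"
    and contQ: "continuous_on UNIV Q" and Qdense: "\<And>S. open S \<Longrightarrow> S \<noteq> {} \<Longrightarrow> \<exists>z\<in>S. Q z \<noteq> 0"
  obtain H :: "complex^'n \<Rightarrow> 'n hmat \<Rightarrow> complex" where H: "poly_family H" "\<And>x A. (A *v homog x) $ None \<noteq> 0 \<Longrightarrow>
      H x A = ((A *v homog x) $ None) ^ d * Q (\<chi> k. (A *v homog x) $ Some k / (A *v homog x) $ None)"
    using Qd unfolding homogenizable_def by blast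
  obtain G where G: "\<And>j. poly_family (G j)" "\<And>j x A. (A *v homog x) $ None \<noteq> 0 \<Longrightarrow>
      G j x (A :: 'n hmat) = ((A *v homog x) $ None) ^ d * P j (\<chi> k. (A *v homog x) $ Some k / (A *v homog x) $ None)"
    using homogenizable_family[of P d, OF Pd] by blast
  define N where "N x y A = H x A * cnj (H y A) - (\<Sum>j\<in>UNIV. G j x A * cnj (G j y A))" for x y A
  define w where "w A x = ((A *v homog x) $ None) ^ d * Q (ball_action A x)" for A :: "'n hmat" and x
  have N: "N x y A = w A x * cnj (w A y) * kform (f (ball_action A x)) (f (ball_action A y))"
    if A: "A \<in> SU_n1" and x: "x \<in> ?B" and y: "y \<in> ?B" for x y A
  proof -
    have iA: "herm_isometry sg A" using A by (simp add: SU_n1_iff)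
    have act: "(\<chi> k. (A *v homog x) $ Some k / (A *v homog x) $ None) = ball_action A x" if "x \<in> ?B" for x
      using that by (simp add: ball_action_def)
    have Hw: "H x A = w A x" if "x \<in> ?B" for x
      using H(2)[OF isometry_denominator(1)[OF iA that]] unfolding act[OF that] w_def .
    have Gw: "G j x A = w A x * f (ball_action A x) $ j" if "x \<in> ?B" for x j
      using G(2)[OF isometry_denominator(1)[OF iA that], of j]
      unfolding act[OF that] w_def PQ[OF ball_action_mem[OF iA that]] by (simp only: mult.assoc)
    show ?thesis unfolding N_def Hw[OF x] Hw[OF y] Gw[OF x] Gw[OF y] kform_def herm_def
      by (simp add: algebra_simps sum_distrib_left)
  qed
  define T where "T i A = (case i of (x, y, u) \<Rightarrow>
    N x y A * N u u A * kform (f x) (f u) * kform (f u) (f y) -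
    kform (f x) (f y) * kform (f u) (f u) * N x u A * N u y A)" for i A
  have "poly_family T"
  proof -
    have Hr: "poly_family (\<lambda>i A. H (\<phi> i) A)" for \<phi> :: "(complex^'n) \<times> (complex^'n) \<times> (complex^'n) \<Rightarrow> complex^'n"
      by (rule poly_family_reindex[OF H(1)])
    have Gr: "poly_family (\<lambda>i A. G j (\<phi> i) A)" for j and \<phi> :: "(complex^'n) \<times> (complex^'n) \<times> (complex^'n) \<Rightarrow> complex^'n"
      by (rule poly_family_reindex[OF G(1)])
    have "poly_family (\<lambda>i A. N (\<phi> i) (\<psi> i) A)" for \<phi> \<psi> :: "(complex^'n) \<times> (complex^'n) \<times> (complex^'n) \<Rightarrow> complex^'n"
      unfolding N_def
      by (intro poly_family_diff poly_family_sum poly_family_mult poly_family_cnj Hr Gr)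
    then show ?thesis unfolding T_def case_prod_unfold
      by (intro poly_family_diff poly_family_mult poly_family_const)
  qed
  from poly_family_zero_set[OF this, of "?B \<times> ?B \<times> ?B"]
  obtain p where p: "real_polynomial_function p" "\<And>A. p A \<ge> 0"
    "\<And>A. p A = 0 \<longleftrightarrow> (\<forall>i\<in>?B \<times> ?B \<times> ?B. T i A = 0)" by blast
  obtain q where q: "real_polynomial_function q" "\<And>A. q A \<ge> 0" "\<And>A :: 'n hmat. q A = 0 \<longleftrightarrow> A \<in> SU_n1"
    using SU_n1_algebraic by blast
  have key: "(\<forall>i\<in>?B \<times> ?B \<times> ?B. T i A = 0) \<longleftrightarrow> ball_action A \<in> hermitian_invariant_group f"
    if A: "A \<in> SU_n1" for A
  proof
    let ?\<gamma> = "ball_action A"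
    have iA: "herm_isometry sg A" using A by (simp add: SU_n1_iff)
    note \<gamma>B = ball_action_mem[OF iA]
    have Tw: "T (x, y, u) A = w A x * cnj (w A y) * w A u * cnj (w A u) *
      (kform (f (?\<gamma> x)) (f (?\<gamma> y)) * kform (f (?\<gamma> u)) (f (?\<gamma> u)) * kform (f x) (f u) * kform (f u) (f y) -
       kform (f x) (f y) * kform (f u) (f u) * kform (f (?\<gamma> x)) (f (?\<gamma> u)) * kform (f (?\<gamma> u)) (f (?\<gamma> y)))"
      if "x \<in> ?B" "y \<in> ?B" "u \<in> ?B" for x y u
      unfolding T_def prod.case N[OF A that(1,2)] N[OF A that(3,3)] N[OF A that(1,3)] N[OF A that(3,2)]
      by (simp add: algebra_simps)
    {
      assume "?\<gamma> \<in> hermitian_invariant_group f"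
      then obtain \<psi> where \<psi>: "\<psi> \<in> ball_aut" "\<And>z. z \<in> ?B \<Longrightarrow> f (?\<gamma> z) = \<psi> (f z)"
        unfolding hermitian_invariant_group_def by auto
      have "T (x, y, u) A = 0" if "x \<in> ?B" "y \<in> ?B" "u \<in> ?B" for x y u
        unfolding Tw[OF that] \<psi>(2)[OF that(1)] \<psi>(2)[OF that(2)] \<psi>(2)[OF that(3)]
          automorphism_imp_cross_ratio[OF \<psi>(1) fB[OF that(1)] fB[OF that(2)] fB[OF that(3)]] by simp
      then show "\<forall>i\<in>?B \<times> ?B \<times> ?B. T i A = 0" by auto
    next
      assume T0: "\<forall>i\<in>?B \<times> ?B \<times> ?B. T i A = 0"
      obtain C where C: "herm_isometry sg C" "A ** C = mat 1" using herm_isometry_inverse[OF iA] by auto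
      have dense: "\<exists>x\<in>S. w A x \<noteq> 0" if S: "open S" "S \<noteq> {}" "S \<subseteq> ?B" for S
      proof -
        let ?S = "ball_action C -` S \<inter> ?B"
        have AC: "?\<gamma> (ball_action C z) = z" if "z \<in> ?B" for z
          using ball_action_mult[OF iA C(1) that] ball_action_mat1[OF that] by (simp add: C)
        obtain D where D: "herm_isometry sg D" "C ** D = mat 1" using herm_isometry_inverse[OF C(1)] by auto
        have CD: "ball_action C (ball_action D z) = z" if "z \<in> ?B" for z
          using ball_action_mult[OF C(1) D(1) that] ball_action_mat1[OF that] by (simp add: D)
        have "continuous_on ?B (ball_action C)"
          by (rule holomorphic_map_continuous[OF ball_action_holomorphic[OF C(1)]])
        then have "open ?S" using S(1) by (simp add: continuous_on_open_vimage)
        moreover obtain s where s: "s \<in> S" using S by blast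
        then have "ball_action D s \<in> ?S" using CD ball_action_mem[OF D(1)] S(3) by auto
        ultimately obtain z where z: "z \<in> ?S" "Q z \<noteq> 0" using Qdense by blast
        let ?x = "ball_action C z"
        have zB: "z \<in> ?B" using z(1) by blast
        have "w A ?x \<noteq> 0" unfolding w_def AC[OF zB]
          using isometry_denominator(1)[OF iA ball_action_mem[OF C(1) zB]] z(2) by simp
        then show ?thesis using z(1) by blast
      qed
      \<comment> \<open>A single base point suffices; it may depend on \<open>A\<close>.\<close>
      obtain u where u: "u \<in> ?B" "w A u \<noteq> 0" using dense[of ?B] by auto
      define D where "D x y = kform (f (?\<gamma> x)) (f (?\<gamma> y)) * kform (f (?\<gamma> u)) (f (?\<gamma> u)) * kform (f x) (f u) * kform (f u) (f y) -
       kform (f x) (f y) * kform (f u) (f u) * kform (f (?\<gamma> x)) (f (?\<gamma> u)) * kform (f (?\<gamma> u)) (f (?\<gamma> y))" for x y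
      have cont\<gamma>: "continuous_on ?B (\<lambda>x. f (?\<gamma> x))"
        using holomorphic_map_continuous[OF ball_action_holomorphic[OF iA]] contf \<gamma>B
        by (intro continuous_on_compose2[OF contf]) auto
      have contD: "continuous_on ?B (\<lambda>x. D x y)" "continuous_on ?B (\<lambda>x. D y x)" for y
        unfolding D_def
        by (intro continuous_on_diff continuous_on_mult continuous_on_const kform_continuous cont\<gamma> contf)+
      have D0: "D x y = 0" if "x \<in> ?B" "y \<in> ?B" "w A x \<noteq> 0" "w A y \<noteq> 0" for x y
      proof -
        have "T (x, y, u) A = 0" using T0 that u by blast
        moreover have "T (x, y, u) A = w A x * cnj (w A y) * w A u * cnj (w A u) * D x y"
          unfolding D_def by (rule Tw[OF that(1,2) u(1)])
        ultimately have "w A x * cnj (w A y) * w A u * cnj (w A u) * D x y = 0" by simp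
        then show ?thesis using that(3,4) u(2) by (simp only: mult_eq_0_iff complex_cnj_zero_iff) blast
      qed
      have D1: "D x y = 0" if y: "y \<in> ?B" "w A y \<noteq> 0" and x: "x \<in> ?B" for x y
      proof (rule zero_if_zero_on_dense[OF open_ball contD(1) _ x])
        show "\<exists>x\<in>S. D x y = 0" if "open S" "S \<noteq> {}" "S \<subseteq> ?B" for S using dense[OF that] D0 y that(3) by blast
      qed
      have D2: "D x y = 0" if x: "x \<in> ?B" and y: "y \<in> ?B" for x y
      proof (rule zero_if_zero_on_dense[OF open_ball contD(2) _ y])
        show "\<exists>y\<in>S. D x y = 0" if "open S" "S \<noteq> {}" "S \<subseteq> ?B" for S using dense[OF that] D1 x that(3) by blast
      qed
      have "\<exists>\<psi>\<in>ball_aut. \<forall>x\<in>?B. f (?\<gamma> x) = \<psi> (f x)"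
      proof (rule cross_ratio_imp_automorphism[OF _ _ u(1)])
        fix x y assume "x \<in> ?B" "y \<in> ?B"
        from D2[OF this] show "kform (f (?\<gamma> x)) (f (?\<gamma> y)) * kform (f (?\<gamma> u)) (f (?\<gamma> u)) * kform (f x) (f u) * kform (f u) (f y) =
          kform (f x) (f y) * kform (f u) (f u) * kform (f (?\<gamma> x)) (f (?\<gamma> u)) * kform (f (?\<gamma> u)) (f (?\<gamma> y))"
          unfolding D_def by (simp only: right_minus_eq)
      qed (use fB \<gamma>B in blast)+
      then show "?\<gamma> \<in> hermitian_invariant_group f"
        unfolding hermitian_invariant_group_def using ball_action_aut[OF iA] by simp
    }
  qed
  show ?thesis
  proof (intro exI conjI allI)
    show "real_polynomial_function (\<lambda>A. p A + q A)" using p q by (simp add: real_polynomial_function.intros(3))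
    show "p A + q A \<ge> 0" for A using p(2)[of A] q(2)[of A] by simp
    have "p A + q A = 0 \<longleftrightarrow> A \<in> SU_n1 \<and> ball_action A \<in> hermitian_invariant_group f" for A
      using add_nonneg_eq_0_iff[OF p(2)[of A] q(2)[of A]] p(3)[of A] q(3)[of A] key[of A] by blast
    then show "{A. p A + q A = 0} = {A \<in> SU_n1. ball_action A \<in> hermitian_invariant_group f}" by blast
  qed
qed

section \<open>Complex differentiable maps are smooth\<close>

lemma Ck_on_cong:
  assumes "open W" "\<And>x. x \<in> W \<Longrightarrow> f x = g x" "Ck_on k W f"
  shows "Ck_on k W g"
  using assms(2,3)
proof (induction k arbitrary: f g)
  case 0
  then show ?case by (simp cong: continuous_on_cong)
next
  case (Suc k)
  have der: "(g has_derivative frechet_derivative f (at x)) (at x)" if x: "x \<in> W" for x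
  proof (rule has_derivative_transform_within_open[OF _ assms(1) x])
    show "(f has_derivative frechet_derivative f (at x)) (at x)"
      using Suc.prems(2) x by (simp add: frechet_derivative_works)
  qed (rule Suc.prems(1))
  have fd: "frechet_derivative f (at x) v = frechet_derivative g (at x) v" if "x \<in> W" for x v
    using frechet_derivative_at[OF der[OF that]] by simp
  show ?case
  proof (simp only: Ck_on.simps, intro conjI ballI allI)
    show "g differentiable at x" if "x \<in> W" for x using der[OF that] by (rule differentiableI)
    show "Ck_on k W (\<lambda>x. frechet_derivative g (at x) v)" for v
      by (rule Suc.IH[OF fd]) (use Suc.prems(2) in auto)
  qed
qed

lemma Ck_on_vec:
  fixes f :: "'a::euclidean_space \<Rightarrow> ('b::euclidean_space)^'n"
  assumes W: "open W" and f: "\<And>i. Ck_on k W (\<lambda>x. f x $ i)"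
  shows "Ck_on k W f"
  using f
proof (induction k arbitrary: f)
  case 0
  then have "continuous_on W (\<lambda>x. \<chi> i. f x $ i)" by (intro continuous_on_vec_lambda) simp
  then show ?case by simp
next
  case (Suc k)
  let ?d = "\<lambda>x v. \<chi> i. frechet_derivative (\<lambda>x. f x $ i) (at x) v"
  have der: "(f has_derivative ?d x) (at x)" if x: "x \<in> W" for x
  proof (rule has_derivative_vec)
    fix i
    have "(\<lambda>x. f x $ i) differentiable at x" using Suc.prems[of i] x by simp
    then show "((\<lambda>x. f x $ i) has_derivative (\<lambda>h. ?d x h $ i)) (at x)"
      unfolding vec_lambda_beta frechet_derivative_works .
  qed
  have fd: "?d x v = frechet_derivative f (at x) v" if "x \<in> W" for x v
    using frechet_derivative_at[OF der[OF that]] by metis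
  show ?case
  proof (simp only: Ck_on.simps, intro conjI ballI allI)
    show "f differentiable at x" if "x \<in> W" for x using der[OF that] by (rule differentiableI)
    fix v
    have *: "Ck_on k W (\<lambda>x. ?d x v)" by (rule Suc.IH) (use Suc.prems in simp)
    show "Ck_on k W (\<lambda>x. frechet_derivative f (at x) v)" by (rule Ck_on_cong[OF W fd *])
  qed
qed

text \<open>The map \<open>J\<close> plays the role of multiplication by the imaginary unit on the source, which is only a
  real vector space. Matrices are the intended case, with \<open>J A = mat \<i> ** A\<close>.\<close>

definition cdiff :: "('a::euclidean_space \<Rightarrow> 'a) \<Rightarrow> 'a set \<Rightarrow> ('a \<Rightarrow> complex) \<Rightarrow> bool"
  where "cdiff J W F \<longleftrightarrow> (\<forall>x\<in>W. \<exists>F'. (F has_derivative F') (at x) \<and> (\<forall>h. F' (J h) = \<i> * F' h))"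

text \<open>The multiple of \<open>v\<close> by \<open>\<zeta>\<close> in the complex structure \<open>J\<close>.\<close>

definition line_point :: "('a::euclidean_space \<Rightarrow> 'a) \<Rightarrow> 'a \<Rightarrow> complex \<Rightarrow> 'a"
  where "line_point J v \<zeta> = Re \<zeta> *\<^sub>R v + Im \<zeta> *\<^sub>R J v"

lemma norm_line_point: "norm (line_point J v \<zeta>) \<le> norm \<zeta> * (norm v + norm (J v))"
proof -
  have "norm (line_point J v \<zeta>) \<le> \<bar>Re \<zeta>\<bar> * norm v + \<bar>Im \<zeta>\<bar> * norm (J v)"
    unfolding line_point_def using norm_triangle_ineq[of "Re \<zeta> *\<^sub>R v" "Im \<zeta> *\<^sub>R J v"] by simp
  also have "\<dots> \<le> norm \<zeta> * norm v + norm \<zeta> * norm (J v)"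
    by (intro add_mono mult_right_mono abs_Re_le_cmod abs_Im_le_cmod) simp_all
  finally show ?thesis by (simp add: distrib_left)
qed

lemma cdiff_frechet:
  assumes "cdiff J W F" "x \<in> W"
  shows "(F has_derivative frechet_derivative F (at x)) (at x)"
    and "frechet_derivative F (at x) (J h) = \<i> * frechet_derivative F (at x) h"
proof -
  obtain F' where F': "(F has_derivative F') (at x)" "\<forall>h. F' (J h) = \<i> * F' h"
    using assms unfolding cdiff_def by blast
  have "F' = frechet_derivative F (at x)" by (rule frechet_derivative_at[OF F'(1)])
  then show "(F has_derivative frechet_derivative F (at x)) (at x)"
    "frechet_derivative F (at x) (J h) = \<i> * frechet_derivative F (at x) h" using F' by auto
qed

text \<open>Cauchy's integral formula for the derivative, on the complex line through \<open>y\<close> in the direction \<open>v\<close>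
  and with the circle parametrised over the unit interval. The integrand involves no derivative
  of \<open>F\<close>, so regularity of \<open>F\<close> passes to its derivative.\<close>

lemma cdiff_cauchy:
  assumes F: "cdiff J W F" and r: "r > 0"
    and sub: "\<And>\<zeta>. norm \<zeta> \<le> r \<Longrightarrow> y + line_point J v \<zeta> \<in> W"
  shows "((\<lambda>s. F (y + line_point J v (of_real r * exp (2 * of_real pi * \<i> * of_real s))) / (of_real r * exp (2 * of_real pi * \<i> * of_real s)))
    has_integral frechet_derivative F (at y) v) {0..1}"
proof -
  define h where "h \<zeta> = F (y + line_point J v \<zeta>)" for \<zeta>
  have lin: "((\<lambda>\<zeta>. y + line_point J v \<zeta>) has_derivative line_point J v) (at \<zeta>)" for \<zeta>
    unfolding line_point_def by (auto intro!: derivative_eq_intros)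
  have hder: "(h has_field_derivative frechet_derivative F (at (y + line_point J v \<zeta>)) v) (at \<zeta>)" if "norm \<zeta> \<le> r" for \<zeta>
  proof -
    let ?D = "frechet_derivative F (at (y + line_point J v \<zeta>))"
    note D = cdiff_frechet[OF F sub[OF that]]
    have linD: "linear ?D" using D(1) has_derivative_linear by blast
    have "(h has_derivative (\<lambda>d. ?D (line_point J v d))) (at \<zeta>)"
      unfolding h_def using diff_chain_at[OF lin D(1)] by (simp add: o_def)
    moreover have "?D (line_point J v d) = ?D v * d" for d
    proof -
      have "?D (line_point J v d) = Re d *\<^sub>R ?D v + Im d *\<^sub>R ?D (J v)"
        unfolding line_point_def[of J v d] linear_add[OF linD] linear_scale[OF linD] ..
      also have "\<dots> = ?D v * (of_real (Re d) + \<i> * of_real (Im d))"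
        unfolding D(2) by (simp add: scaleR_conv_of_real algebra_simps)
      finally show ?thesis by (simp add: complex_eq[symmetric])
    qed
    ultimately show ?thesis by (simp add: has_field_derivative_def)
  qed
  have cont: "continuous_on (cball 0 r) h"
  proof (intro continuous_at_imp_continuous_on ballI)
    fix \<zeta> :: complex assume "\<zeta> \<in> cball 0 r"
    then show "isCont h \<zeta>" by (intro DERIV_isCont[OF hder]) simp
  qed
  have hol: "h holomorphic_on ball 0 r"
    unfolding holomorphic_on_open[OF open_ball] using hder by force
  have "((\<lambda>u. h u / (u - 0) ^ Suc 1) has_contour_integral (2 * pi * \<i>) / fact 1 * (deriv ^^ 1) h 0) (circlepath 0 r)"
    by (rule Cauchy_has_contour_integral_higher_derivative_circlepath[OF cont hol]) (use r in simp)
  moreover have "(deriv ^^ 1) h 0 = frechet_derivative F (at y) v"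
    using DERIV_imp_deriv[OF hder[of 0]] r by (simp add: line_point_def)
  ultimately have "((\<lambda>u. h u / u ^ 2) has_contour_integral (2 * pi * \<i>) * frechet_derivative F (at y) v) (circlepath 0 r)"
    by (simp add: power2_eq_square)
  then have "((\<lambda>s. h (circlepath 0 r s) / (circlepath 0 r s) ^ 2 * vector_derivative (circlepath 0 r) (at s))
      has_integral (2 * pi * \<i>) * frechet_derivative F (at y) v) {0..1}"
    unfolding has_contour_integral .
  then have "((\<lambda>s. (1 / (2 * pi * \<i>)) * (h (circlepath 0 r s) / (circlepath 0 r s) ^ 2 * vector_derivative (circlepath 0 r) (at s)))
      has_integral (1 / (2 * pi * \<i>)) * ((2 * pi * \<i>) * frechet_derivative F (at y) v)) {0..1}"
    by (rule has_integral_mult_right)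
  moreover have "(1 / (2 * pi * \<i>)) * ((2 * pi * \<i>) * c) = c" for c by simp
  moreover have "(1 / (2 * pi * \<i>)) * (h (circlepath 0 r s) / (circlepath 0 r s) ^ 2 * vector_derivative (circlepath 0 r) (at s))
    = F (y + line_point J v (of_real r * exp (2 * of_real pi * \<i> * of_real s))) / (of_real r * exp (2 * of_real pi * \<i> * of_real s))"
    for s
  proof -
    have "vector_derivative (circlepath 0 r) (at s) = 2 * pi * \<i> * r * exp (2 * pi * \<i> * s)"
      by (simp add: vector_derivative_circlepath)
    then show ?thesis using r by (simp add: h_def circlepath power2_eq_square)
  qed
  ultimately show ?thesis by (simp only:)
qed

lemma cdiff_continuous: "cdiff J W F \<Longrightarrow> continuous_on W F"
  unfolding cdiff_def by (meson continuous_at_imp_continuous_on has_derivative_continuous)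

lemma continuous_line_integrand:
  assumes G: "continuous_on W (G :: 'a::euclidean_space \<Rightarrow> 'b::real_normed_vector)" and sub: "\<And>y \<zeta>. y \<in> U \<Longrightarrow> norm \<zeta> \<le> r \<Longrightarrow> y + line_point J v \<zeta> \<in> W" and r: "r > 0"
  shows "continuous_on (U \<times> cbox 0 1) (\<lambda>(y, s :: real). G (y + line_point J v (of_real r * exp (2 * of_real pi * \<i> * of_real s))))"
proof -
  have "continuous_on (U \<times> cbox 0 1) (\<lambda>p. G (fst p + line_point J v (of_real r * exp (2 * of_real pi * \<i> * of_real (snd p)))))"
  proof (rule continuous_on_compose2[OF G])
    show "continuous_on (U \<times> cbox 0 1) (\<lambda>p. fst p + line_point J v (of_real r * exp (2 * of_real pi * \<i> * of_real (snd p))))"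
      unfolding line_point_def by (intro continuous_intros)
    show "(\<lambda>p. fst p + line_point J v (of_real r * exp (2 * of_real pi * \<i> * of_real (snd p)))) ` (U \<times> cbox 0 1) \<subseteq> W"
      using r by (auto intro!: sub simp: norm_mult)
  qed
  then show ?thesis by (simp add: case_prod_unfold)
qed

text \<open>One radius for all centres \<open>y\<close> near \<open>x\<close>, so that the integral formula can be differentiated in \<open>y\<close>.\<close>

lemma circle_radius:
  assumes "open W" "x \<in> W"
  obtains e r where "e > 0" "r > 0" "ball x e \<subseteq> W" "\<And>y \<zeta>. y \<in> ball x e \<Longrightarrow> norm (\<zeta>::complex) \<le> r \<Longrightarrow> y + line_point J v \<zeta> \<in> W"
proof -
  obtain d where d: "d > 0" "ball x d \<subseteq> W" using assms open_contains_ball by blast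
  define r where "r = d / 2 / (norm v + norm (J v) + 1)"
  have p: "norm v + norm (J v) + 1 > 0" by (simp add: add_nonneg_pos)
  show ?thesis
  proof (rule that[of "d / 2" r])
    show "d / 2 > 0" and "r > 0" using d p by (simp_all add: r_def)
    show "ball x (d / 2) \<subseteq> W" using d(1) subset_ball[of "d / 2" d x] d(2) by auto
    fix y and \<zeta> :: complex assume y: "y \<in> ball x (d / 2)" and z: "norm \<zeta> \<le> r"
    have "norm (line_point J v \<zeta>) \<le> norm \<zeta> * (norm v + norm (J v))" by (rule norm_line_point)
    also have "\<dots> \<le> r * (norm v + norm (J v) + 1)" using z \<open>r > 0\<close> by (intro mult_mono) auto
    also have "\<dots> = d / 2"
    proof -
      have "a / b * b = a" if "b > 0" for a b :: real using that by simp
      from this[OF p] show ?thesis unfolding r_def .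
    qed
    finally have "norm (line_point J v \<zeta>) \<le> d / 2" .
    then have "dist x (y + line_point J v \<zeta>) < d"
      using y norm_triangle_ineq[of "y - x" "line_point J v \<zeta>"] by (simp add: dist_norm norm_minus_commute algebra_simps)
    then show "y + line_point J v \<zeta> \<in> W" using d by auto
  qed
qed

lemma cdiff_C1:
  assumes F: "cdiff J W F" and W: "open W"
  shows "continuous_on W (\<lambda>x. frechet_derivative F (at x) v)"
proof (rule continuous_at_imp_continuous_on, rule ballI)
  fix x assume x: "x \<in> W"
  obtain e r where er: "e > 0" "r > 0" "ball x e \<subseteq> W"
    and sub: "\<And>y \<zeta>. y \<in> ball x e \<Longrightarrow> norm \<zeta> \<le> r \<Longrightarrow> y + line_point J v (\<zeta>::complex) \<in> W"
    using circle_radius[OF W x, of J v] by blast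
  let ?c = "\<lambda>s::real. of_real r * exp (2 * of_real pi * \<i> * of_real s)"
  have rep: "frechet_derivative F (at y) v = integral (cbox 0 1) (\<lambda>s. F (y + line_point J v (?c s)) / ?c s)" if "y \<in> ball x e" for y
    using integral_unique[OF cdiff_cauchy[OF F er(2) sub[OF that]]] by simp
  have "continuous_on (ball x e \<times> cbox 0 1) (\<lambda>(y, s). F (y + line_point J v (?c s)) / ?c s)"
    using continuous_line_integrand[where U = "ball x e", OF cdiff_continuous[OF F] sub er(2)] er(2)
    unfolding case_prod_unfold by (intro continuous_intros) auto
  then have "continuous_on (ball x e) (\<lambda>y. integral (cbox 0 1) (\<lambda>s. F (y + line_point J v (?c s)) / ?c s))"
    by (rule integral_continuous_on_param)
  then have "continuous_on (ball x e) (\<lambda>y. frechet_derivative F (at y) v)"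
    by (rule continuous_on_eq) (rule rep[symmetric])
  then show "isCont (\<lambda>x. frechet_derivative F (at x) v) x"
    using er(1) by (simp add: continuous_on_eq_continuous_at)
qed

text \<open>The integral formula is differentiated under the integral sign. The derivative of the integrand is
  continuous by \<open>cdiff_C1\<close> and complex linear.\<close>

lemma cdiff_derivative:
  assumes F: "cdiff J W F" and W: "open W" and J: "bounded_linear J"
  shows "cdiff J W (\<lambda>x. frechet_derivative F (at x) v)"
  unfolding cdiff_def
proof
  fix x assume x: "x \<in> W"
  obtain e r where er: "e > 0" "r > 0" "ball x e \<subseteq> W"
    and sub: "\<And>y \<zeta>. y \<in> ball x e \<Longrightarrow> norm \<zeta> \<le> r \<Longrightarrow> y + line_point J v (\<zeta>::complex) \<in> W"
    using circle_radius[OF W x, of J v] by blast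
  let ?c = "\<lambda>s::real. of_real r * exp (2 * of_real pi * \<i> * of_real s)"
  have c0: "?c s \<noteq> 0" for s using er(2) by simp
  have cW: "y + line_point J v (?c s) \<in> W" if "y \<in> ball x e" for y s
    using sub[OF that] er(2) by (simp add: norm_mult)
  have rep: "frechet_derivative F (at y) v = integral (cbox 0 1) (\<lambda>s. F (y + line_point J v (?c s)) / ?c s)" if "y \<in> ball x e" for y
    using integral_unique[OF cdiff_cauchy[OF F er(2) sub[OF that]]] by simp
  define DB where "DB y = Blinfun (frechet_derivative F (at y))" for y
  have DB: "blinfun_apply (DB y) = frechet_derivative F (at y)" if "y \<in> W" for y
    unfolding DB_def using has_derivative_bounded_linear[OF cdiff_frechet(1)[OF F that]]
    by (simp add: bounded_linear_Blinfun_apply)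
  have contDB: "continuous_on W DB"
  proof (rule continuous_on_blinfun_componentwise)
    fix i :: 'a assume "i \<in> Basis"
    show "continuous_on W (\<lambda>y. blinfun_apply (DB y) i)"
      using cdiff_C1[OF F W, of i] by (simp add: DB cong: continuous_on_cong)
  qed
  define fx where "fx y s = blinfun_mult_left (1 / ?c s) o\<^sub>L DB (y + line_point J v (?c s))" for y s
  have contfx: "continuous_on (ball x e \<times> cbox 0 1) (\<lambda>(y, s). fx y s)"
    using continuous_line_integrand[where U = "ball x e", OF contDB sub er(2)] er(2)
    unfolding case_prod_unfold fx_def by (intro continuous_intros) auto
  have contf: "continuous_on (cbox 0 1) (\<lambda>s. F (y + line_point J v (?c s)) / ?c s)" if "y \<in> ball x e" for y
  proof (intro continuous_on_divide)
    show "continuous_on (cbox 0 1) (\<lambda>s. F (y + line_point J v (?c s)))"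
    proof (rule continuous_on_compose2[OF cdiff_continuous[OF F]])
      show "continuous_on (cbox 0 1) (\<lambda>s. y + line_point J v (?c s))" unfolding line_point_def by (intro continuous_intros)
    qed (use cW[OF that] in auto)
  qed (use er(2) in \<open>auto intro!: continuous_intros\<close>)
  have lz: "((\<lambda>y. integral (cbox 0 1) (\<lambda>s. F (y + line_point J v (?c s)) / ?c s)) has_derivative integral (cbox 0 1) (fx x)) (at x within ball x e)"
  proof (rule leibniz_rule[OF _ _ contfx])
    fix y and s :: real assume y: "y \<in> ball x e"
    have "(F has_derivative blinfun_apply (DB (y + line_point J v (?c s)))) (at (y + line_point J v (?c s)))"
      using cdiff_frechet(1)[OF F cW[OF y]] by (simp add: DB[OF cW[OF y]])
    moreover have "((\<lambda>y. y + line_point J v (?c s)) has_derivative (\<lambda>h. h)) (at y)" by (auto intro!: derivative_eq_intros)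
    ultimately have "((\<lambda>y. F (y + line_point J v (?c s))) has_derivative blinfun_apply (DB (y + line_point J v (?c s)))) (at y)"
      using diff_chain_at[of "\<lambda>y. y + line_point J v (?c s)"] by (fastforce simp: o_def)
    then have "((\<lambda>y. F (y + line_point J v (?c s)) * (1 / ?c s)) has_derivative (\<lambda>h. blinfun_apply (DB (y + line_point J v (?c s))) h * (1 / ?c s))) (at y)"
      by (rule has_derivative_mult_left)
    moreover have "(\<lambda>h. blinfun_apply (DB (y + line_point J v (?c s))) h * (1 / ?c s)) = blinfun_apply (fx y s)"
      by (simp add: fx_def fun_eq_iff)
    moreover have "(\<lambda>y. F (y + line_point J v (?c s)) * (1 / ?c s)) = (\<lambda>y. F (y + line_point J v (?c s)) / ?c s)"
      by simp
    ultimately show "((\<lambda>y. F (y + line_point J v (?c s)) / ?c s) has_derivative blinfun_apply (fx y s)) (at y within ball x e)"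
      by (simp only: has_derivative_at_withinI)
  next
    fix y assume "y \<in> ball x e"
    then show "(\<lambda>s. F (y + line_point J v (?c s)) / ?c s) integrable_on cbox 0 1"
      by (intro integrable_continuous contf)
  qed (use er(1) in auto)
  have xe: "x \<in> ball x e" using er(1) by simp
  have der: "((\<lambda>y. frechet_derivative F (at y) v) has_derivative integral (cbox 0 1) (fx x)) (at x)"
  proof (rule has_derivative_transform_within_open[OF _ open_ball])
    show "((\<lambda>y. integral (cbox 0 1) (\<lambda>s. F (y + line_point J v (?c s)) / ?c s)) has_derivative integral (cbox 0 1) (fx x)) (at x)"
      using lz unfolding at_within_open[OF xe open_ball] .
    show "x \<in> ball x e" by (rule xe)
    show "integral (cbox 0 1) (\<lambda>s. F (y + line_point J v (?c s)) / ?c s) = frechet_derivative F (at y) v"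
      if "y \<in> ball x e" for y using rep[OF that] by (rule sym)
  qed
  have int: "fx x integrable_on cbox 0 1"
  proof (rule integrable_continuous)
    show "continuous_on (cbox 0 1) (fx x)"
      using continuous_on_compose2[OF contfx, of "cbox 0 1" "\<lambda>s. (x, s)"] xe
      by (simp add: continuous_on_Pair image_subset_iff)
  qed
  have app: "blinfun_apply (integral (cbox 0 1) (fx x)) h = integral (cbox 0 1) (\<lambda>s. fx x s h)" for h
    using blinfun_apply_integral[OF int] by simp
  have "blinfun_apply (integral (cbox 0 1) (fx x)) (J h) = \<i> * blinfun_apply (integral (cbox 0 1) (fx x)) h" for h
  proof -
    have "fx x s (J h) = \<i> * fx x s h" for s
      unfolding fx_def using cdiff_frechet(2)[OF F cW[OF xe]] by (simp add: DB[OF cW[OF xe]])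
    then show ?thesis unfolding app by simp
  qed
  with der show "\<exists>F'. ((\<lambda>x. frechet_derivative F (at x) v) has_derivative F') (at x) \<and> (\<forall>h. F' (J h) = \<i> * F' h)"
    by blast
qed

lemma cdiff_Ck:
  assumes "open W" "bounded_linear J"
  shows "cdiff J W F \<Longrightarrow> Ck_on k W F"
proof (induction k arbitrary: F)
  case 0 then show ?case by (simp add: cdiff_continuous)
next
  case (Suc k)
  have "F differentiable at x" if "x \<in> W" for x
    using cdiff_frechet(1)[OF Suc.prems that] by (rule differentiableI)
  then show ?case using Suc.IH[OF cdiff_derivative[OF Suc.prems assms]] by simp
qed

section \<open>The matrix exponential\<close>

lemma norm_matrix_power2: "(norm (A :: complex^'a^'b))\<^sup>2 = (\<Sum>i\<in>UNIV. \<Sum>j\<in>UNIV. (norm (A $ i $ j))\<^sup>2)"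
  unfolding norm_vec_def L2_set_def by (simp add: sum_nonneg)

lemma norm_matrix_mult:
  fixes A :: "complex^'b^'c" and B :: "complex^'a^'b"
  shows "norm (A ** B) \<le> norm A * norm B"
proof (rule power2_le_imp_le)
  let ?a = "\<lambda>i. \<Sum>k\<in>UNIV. (norm (A $ i $ k))\<^sup>2" and ?b = "\<lambda>j. \<Sum>k\<in>UNIV. (norm (B $ k $ j))\<^sup>2"
  have "(norm ((A ** B) $ i $ j))\<^sup>2 \<le> ?a i * ?b j" for i j
  proof -
    have "norm ((A ** B) $ i $ j) \<le> (\<Sum>k\<in>UNIV. \<bar>norm (A $ i $ k)\<bar> * \<bar>norm (B $ k $ j)\<bar>)"
      unfolding matrix_matrix_mult_def by (simp add: sum_norm_le norm_mult[symmetric])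
    also have "\<dots> \<le> L2_set (\<lambda>k. norm (A $ i $ k)) UNIV * L2_set (\<lambda>k. norm (B $ k $ j)) UNIV"
      by (rule L2_set_mult_ineq)
    finally have "(norm ((A ** B) $ i $ j))\<^sup>2 \<le> (L2_set (\<lambda>k. norm (A $ i $ k)) UNIV * L2_set (\<lambda>k. norm (B $ k $ j)) UNIV)\<^sup>2"
      by (intro power_mono) simp_all
    also have "\<dots> = ?a i * ?b j" by (simp add: L2_set_def power_mult_distrib sum_nonneg)
    finally show ?thesis .
  qed
  then have "(norm (A ** B))\<^sup>2 \<le> (\<Sum>i\<in>UNIV. \<Sum>j\<in>UNIV. ?a i * ?b j)"
    unfolding norm_matrix_power2 by (intro sum_mono)
  also have "\<dots> = (\<Sum>i\<in>UNIV. ?a i) * (\<Sum>j\<in>UNIV. ?b j)" by (simp add: sum_product)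
  also have "(\<Sum>j\<in>UNIV. ?b j) = (norm B)\<^sup>2" unfolding norm_matrix_power2 by (rule sum.swap)
  also have "(\<Sum>i\<in>UNIV. ?a i) = (norm A)\<^sup>2" unfolding norm_matrix_power2 ..
  finally show "(norm (A ** B))\<^sup>2 \<le> (norm A * norm B)\<^sup>2" by (simp add: power_mult_distrib)
qed simp

lemma matrix_scaleR_mult:
  "(r *\<^sub>R A) ** B = r *\<^sub>R (A ** (B :: complex^'a^'b))"
  "A ** (r *\<^sub>R B) = r *\<^sub>R (A ** (B :: complex^'a^'b))"
  by (simp_all add: matrix_matrix_mult_def vec_eq_iff scaleR_sum_right)

lemma matrix_add_right: "(A + A') ** B = A ** B + A' ** (B :: complex^'a^'b)"
  by (simp add: matrix_matrix_mult_def vec_eq_iff distrib_right sum.distrib)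

lemma bounded_bilinear_matrix: "bounded_bilinear ((**) :: complex^'b^'c \<Rightarrow> complex^'a^'b \<Rightarrow> complex^'a^'c)"
proof
  show "\<exists>K. \<forall>(A :: complex^'b^'c) (B :: complex^'a^'b). norm (A ** B) \<le> norm A * norm B * K"
    by (intro exI[of _ 1] allI) (simp add: norm_matrix_mult)
qed (simp_all add: matrix_scaleR_mult matrix_add_ldistrib matrix_add_right)

lemmas bounded_linear_matrix_left = bounded_bilinear.bounded_linear_left[OF bounded_bilinear_matrix]
lemmas bounded_linear_matrix_right = bounded_bilinear.bounded_linear_right[OF bounded_bilinear_matrix]

lemma matrix_neg_mult: "(- A) ** B = - (A ** (B :: complex^'a^'b))" "A ** (- B) = - (A ** (B :: complex^'a^'b))"
  using bounded_bilinear.minus_left[OF bounded_bilinear_matrix] bounded_bilinear.minus_right[OF bounded_bilinear_matrix] by blast+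

primrec mpow :: "complex^'a^'a \<Rightarrow> nat \<Rightarrow> complex^'a^'a" where
  "mpow X 0 = mat 1"
| "mpow X (Suc k) = X ** mpow X k"

definition mexp :: "complex^'a^'a \<Rightarrow> complex^'a^'a"
  where "mexp X = (\<Sum>k. (1 / fact k) *\<^sub>R mpow X k)"

text \<open>The norm is Euclidean: it is submultiplicative, but \<^term>\<open>mat 1\<close> need not have norm one.\<close>

lemma norm_mpow: "norm (mpow X k) \<le> norm (mat 1 :: complex^'a^'a) * norm (X :: complex^'a^'a) ^ k"
proof (induction k)
  case (Suc k)
  have "norm (mpow X (Suc k)) \<le> norm X * norm (mpow X k)" by (simp add: norm_matrix_mult)
  also have "\<dots> \<le> norm X * (norm (mat 1 :: complex^'a^'a) * norm X ^ k)" using Suc by (rule mult_left_mono) simp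
  finally show ?case by (simp add: mult_ac)
qed simp

lemma summable_mexp: "summable (\<lambda>k. (1 / fact k) *\<^sub>R mpow (X :: complex^'a^'a) k)"
proof (rule summable_comparison_test)
  let ?c = "norm (mat 1 :: complex^'a^'a)"
  show "summable (\<lambda>k. ?c * (inverse (fact k) * norm X ^ k))"
    by (intro summable_mult summable_exp)
  have "norm ((1 / fact k) *\<^sub>R mpow X k) \<le> ?c * (inverse (fact k) * norm X ^ k)" for k
    using mult_left_mono[OF norm_mpow[of X k], of "1 / fact k"] by (simp add: field_simps)
  then show "\<exists>N. \<forall>k\<ge>N. norm ((1 / fact k) *\<^sub>R mpow X k) \<le> ?c * (inverse (fact k) * norm X ^ k)" by blast
qed

lemma mexp_sums: "(\<lambda>k. (1 / fact k) *\<^sub>R mpow X k) sums mexp X"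
  unfolding mexp_def by (rule summable_sums[OF summable_mexp])

subsection \<open>Its derivative\<close>

text \<open>The derivative of the power map, by the product rule for factors that need not commute. Bounded linear
  functions as values allow uniform convergence of the derivative of the exponential series.\<close>

primrec dpow :: "complex^'a^'a \<Rightarrow> nat \<Rightarrow> (complex^'a^'a) \<Rightarrow>\<^sub>L (complex^'a^'a)" where
  "dpow X 0 = 0"
| "dpow X (Suc k) = Blinfun (\<lambda>V. V ** mpow X k) + (Blinfun (\<lambda>V. X ** V) o\<^sub>L dpow X k)"

lemma Blinfun_matrix:
  "blinfun_apply (Blinfun (\<lambda>V. V ** (Y :: complex^'a^'a))) V = (V :: complex^'a^'a) ** Y"
  "blinfun_apply (Blinfun (\<lambda>V. Y ** (V :: complex^'a^'a))) V = Y ** V"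
  by (simp_all add: bounded_linear_Blinfun_apply bounded_linear_matrix_left bounded_linear_matrix_right)

lemma dpow_Suc_apply: "dpow X (Suc k) V = V ** mpow X k + X ** dpow X k V"
  by (simp add: Blinfun_matrix blinfun.add_left)

lemma mpow_has_derivative: "((\<lambda>X. mpow X k) has_derivative blinfun_apply (dpow X k)) (at X)"
proof (induction k)
  case 0 then show ?case by simp
next
  case (Suc k)
  have "((\<lambda>X. X ** mpow X k) has_derivative (\<lambda>V. X ** dpow X k V + V ** mpow X k)) (at X)"
    by (rule bounded_bilinear.FDERIV[OF bounded_bilinear_matrix has_derivative_ident Suc])
  moreover have "(\<lambda>V. X ** dpow X k V + V ** mpow X k) = blinfun_apply (dpow X (Suc k))"
    by (rule ext) (simp only: dpow_Suc_apply add.commute)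
  ultimately show ?case by simp
qed

lemma norm_dpow: "norm (dpow X k) \<le> norm (mat 1 :: complex^'a^'a) * real k * norm (X :: complex^'a^'a) ^ (k - 1)"
proof (rule norm_blinfun_bound)
  let ?c = "norm (mat 1 :: complex^'a^'a)"
  show "0 \<le> ?c * real k * norm X ^ (k - 1)" by simp
  show "norm (dpow X k V) \<le> ?c * real k * norm X ^ (k - 1) * norm V" for V
  proof (induction k)
    case (Suc k)
    have "norm (dpow X (Suc k) V) \<le> norm V * norm (mpow X k) + norm X * norm (dpow X k V)"
      unfolding dpow_Suc_apply
      using norm_triangle_ineq[of "V ** mpow X k" "X ** dpow X k V"] norm_matrix_mult[of V "mpow X k"]
        norm_matrix_mult[of X "dpow X k V"] by linarith
    also have "\<dots> \<le> norm V * (?c * norm X ^ k) + norm X * (?c * real k * norm X ^ (k - 1) * norm V)"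
      by (intro add_mono mult_left_mono norm_mpow Suc) simp_all
    also have "norm X * (?c * real k * norm X ^ (k - 1) * norm V) = ?c * real k * norm X ^ k * norm V"
      by (cases k) simp_all
    finally show ?case by (simp add: algebra_simps)
  qed simp
qed

definition dexp :: "complex^'a^'a \<Rightarrow> (complex^'a^'a) \<Rightarrow>\<^sub>L (complex^'a^'a)"
  where "dexp X = (\<Sum>k. (1 / fact k) *\<^sub>R dpow X k)"

lemma dexp_bound:
  assumes "norm (X :: complex^'a^'a) \<le> r"
  shows "norm ((1 / fact k) *\<^sub>R dpow X k) \<le> norm (mat 1 :: complex^'a^'a) * (real k * r ^ (k - 1) / fact k)"
proof -
  have r: "r \<ge> 0" using assms norm_ge_zero order_trans by blast
  have "norm (dpow X k) \<le> norm (mat 1 :: complex^'a^'a) * real k * norm X ^ (k - 1)" by (rule norm_dpow)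
  also have "\<dots> \<le> norm (mat 1 :: complex^'a^'a) * real k * r ^ (k - 1)"
    using assms by (intro mult_left_mono power_mono) auto
  finally show ?thesis by (simp add: field_simps)
qed

lemma dexp_majorant: "summable (\<lambda>k. (c :: real) * (real k * r ^ (k - 1) / fact k))"
proof (intro summable_mult)
  have "summable (\<lambda>k. real (Suc k) * r ^ (Suc k - 1) / fact (Suc k))"
  proof -
    have "real (Suc k) * r ^ (Suc k - 1) / fact (Suc k) = inverse (fact k) * r ^ k" for k
      by (simp add: divide_inverse fact_Suc del: of_nat_Suc)
    then show ?thesis using summable_exp[of r] by simp
  qed
  then show "summable (\<lambda>k. real k * r ^ (k - 1) / fact k)" by (rule summable_Suc_iff[of "\<lambda>k. real k * r ^ (k - 1) / fact k", THEN iffD1])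
qed

lemma dexp_uniform:
  "uniform_limit (ball 0 r) (\<lambda>n X. \<Sum>k<n. (1 / fact k) *\<^sub>R dpow X k) (dexp :: complex^'a^'a \<Rightarrow> _) sequentially"
proof -
  have eq: "dexp = (\<lambda>X :: complex^'a^'a. \<Sum>k. (1 / fact k) *\<^sub>R dpow X k)" by (rule ext) (rule dexp_def)
  show ?thesis unfolding eq
  proof (rule Weierstrass_m_test)
  fix k and X :: "complex^'a^'a" assume "X \<in> ball 0 r"
  then show "norm ((1 / fact k) *\<^sub>R dpow X k) \<le> norm (mat 1 :: complex^'a^'a) * (real k * r ^ (k - 1) / fact k)"
    by (intro dexp_bound) simp
  qed (rule dexp_majorant)
qed

lemma dexp_sums: "(\<lambda>k. (1 / fact k) *\<^sub>R dpow X k V) sums dexp (X :: complex^'a^'a) V"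
proof -
  have "X \<in> ball 0 (norm X + 1)" by simp
  then have "(\<lambda>n. \<Sum>k<n. (1 / fact k) *\<^sub>R dpow X k) \<longlonglongrightarrow> dexp X"
    using tendsto_uniform_limitI[OF dexp_uniform] by blast
  then have "(\<lambda>k. (1 / fact k) *\<^sub>R dpow X k) sums dexp X" unfolding sums_def .
  from bounded_linear.sums[OF blinfun.bounded_linear_left this, of V] show ?thesis
    by (simp add: blinfun.scaleR_left)
qed

text \<open>The derivatives of the partial sums converge uniformly on balls.\<close>

lemma mexp_has_derivative: "(mexp has_derivative blinfun_apply (dexp X)) (at (X :: complex^'a^'a))"
proof -
  define r where "r = norm X + 1"
  have X: "X \<in> ball 0 r" by (simp add: r_def)
  have "\<exists>g. \<forall>x\<in>ball (0 :: complex^'a^'a) r. (\<lambda>n. (1 / fact n) *\<^sub>R mpow x n) sums g x \<and> (g has_derivative blinfun_apply (dexp x)) (at x within ball 0 r)"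
  proof (rule has_derivative_series[where f' = "\<lambda>n x V. (1 / fact n) *\<^sub>R dpow x n V"])
    show "convex (ball (0 :: complex^'a^'a) r)" by (rule convex_ball)
    show "((\<lambda>X. (1 / fact n) *\<^sub>R mpow X n) has_derivative (\<lambda>V. (1 / fact n) *\<^sub>R dpow x n V)) (at x within ball 0 r)" for n and x :: "complex^'a^'a"
      by (rule has_derivative_at_withinI, rule has_derivative_scaleR_right, rule mpow_has_derivative)
    show "\<forall>\<^sub>F n in sequentially. \<forall>x\<in>ball (0 :: complex^'a^'a) r. \<forall>h. norm ((\<Sum>i<n. (1 / fact i) *\<^sub>R dpow x i h) - dexp x h) \<le> e * norm h" if e: "e > 0" for e
    proof -
      have "\<forall>\<^sub>F n in sequentially. \<forall>x\<in>ball 0 r. dist (\<Sum>k<n. (1 / fact k) *\<^sub>R dpow x k) (dexp (x :: complex^'a^'a)) < e"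
        using dexp_uniform e unfolding uniform_limit_iff by blast
      then show ?thesis
      proof (rule eventually_mono, intro ballI allI)
        fix n and x h :: "complex^'a^'a" assume "\<forall>x\<in>ball 0 r. dist (\<Sum>k<n. (1 / fact k) *\<^sub>R dpow x k) (dexp (x :: complex^'a^'a)) < e" "x \<in> ball 0 r"
        then have le: "norm ((\<Sum>k<n. (1 / fact k) *\<^sub>R dpow x k) - dexp x) \<le> e" by (simp add: dist_norm less_imp_le)
        have "(\<Sum>i<n. (1 / fact i) *\<^sub>R dpow x i h) - dexp x h = blinfun_apply ((\<Sum>k<n. (1 / fact k) *\<^sub>R dpow x k) - dexp x) h"
          by (simp add: blinfun.diff_left blinfun.sum_left blinfun.scaleR_left)
        also have "norm \<dots> \<le> norm ((\<Sum>k<n. (1 / fact k) *\<^sub>R dpow x k) - dexp x) * norm h" by (rule norm_blinfun)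
        also have "\<dots> \<le> e * norm h" using le by (rule mult_right_mono) simp
        finally show "norm ((\<Sum>i<n. (1 / fact i) *\<^sub>R dpow x i h) - dexp x h) \<le> e * norm h" .
      qed
    qed
    show "X \<in> ball 0 r" by (rule X)
    show "(\<lambda>n. (1 / fact n) *\<^sub>R mpow X n) sums mexp X" by (rule mexp_sums)
  qed
  then obtain g :: "complex^'a^'a \<Rightarrow> complex^'a^'a" where g: "\<And>x. x \<in> ball 0 r \<Longrightarrow> (\<lambda>n. (1 / fact n) *\<^sub>R mpow x n) sums g x"
    "\<And>x. x \<in> ball 0 r \<Longrightarrow> (g has_derivative blinfun_apply (dexp x)) (at x within ball 0 r)" by blast
  have eq: "g x = mexp x" if "x \<in> ball 0 r" for x using sums_unique2[OF g(1)[OF that] mexp_sums] .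
  have "(g has_derivative blinfun_apply (dexp X)) (at X)"
    using g(2)[OF X] unfolding at_within_open[OF X open_ball] .
  then show ?thesis by (rule has_derivative_transform_within_open[OF _ open_ball X eq])
qed

lemma continuous_mpow: "continuous_on UNIV (\<lambda>X :: complex^'a^'a. mpow X k)"
  by (intro continuous_at_imp_continuous_on ballI has_derivative_continuous[OF mpow_has_derivative])

lemma continuous_Blinfun_matrix:
  "continuous_on UNIV (\<lambda>Y :: complex^'a^'a. Blinfun (\<lambda>V :: complex^'a^'a. V ** Y))"
  "continuous_on UNIV (\<lambda>Y :: complex^'a^'a. Blinfun (\<lambda>V :: complex^'a^'a. Y ** V))"
proof -
  have "linear (\<lambda>Y :: complex^'a^'a. Blinfun (\<lambda>V :: complex^'a^'a. V ** Y))"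
    by (rule linearI; rule blinfun_eqI; unfold Blinfun_matrix blinfun.add_left blinfun.scaleR_left; simp add: matrix_add_ldistrib matrix_scaleR_mult)
  moreover have "linear (\<lambda>Y :: complex^'a^'a. Blinfun (\<lambda>V :: complex^'a^'a. Y ** V))"
    by (rule linearI; rule blinfun_eqI; unfold Blinfun_matrix blinfun.add_left blinfun.scaleR_left; simp add: matrix_add_right matrix_scaleR_mult)
  ultimately show "continuous_on UNIV (\<lambda>Y :: complex^'a^'a. Blinfun (\<lambda>V :: complex^'a^'a. V ** Y))"
    "continuous_on UNIV (\<lambda>Y :: complex^'a^'a. Blinfun (\<lambda>V :: complex^'a^'a. Y ** V))"
    by (simp_all add: linear_continuous_on linear_linear)
qed

lemma continuous_dpow: "continuous_on UNIV (\<lambda>X :: complex^'a^'a. dpow X k)"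
proof (induction k)
  case (Suc k)
  have "continuous_on UNIV (\<lambda>X :: complex^'a^'a. Blinfun (\<lambda>V :: complex^'a^'a. V ** mpow X k))"
    by (rule continuous_on_compose2[OF continuous_Blinfun_matrix(1) continuous_mpow]) simp
  then show ?case using Suc continuous_Blinfun_matrix(2) by (auto intro!: continuous_intros)
qed simp

lemma continuous_dexp: "continuous_on UNIV (dexp :: complex^'a^'a \<Rightarrow> _)"
proof (rule continuous_at_imp_continuous_on, rule ballI)
  fix X :: "complex^'a^'a"
  have "continuous_on (ball 0 (norm X + 1)) (dexp :: complex^'a^'a \<Rightarrow> _)"
    by (rule uniform_limit_theorem[OF _ dexp_uniform])
      (auto intro!: always_eventually continuous_intros continuous_on_subset[OF continuous_dpow])
  then show "isCont dexp X" by (simp add: continuous_on_eq_continuous_at)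
qed

lemma mat_commute: "mat c ** A = A ** mat (c :: complex)"
  by (simp add: matrix_matrix_mult_def mat_def vec_eq_iff if_distrib if_distribR mult.commute cong: if_cong)

lemma dpow_complex_linear: "dpow X k (mat \<i> ** V) = mat \<i> ** dpow X k V"
proof (induction k)
  case 0 then show ?case by (simp add: matrix_matrix_mult_def vec_eq_iff)
next
  case (Suc k)
  have "X ** (mat \<i> ** Y) = mat \<i> ** (X ** Y)" for Y
    by (metis matrix_mul_assoc mat_commute)
  then show ?case unfolding dpow_Suc_apply Suc by (simp add: matrix_add_ldistrib matrix_mul_assoc)
qed

text \<open>This makes the exponential map and its local inverse complex differentiable, hence smooth by
  \<open>cdiff_Ck\<close>.\<close>

lemma dexp_complex_linear: "dexp X (mat \<i> ** V) = mat \<i> ** dexp X V"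
proof -
  have "(\<lambda>k. mat \<i> ** ((1 / fact k) *\<^sub>R dpow X k V)) sums (mat \<i> ** dexp X V)"
    by (rule bounded_linear.sums[OF bounded_linear_matrix_right dexp_sums])
  then have "(\<lambda>k. (1 / fact k) *\<^sub>R dpow X k (mat \<i> ** V)) sums (mat \<i> ** dexp X V)"
    by (simp add: dpow_complex_linear matrix_scaleR_mult)
  then show ?thesis using dexp_sums sums_unique2 by blast
qed

subsection \<open>One-parameter groups\<close>

lemma mpow_commute: "X ** V = V ** X \<Longrightarrow> mpow X k ** V = V ** mpow X k"
proof (induction k)
  case (Suc k)
  then have "mpow X (Suc k) ** V = X ** (V ** mpow X k)" by (simp add: matrix_mul_assoc[symmetric])
  then show ?case using Suc.prems by (simp add: matrix_mul_assoc)
qed simp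

lemma mexp_commute:
  assumes "X ** V = V ** X"
  shows "mexp X ** V = V ** mexp X"
proof -
  have "(\<lambda>k. ((1 / fact k) *\<^sub>R mpow X k) ** V) sums (mexp X ** V)"
    by (rule bounded_linear.sums[OF bounded_linear_matrix_left mexp_sums])
  moreover have "(\<lambda>k. V ** ((1 / fact k) *\<^sub>R mpow X k)) sums (V ** mexp X)"
    by (rule bounded_linear.sums[OF bounded_linear_matrix_right mexp_sums])
  ultimately show ?thesis using sums_unique2 by (simp add: matrix_scaleR_mult mpow_commute[OF assms])
qed

lemma dpow_commute: "X ** V = V ** X \<Longrightarrow> dpow X (Suc k) V = real (Suc k) *\<^sub>R (V ** mpow X k)"
proof (induction k)
  case 0 then show ?case unfolding dpow_Suc_apply by (simp add: matrix_matrix_mult_def vec_eq_iff)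
next
  case (Suc k)
  have "X ** (V ** mpow X k) = V ** mpow X (Suc k)" using Suc.prems by (simp add: matrix_mul_assoc)
  then have "dpow X (Suc (Suc k)) V = 1 *\<^sub>R (V ** mpow X (Suc k)) + real (Suc k) *\<^sub>R (V ** mpow X (Suc k))"
    unfolding dpow_Suc_apply[of X "Suc k"] Suc.IH[OF Suc.prems] matrix_scaleR_mult by simp
  then show ?case unfolding scaleR_add_left[symmetric] by (simp only: of_nat_Suc)
qed

lemma dexp_commute:
  assumes "X ** V = V ** X"
  shows "dexp X V = V ** mexp X"
proof -
  have "(1 / fact (Suc k)) *\<^sub>R dpow X (Suc k) V = V ** ((1 / fact k) *\<^sub>R mpow X k)" for k
    unfolding dpow_commute[OF assms] matrix_scaleR_mult by (simp del: of_nat_Suc)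
  moreover have "(\<lambda>k. V ** ((1 / fact k) *\<^sub>R mpow X k)) sums (V ** mexp X)"
    by (rule bounded_linear.sums[OF bounded_linear_matrix_right mexp_sums])
  ultimately have "(\<lambda>k. (1 / fact (Suc k)) *\<^sub>R dpow X (Suc k) V) sums (V ** mexp X)" by simp
  then have "(\<lambda>k. (1 / fact k) *\<^sub>R dpow X k V) sums (V ** mexp X)"
    unfolding sums_Suc_iff[of "\<lambda>k. (1 / fact k) *\<^sub>R dpow X k V"] by simp
  then show ?thesis using dexp_sums sums_unique2 by blast
qed

lemma mexp_0 [simp]: "mexp 0 = mat 1"
proof -
  have "(\<lambda>k. (1 / fact k) *\<^sub>R mpow (0 :: complex^'a^'a) k) = (\<lambda>k. if k = 0 then mat 1 else 0)"
  proof
    fix k show "(1 / fact k) *\<^sub>R mpow (0 :: complex^'a^'a) k = (if k = 0 then mat 1 else 0)"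
      by (cases k) (simp_all add: matrix_matrix_mult_def vec_eq_iff)
  qed
  then have "(\<lambda>k. if k = 0 then mat 1 else 0) sums mexp (0 :: complex^'a^'a)" using mexp_sums[of "0 :: complex^'a^'a"] by simp
  moreover have "(\<lambda>k. if k = 0 then mat 1 else (0 :: complex^'a^'a)) sums (mat 1)" by (rule sums_single[of 0 "\<lambda>_. mat 1"])
  ultimately show ?thesis using sums_unique2 by blast
qed

lemma mexp_line_derivative:
  "((\<lambda>t. mexp (t *\<^sub>R X)) has_vector_derivative X ** mexp (t *\<^sub>R X)) (at t)"
proof -
  have c: "(t *\<^sub>R X) ** X = X ** (t *\<^sub>R X)" by (simp add: matrix_scaleR_mult)
  have "((\<lambda>t. t *\<^sub>R X) has_derivative (\<lambda>h. h *\<^sub>R X)) (at t)" by (auto intro!: derivative_eq_intros)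
  from diff_chain_at[OF this mexp_has_derivative]
  have "((\<lambda>t. mexp (t *\<^sub>R X)) has_derivative (\<lambda>h. dexp (t *\<^sub>R X) (h *\<^sub>R X))) (at t)" by (simp add: o_def)
  then show ?thesis unfolding has_vector_derivative_def blinfun.scaleR_right dexp_commute[OF c] .
qed

text \<open>The product of \<open>exp (- u X)\<close> and \<open>exp ((u + t) X)\<close> has derivative zero in \<open>u\<close>.\<close>

lemma mexp_add: "mexp ((s + t) *\<^sub>R X) = mexp (s *\<^sub>R X) ** mexp (t *\<^sub>R X)"
proof -
  have com: "mexp (t *\<^sub>R X) ** X = X ** mexp (t *\<^sub>R X)" for t
    by (rule mexp_commute) (simp add: matrix_scaleR_mult)
  have const: "mexp ((- u) *\<^sub>R X) ** mexp ((u + t) *\<^sub>R X) = mexp (t *\<^sub>R X)" for u t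
  proof -
    define F where "F u = mexp ((- u) *\<^sub>R X) ** mexp ((u + t) *\<^sub>R X)" for u
    have "(F has_vector_derivative 0) (at u)" for u
    proof -
      have 1: "((\<lambda>u. mexp ((- u) *\<^sub>R X)) has_vector_derivative (-1) *\<^sub>R (X ** mexp ((- u) *\<^sub>R X))) (at u)"
        using vector_diff_chain_at[of "\<lambda>u. - u" "-1" u "\<lambda>t. mexp (t *\<^sub>R X)", OF _ mexp_line_derivative]
        by (simp add: o_def has_vector_derivative_minus has_vector_derivative_id)
      have 2: "((\<lambda>u. mexp ((u + t) *\<^sub>R X)) has_vector_derivative 1 *\<^sub>R (X ** mexp ((u + t) *\<^sub>R X))) (at u)"
        using vector_diff_chain_at[of "\<lambda>u. u + t" 1 u "\<lambda>t. mexp (t *\<^sub>R X)", OF _ mexp_line_derivative]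
        by (simp add: o_def has_vector_derivative_add_const has_vector_derivative_id)
      have "(F has_vector_derivative (mexp ((- u) *\<^sub>R X) ** (1 *\<^sub>R (X ** mexp ((u + t) *\<^sub>R X)))
          + ((-1) *\<^sub>R (X ** mexp ((- u) *\<^sub>R X))) ** mexp ((u + t) *\<^sub>R X))) (at u)"
        unfolding F_def by (rule bounded_bilinear.has_vector_derivative[OF bounded_bilinear_matrix 1 2])
      also have "mexp ((- u) *\<^sub>R X) ** (1 *\<^sub>R (X ** mexp ((u + t) *\<^sub>R X))) + ((-1) *\<^sub>R (X ** mexp ((- u) *\<^sub>R X))) ** mexp ((u + t) *\<^sub>R X) = 0"
        unfolding com[of "- u", symmetric] by (simp add: matrix_mul_assoc matrix_neg_mult)
      finally show ?thesis .
    qed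
    then have "F u = F 0" for u
      using has_vector_derivative_zero_constant[of UNIV F] by (metis UNIV_I convex_UNIV)
    then show ?thesis by (simp add: F_def)
  qed
  have inv: "mexp ((- u) *\<^sub>R X) ** mexp (u *\<^sub>R X) = mat 1" for u using const[of u 0] by simp
  then have inv': "mexp (u *\<^sub>R X) ** mexp ((- u) *\<^sub>R X) = mat 1" for u by (simp add: matrix_left_right_inverse)
  have "mexp ((s + t) *\<^sub>R X) = mexp (s *\<^sub>R X) ** (mexp ((- s) *\<^sub>R X) ** mexp ((s + t) *\<^sub>R X))"
    unfolding matrix_mul_assoc inv' by simp
  then show ?thesis unfolding const .
qed

lemma mexp_minus: "mexp X ** mexp (- X) = mat 1" "mexp (- X) ** mexp X = mat 1"
  using mexp_add[of 1 "-1" X] mexp_add[of "-1" 1 X] by simp_all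

lemma mexp_of_nat: "mexp (real k *\<^sub>R X) = mpow (mexp X) k"
proof (induction k)
  case (Suc k)
  then show ?case using mexp_add[of 1 "real k" X] by simp
qed simp

text \<open>Taking adjoints and conjugation by \<^term>\<open>sig_mat\<close> are of this kind.\<close>

lemma mexp_map:
  fixes L :: "complex^'a^'a \<Rightarrow> complex^'a^'a"
  assumes L: "bounded_linear L" and pow: "\<And>k. L (mpow X k) = mpow Y k"
  shows "L (mexp X) = mexp Y"
proof -
  have "(\<lambda>k. L ((1 / fact k) *\<^sub>R mpow X k)) sums L (mexp X)" by (rule bounded_linear.sums[OF L mexp_sums])
  moreover have "L ((1 / fact k) *\<^sub>R mpow X k) = (1 / fact k) *\<^sub>R mpow Y k" for k
    using linear_scale[OF bounded_linear.linear[OF L]] pow by simp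
  ultimately show ?thesis using mexp_sums[of Y] sums_unique2 by auto
qed

section \<open>The local logarithm\<close>

lemma dexp_0: "dexp 0 = (id_blinfun :: (complex^'a^'a) \<Rightarrow>\<^sub>L (complex^'a^'a))"
proof (rule blinfun_eqI)
  fix V :: "complex^'a^'a"
  have "0 ** V = V ** 0" by (simp add: matrix_matrix_mult_def)
  then show "blinfun_apply (dexp 0) V = blinfun_apply id_blinfun V" using dexp_commute[of 0 V] by simp
qed

text \<open>The inverse function theorem at the origin, where the derivative is the identity. The derivative of
  the inverse is complex linear, as the inverse of a complex linear map.\<close>

lemma mexp_local_inverse:
  obtains U V and lg :: "complex^'a^'a \<Rightarrow> complex^'a^'a" where
    "open U" "0 \<in> U" "open V" "mat 1 \<in> V"
    "\<And>X. X \<in> U \<Longrightarrow> mexp X \<in> V \<and> lg (mexp X) = X"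
    "\<And>A. A \<in> V \<Longrightarrow> lg A \<in> U \<and> mexp (lg A) = A"
    "\<And>A. A \<in> V \<Longrightarrow> \<exists>D. (lg has_derivative D) (at A) \<and> (\<forall>H. D (mat \<i> ** H) = mat \<i> ** D H)"
    "(lg has_derivative (\<lambda>H. H)) (at (mat 1))"
proof (rule inverse_function_theorem[where f = "mexp :: complex^'a^'a \<Rightarrow> _" and f' = dexp and U = UNIV and ?x0.0 = 0 and invf = id_blinfun])
  show "open UNIV" "(0 :: complex^'a^'a) \<in> UNIV" by simp_all
  show "(mexp has_derivative blinfun_apply (dexp X)) (at X)" for X :: "complex^'a^'a" by (rule mexp_has_derivative)
  show "continuous_on UNIV (dexp :: complex^'a^'a \<Rightarrow> _)" by (rule continuous_dexp)
  show "id_blinfun o\<^sub>L dexp (0 :: complex^'a^'a) = id_blinfun" by (rule blinfun_eqI) (simp add: dexp_0)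
  fix U V :: "(complex^'a^'a) set" and g g'
  assume U: "open U" "0 \<in> U" and V: "open V" "mexp 0 \<in> V" and hom: "homeomorphism U V mexp g"
    and der: "\<And>y. y \<in> V \<Longrightarrow> (g has_derivative g' y) (at y)"
    and g': "\<And>y. y \<in> V \<Longrightarrow> g' y = inv_into UNIV (blinfun_apply (dexp (g y)))"
    and bij: "\<And>y. y \<in> V \<Longrightarrow> bij (blinfun_apply (dexp (g y)))"
  have 1: "mexp X \<in> V \<and> g (mexp X) = X" if "X \<in> U" for X
    using hom that unfolding homeomorphism_def by blast
  have 2: "g A \<in> U \<and> mexp (g A) = A" if "A \<in> V" for A
    using hom that unfolding homeomorphism_def by blast
  have 3: "\<exists>D. (g has_derivative D) (at A) \<and> (\<forall>H. D (mat \<i> ** H) = mat \<i> ** D H)" if A: "A \<in> V" for A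
  proof (intro exI conjI allI)
    show "(g has_derivative g' A) (at A)" by (rule der[OF A])
    fix H
    let ?E = "blinfun_apply (dexp (g A))"
    have E: "?E (inv_into UNIV ?E K) = K" "inv_into UNIV ?E (?E K) = K" for K
      using bij[OF A] by (simp_all add: bij_is_inj bij_is_surj surj_f_inv_f)
    have "?E (mat \<i> ** inv_into UNIV ?E H) = mat \<i> ** H" unfolding dexp_complex_linear E ..
    then have "inv_into UNIV ?E (mat \<i> ** H) = mat \<i> ** inv_into UNIV ?E H" using E(2) by metis
    then show "g' A (mat \<i> ** H) = mat \<i> ** g' A H" unfolding g'[OF A] .
  qed
  have "g (mat 1) = 0" using 1[OF U(2)] by simp
  then have "g' (mat 1) = inv_into UNIV (blinfun_apply id_blinfun)" using g'[of "mat 1"] V(2) by (simp add: dexp_0)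
  moreover have "blinfun_apply id_blinfun = (id :: complex^'a^'a \<Rightarrow> _)" by (rule ext) simp
  ultimately have "g' (mat 1) = (\<lambda>H. H)" by (simp add: id_def)
  then have 4: "(g has_derivative (\<lambda>H. H)) (at (mat 1))" using der[of "mat 1"] V(2) by simp
  have V1: "mat 1 \<in> V" using V(2) by simp
  show thesis by (rule that[OF U V(1) V1 1 2 3 4])
qed

lemma mat_i_component: "(mat c ** A) $ i $ j = c * (A :: complex^'a^'b) $ i $ j"
  by (simp add: matrix_matrix_mult_def mat_def if_distrib if_distribR cong: if_cong)

lemma bounded_linear_mat_i: "bounded_linear (\<lambda>A :: complex^'a^'a. mat \<i> ** A)"
  by (rule bounded_linear_matrix_right)

lemma complex_derivative_Ck:
  fixes F :: "complex^'a^'a \<Rightarrow> complex^'b^'c"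
  assumes W: "open W" and F: "\<And>A. A \<in> W \<Longrightarrow> \<exists>D. (F has_derivative D) (at A) \<and> (\<forall>H. D (mat \<i> ** H) = mat \<i> ** D H)"
  shows "Ck_on k W F"
proof (intro Ck_on_vec W)
  fix i j
  have "cdiff (\<lambda>A. mat \<i> ** A) W (\<lambda>x. F x $ i $ j)" unfolding cdiff_def
  proof
    fix A assume "A \<in> W"
    then obtain D where D: "(F has_derivative D) (at A)" "\<And>H. D (mat \<i> ** H) = mat \<i> ** D H" using F by blast
    have "((\<lambda>x. F x $ i $ j) has_derivative (\<lambda>H. D H $ i $ j)) (at A)"
      by (intro bounded_linear.has_derivative[OF bounded_linear_vec_nth] D(1))
    moreover have "D (mat \<i> ** H) $ i $ j = \<i> * D H $ i $ j" for H unfolding D(2) mat_i_component ..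
    ultimately show "\<exists>F'. ((\<lambda>x. F x $ i $ j) has_derivative F') (at A) \<and> (\<forall>h. F' (mat \<i> ** h) = \<i> * F' h)"
      by (intro exI[of _ "\<lambda>H. D H $ i $ j"]) simp
  qed
  then show "Ck_on k W (\<lambda>x. F x $ i $ j)" by (rule cdiff_Ck[OF W bounded_linear_mat_i])
qed

lemma smooth_onI:
  assumes "open W" "S \<subseteq> W" "\<And>k. Ck_on k W g" "\<And>x. x \<in> S \<Longrightarrow> g x = f x"
  shows "smooth_on S f"
  unfolding smooth_on_def using assms by blast

section \<open>Determinant and trace\<close>

text \<open>A permutation other than the identity moves at least two indices. Each term of the product rule for
  its summand in the Leibniz formula differentiates one factor and therefore keeps an off-diagonal
  entry of the identity matrix.\<close>

lemma det_derivative: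
  fixes a :: "real \<Rightarrow> complex^'a^'a"
  assumes a: "(a has_vector_derivative X) (at 0)" and a0: "a 0 = mat 1"
  shows "((\<lambda>t. det (a t)) has_vector_derivative trace X) (at 0)"
proof -
  let ?P = "{p. p permutes (UNIV :: 'a set)}"
  have entry: "((\<lambda>t. a t $ i $ j) has_derivative (\<lambda>h. h *\<^sub>R X $ i $ j)) (at 0)" for i j
  proof -
    have "((\<lambda>t. a t $ i $ j) has_derivative (\<lambda>h. (h *\<^sub>R X) $ i $ j)) (at 0)"
      using a unfolding has_vector_derivative_def
      by (intro bounded_linear.has_derivative[OF bounded_linear_vec_nth])
    then show ?thesis by simp
  qed
  define d where "d p h = (\<Sum>i\<in>UNIV. h *\<^sub>R X $ i $ p i * (\<Prod>j\<in>UNIV - {i}. a 0 $ j $ p j))" for p h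
  have "((\<lambda>t. \<Prod>i\<in>UNIV. a t $ i $ p i) has_derivative d p) (at 0)" for p
    unfolding d_def by (rule has_derivative_prod) (rule entry)
  then have "((\<lambda>t. \<Sum>p\<in>?P. of_int (sign p) * (\<Prod>i\<in>UNIV. a t $ i $ p i)) has_derivative (\<lambda>h. \<Sum>p\<in>?P. of_int (sign p) * d p h)) (at 0)"
    by (intro has_derivative_sum has_derivative_mult_right)
  moreover have "(\<Sum>p\<in>?P. of_int (sign p) * d p h) = h *\<^sub>R trace X" for h
  proof -
    have nz: "d p h = 0" if p: "p permutes UNIV" and "p \<noteq> id" for p
    proof -
      obtain k where k: "p k \<noteq> k" using \<open>p \<noteq> id\<close> by (auto simp: fun_eq_iff)
      have "(\<Prod>j\<in>UNIV - {i}. a 0 $ j $ p j) = 0" for i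
      proof -
        have inj: "inj p" using p by (rule permutes_inj)
        have "\<exists>j. j \<noteq> i \<and> p j \<noteq> j"
        proof (cases "k = i")
          case False then show ?thesis using k by blast
        next
          case True
          have "p (p k) \<noteq> p k" using k inj by (auto dest: injD)
          then show ?thesis using True k by blast
        qed
        then obtain j where "j \<noteq> i" "p j \<noteq> j" by blast
        then show ?thesis by (intro prod_zero) (auto simp: a0 mat_def intro!: bexI[of _ j])
      qed
      then show ?thesis unfolding d_def by (simp only: mult_zero_right sum.neutral_const)
    qed
    have "(\<Sum>p\<in>?P. of_int (sign p) * d p h) = (\<Sum>p\<in>{id}. of_int (sign p) * d p h)"
      by (rule sum.mono_neutral_right) (auto simp: nz permutes_id finite_permutations)
    also have "\<dots> = d id h" by (simp add: sign_id)
    also have "\<dots> = (\<Sum>i\<in>UNIV. h *\<^sub>R X $ i $ i)" by (simp add: d_def a0 mat_def)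
    also have "\<dots> = h *\<^sub>R trace X" by (simp add: trace_def scaleR_sum_right)
    finally show ?thesis .
  qed
  ultimately show ?thesis unfolding has_vector_derivative_def det_def by simp
qed

text \<open>The function \<open>\<phi> t = det (exp (t X))\<close> turns sums into products and has derivative \<open>trace X\<close> at zero, so
  \<open>\<phi>' = trace X * \<phi>\<close>.\<close>

lemma det_mexp: "det (mexp X) = exp (trace X)"
proof -
  define \<phi> where "\<phi> t = det (mexp (t *\<^sub>R X))" for t
  define \<tau> where "\<tau> = trace X"
  have d0: "(\<phi> has_vector_derivative \<tau>) (at 0)"
    unfolding \<phi>_def \<tau>_def using mexp_line_derivative[of X 0] by (intro det_derivative) simp_all
  have add: "\<phi> (s + t) = \<phi> s * \<phi> t" for s t unfolding \<phi>_def mexp_add det_mul ..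
  have "\<phi> 0 = 1" by (simp add: \<phi>_def)
  have d: "(\<phi> has_vector_derivative \<phi> t * \<tau>) (at t)" for t
  proof -
    have "((\<lambda>s. s - t) has_vector_derivative 1) (at t)" by (auto intro!: derivative_eq_intros)
    then have "((\<phi> \<circ> (\<lambda>s. s - t)) has_vector_derivative 1 *\<^sub>R \<tau>) (at t)"
      by (rule vector_diff_chain_at) (use d0 in simp)
    then have "((\<lambda>s. \<phi> t * (\<phi> \<circ> (\<lambda>s. s - t)) s) has_vector_derivative \<phi> t * (1 *\<^sub>R \<tau>)) (at t)"
      by (rule has_vector_derivative_mult_right)
    moreover have "\<phi> t * (\<phi> \<circ> (\<lambda>s. s - t)) s = \<phi> s" for s using add[of t "s - t"] by simp
    ultimately show ?thesis by simp
  qed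
  define \<psi> where "\<psi> t = \<phi> t * exp (- (t *\<^sub>R \<tau>))" for t :: real
  have "(\<psi> has_vector_derivative 0) (at t)" for t
  proof -
    have e: "((\<lambda>t. exp (- (t *\<^sub>R \<tau>))) has_vector_derivative (- \<tau>) * exp (- (t *\<^sub>R \<tau>))) (at t)"
      using exp_scaleR_has_vector_derivative_left[where A = "- \<tau>" and t = t] by simp
    have "(\<psi> has_vector_derivative (\<phi> t * ((- \<tau>) * exp (- (t *\<^sub>R \<tau>))) + (\<phi> t * \<tau>) * exp (- (t *\<^sub>R \<tau>)))) (at t)"
      unfolding \<psi>_def by (rule has_vector_derivative_mult[OF d e])
    then show ?thesis by simp
  qed
  then have "\<psi> 1 = \<psi> 0" using has_vector_derivative_zero_constant[of UNIV \<psi>] by (metis UNIV_I convex_UNIV)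
  then have "\<phi> 1 * exp (- \<tau>) = 1" using \<open>\<phi> 0 = 1\<close> by (simp add: \<psi>_def)
  then have "\<phi> 1 = exp \<tau>" by (simp add: exp_minus field_simps)
  then show ?thesis by (simp add: \<phi>_def \<tau>_def)
qed

section \<open>Functions of small exponential type\<close>

lemma factor_zeros_at_naturals:
  assumes "h holomorphic_on UNIV" "\<And>k. h (of_nat k) = 0"
  shows "\<exists>g. g holomorphic_on UNIV \<and> (\<forall>z. h z = (\<Prod>j<m. z - of_nat j) * g z)"
proof (induction m)
  case 0 show ?case using assms(1) by (intro exI[of _ h]) simp
next
  case (Suc m)
  then obtain g where g: "g holomorphic_on UNIV" "\<And>z. h z = (\<Prod>j<m. z - of_nat j) * g z" by blast
  let ?m = "of_nat m :: complex"
  have "(\<Prod>j<m. ?m - of_nat j) \<noteq> 0" by (simp add: of_nat_diff[symmetric] del: of_nat_diff)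
  then have g0: "g ?m = 0" using g(2)[of ?m] assms(2)[of m] by simp
  define G where "G z = (if z = ?m then deriv g ?m else (g z - g ?m) / (z - ?m))" for z
  have "G holomorphic_on UNIV" unfolding G_def by (rule pole_lemma_open[OF g(1) open_UNIV])
  moreover have "h z = (\<Prod>j<Suc m. z - of_nat j) * G z" for z
  proof -
    have "g z = (z - ?m) * G z" using g0 by (simp add: G_def)
    then have "(\<Prod>j<m. z - of_nat j) * g z = (\<Prod>j<Suc m. z - of_nat j) * G z"
      by (simp add: prod.lessThan_Suc mult.assoc)
    then show ?thesis using g(2)[of z] by (rule trans[rotated])
  qed
  ultimately show ?case by blast
qed

text \<open>Dividing \<open>h\<close> by the linear factors of its first \<open>m\<close> zeros leaves an entire function \<open>g\<close>, which the maximum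
  principle bounds by its values on the circle of radius \<open>4 m\<close>. There each factor is at least \<open>3 m\<close>,
  while it is at most \<open>2 m\<close> on the disc of radius \<open>m\<close>. So \<open>\<bar>h z\<bar> \<le> C (2 / 3) ^ m exp (4 m r)\<close> on
  this disc, which tends to zero as \<open>m\<close> grows.\<close>

lemma zero_if_small_type:
  assumes hol: "h holomorphic_on UNIV" and zero: "\<And>k. h (of_nat k) = 0"
    and bound: "\<And>z. norm (h z) \<le> C * exp (r * norm z)" and r: "r \<ge> 0" "exp (4 * r) < 3 / 2"
  shows "h z = 0"
proof -
  define q where "q = 2 / 3 * exp (4 * r)"
  have q: "0 \<le> q" "q < 1" using r by (simp_all add: q_def)
  have "norm (h 0) \<le> C" using bound[of 0] by simp
  then have C: "C \<ge> 0" using norm_ge_zero[of "h 0"] by linarith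
  have le: "norm (h z) \<le> C * q ^ m" if m: "m \<ge> 1" "norm z \<le> real m" for m
  proof -
    obtain g where "g holomorphic_on UNIV \<and> (\<forall>z. h z = (\<Prod>j<m. z - of_nat j) * g z)"
      using factor_zeros_at_naturals[OF hol zero, of m] by (rule exE)
    then have g: "g holomorphic_on UNIV" "\<And>z. h z = (\<Prod>j<m. z - of_nat j) * g z" by simp_all
    let ?\<rho> = "4 * real m"
    have "norm (g z) \<le> C * exp (r * ?\<rho>) / (3 * real m) ^ m"
    proof (rule maximum_modulus_frontier[where S = "ball 0 ?\<rho>" and f = g and \<xi> = z])
      show "g holomorphic_on interior (ball 0 ?\<rho>)" using g(1) holomorphic_on_subset by blast
      show "continuous_on (closure (ball 0 ?\<rho>)) g"
        using holomorphic_on_imp_continuous_on[OF g(1)] continuous_on_subset by blast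
      show "bounded (ball (0::complex) ?\<rho>)" by simp
      show "z \<in> ball 0 ?\<rho>" using m by simp
      fix w :: complex assume "w \<in> frontier (ball 0 ?\<rho>)"
      then have w: "norm w = ?\<rho>" using m by simp
      have "(\<Prod>j<m. 3 * real m) \<le> (\<Prod>j<m. norm (w - of_nat j))"
      proof (intro prod_mono conjI)
        fix j assume "j \<in> {..<m}"
        then show "3 * real m \<le> norm (w - of_nat j)" using norm_triangle_ineq2[of w "of_nat j"] w by simp
      qed simp
      then have p: "(3 * real m) ^ m \<le> norm (\<Prod>j<m. w - of_nat j)" by (simp add: prod_norm)
      have pos: "(3 * real m) ^ m > 0" using m by simp
      have "(3 * real m) ^ m * norm (g w) \<le> norm (\<Prod>j<m. w - of_nat j) * norm (g w)"
        using p by (rule mult_right_mono) simp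
      also have "\<dots> = norm (h w)" unfolding g(2)[of w] by (simp add: norm_mult)
      also have "\<dots> \<le> C * exp (r * ?\<rho>)" using bound[of w] w by simp
      finally show "norm (g w) \<le> C * exp (r * ?\<rho>) / (3 * real m) ^ m" using pos by (simp add: field_simps)
    qed
    moreover have "norm (\<Prod>j<m. z - of_nat j) \<le> (2 * real m) ^ m"
    proof -
      have "(\<Prod>j<m. norm (z - of_nat j)) \<le> (\<Prod>j<m. 2 * real m)"
      proof (intro prod_mono conjI)
        fix j assume "j \<in> {..<m}"
        then show "norm (z - of_nat j) \<le> 2 * real m" using norm_triangle_ineq4[of z "of_nat j"] m by simp
      qed simp
      then show ?thesis by (simp add: prod_norm)
    qed
    ultimately have "norm (h z) \<le> (2 * real m) ^ m * (C * exp (r * ?\<rho>) / (3 * real m) ^ m)"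
      unfolding g(2)[of z] norm_mult by (intro mult_mono) simp_all
    also have "\<dots> = C * q ^ m"
    proof -
      have "a * (C * b / d) = C * (a / d * b)" for a b d :: real by simp
      moreover have "exp (r * ?\<rho>) = exp (4 * r) ^ m" by (simp add: exp_of_nat_mult[symmetric] mult_ac)
      moreover have "(2 * real m) ^ m / (3 * real m) ^ m = (2 / 3) ^ m" using m by (simp add: power_divide[symmetric])
      ultimately show ?thesis unfolding q_def power_mult_distrib[of "2 / 3"] by (simp only:)
    qed
    finally show ?thesis .
  qed
  have "(\<lambda>m. C * q ^ m) \<longlonglongrightarrow> C * 0" by (intro tendsto_mult tendsto_const LIMSEQ_realpow_zero q)
  moreover have "\<forall>\<^sub>F m in sequentially. norm (h z) \<le> C * q ^ m"
    using eventually_ge_at_top[of "max 1 (nat \<lceil>norm z\<rceil>)"] by eventually_elim (intro le, auto)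
  ultimately have "norm (h z) \<le> C * 0" by (intro tendsto_lowerbound[of _ _ sequentially]) auto
  then show ?thesis by simp
qed

section \<open>Algebraic groups of matrices\<close>

lemma mpow_scaleR: "mpow (t *\<^sub>R X) k = t ^ k *\<^sub>R mpow X k"
  by (induction k) (simp_all add: matrix_scaleR_mult)

text \<open>The restriction to the real line is given by a power series, dominated by that of the exponential
  function, and this series defines \<open>h\<close>.\<close>

lemma linear_functional_along_group:
  fixes f :: "complex^'a^'a \<Rightarrow> real"
  assumes f: "bounded_linear f"
  shows "\<exists>h C. h holomorphic_on UNIV \<and> (\<forall>t. h (of_real t) = of_real (f (mexp (t *\<^sub>R Z)))) \<and>
    (\<forall>z. norm (h z) \<le> C * exp (1 * norm Z * norm z))"
proof -
  define a where "a k = f (mpow Z k) / fact k" for k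
  obtain K where K: "K > 0" "\<And>X. norm (f X) \<le> norm X * K" using bounded_linear.pos_bounded[OF f] by blast
  define c where "c = norm (mat 1 :: complex^'a^'a) * K"
  have c0: "c \<ge> 0" using K by (simp add: c_def)
  have a: "\<bar>a k\<bar> \<le> c * (inverse (fact k) * norm Z ^ k)" for k
  proof -
    have "\<bar>f (mpow Z k)\<bar> \<le> norm (mpow Z k) * K" using K(2)[of "mpow Z k"] by simp
    also have "\<dots> \<le> (norm (mat 1 :: complex^'a^'a) * norm Z ^ k) * K"
      using K(1) norm_mpow[of Z k] by (intro mult_right_mono) auto
    finally show ?thesis by (simp add: a_def c_def field_simps)
  qed
  have nle: "norm (complex_of_real (a k) * z ^ k) \<le> c * (inverse (fact k) * (norm Z * norm z) ^ k)" for k z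
  proof -
    have "norm (complex_of_real (a k) * z ^ k) \<le> c * (inverse (fact k) * norm Z ^ k) * norm z ^ k"
      unfolding norm_mult norm_power norm_of_real by (rule mult_right_mono[OF a]) simp
    then show ?thesis by (simp add: power_mult_distrib mult_ac)
  qed
  have maj: "summable (\<lambda>k. c * (inverse (fact k) * (norm Z * norm z) ^ k))" for z :: complex
    by (intro summable_mult summable_exp)
  have sumn: "summable (\<lambda>k. norm (complex_of_real (a k) * z ^ k))" for z
    by (rule summable_comparison_test'[OF maj[of z], of 0]) (use nle in simp)
  define h where "h z = (\<Sum>k. of_real (a k) * z ^ k)" for z :: complex
  have hs: "(\<lambda>k. of_real (a k) * z ^ k) sums h z" for z
    unfolding h_def by (rule summable_sums[OF summable_norm_cancel[OF sumn]])
  have "h holomorphic_on ball 0 r" for r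
    by (rule power_series_holomorphic[of _ _ "\<lambda>k. of_real (a k)"]) (use hs in simp)
  then have hol: "h holomorphic_on UNIV"
    unfolding holomorphic_on_open[OF open_UNIV] holomorphic_on_open[OF open_ball]
    by (metis dist_0_norm less_add_one mem_ball)
  have "h (of_real t) = of_real (f (mexp (t *\<^sub>R Z)))" for t
  proof -
    have "(\<lambda>k. f ((1 / fact k) *\<^sub>R mpow (t *\<^sub>R Z) k)) sums f (mexp (t *\<^sub>R Z))"
      by (rule bounded_linear.sums[OF f mexp_sums])
    moreover have "f ((1 / fact k) *\<^sub>R mpow (t *\<^sub>R Z) k) = a k * t ^ k" for k
      by (simp add: mpow_scaleR matrix_scaleR_mult linear_scale[OF bounded_linear.linear[OF f]] a_def)
    ultimately have "(\<lambda>k. complex_of_real (a k * t ^ k)) sums of_real (f (mexp (t *\<^sub>R Z)))"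
      by (simp only: sums_of_real_iff)
    then show ?thesis using hs[of "of_real t"] sums_unique2 by simp
  qed
  moreover have "norm (h z) \<le> c * exp (1 * norm Z * norm z)" for z
  proof -
    have "norm (h z) \<le> (\<Sum>k. norm (complex_of_real (a k) * z ^ k))" unfolding h_def by (rule summable_norm[OF sumn])
    also have "\<dots> \<le> (\<Sum>k. c * (inverse (fact k) * (norm Z * norm z) ^ k))" by (rule suminf_le[OF nle sumn maj])
    also have "\<dots> = c * (\<Sum>k. inverse (fact k) * (norm Z * norm z) ^ k)" by (rule suminf_mult[OF summable_exp])
    also have "(\<Sum>k. inverse (fact k) * (norm Z * norm z) ^ k) = exp (1 * norm Z * norm z)" by (simp add: exp_def scaleR_conv_of_real)
    finally show ?thesis .
  qed
  ultimately show ?thesis using hol by blast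
qed

text \<open>The constant \<open>D\<close> depends on \<open>T\<close> only, so the exponential type \<open>D \<bar>Z\<bar>\<close> is small if \<open>Z\<close> is.\<close>

lemma polynomial_along_group:
  fixes T :: "complex^'a^'a \<Rightarrow> real"
  assumes "real_polynomial_function T"
  shows "\<exists>D\<ge>0. \<forall>Z. \<exists>h C. h holomorphic_on UNIV \<and> (\<forall>t. h (of_real t) = of_real (T (mexp (t *\<^sub>R Z)))) \<and>
    (\<forall>z. norm (h z) \<le> C * exp (D * norm Z * norm z))"
  using assms
proof induction
  case (linear f)
  show ?case using linear_functional_along_group[OF linear] by (intro exI[of _ 1]) simp
next
  case (const c)
  have "\<exists>h C. h holomorphic_on UNIV \<and> (\<forall>t::real. h (of_real t) = of_real c) \<and>
    (\<forall>z. norm (h z) \<le> C * exp (0 * norm Z * norm z))" for Z :: "complex^'a^'a"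
    by (rule exI[of _ "\<lambda>_. of_real c"], rule exI[of _ "\<bar>c\<bar>"]) auto
  then show ?case by (intro exI[of _ 0]) simp
next
  case (add f g)
  then obtain D E where D: "D \<ge> 0" "\<And>Z. \<exists>h C. h holomorphic_on UNIV \<and> (\<forall>t. h (of_real t) = of_real (f (mexp (t *\<^sub>R Z)))) \<and>
    (\<forall>z. norm (h z) \<le> C * exp (D * norm Z * norm z))"
    and E: "E \<ge> 0" "\<And>Z. \<exists>h C. h holomorphic_on UNIV \<and> (\<forall>t. h (of_real t) = of_real (g (mexp (t *\<^sub>R Z)))) \<and>
    (\<forall>z. norm (h z) \<le> C * exp (E * norm Z * norm z))" by blast
  show ?case
  proof (intro exI[of _ "max D E"] conjI allI)
    fix Z :: "complex^'a^'a"
    obtain h C where h: "h holomorphic_on UNIV" "\<And>t. h (of_real t) = of_real (f (mexp (t *\<^sub>R Z)))"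
      "\<And>z. norm (h z) \<le> C * exp (D * norm Z * norm z)" using D(2)[of Z] by blast
    obtain k C' where k: "k holomorphic_on UNIV" "\<And>t. k (of_real t) = of_real (g (mexp (t *\<^sub>R Z)))"
      "\<And>z. norm (k z) \<le> C' * exp (E * norm Z * norm z)" using E(2)[of Z] by blast
    have up: "c * exp (d * norm Z * norm z) \<le> \<bar>c\<bar> * exp (max D E * norm Z * norm z)" if "d \<le> max D E" for c d and z :: complex
      using that by (intro mult_mono) (auto intro!: mult_right_mono)
    have "norm (h z + k z) \<le> (\<bar>C\<bar> + \<bar>C'\<bar>) * exp (max D E * norm Z * norm z)" for z
      using norm_triangle_ineq[of "h z" "k z"] h(3)[of z] k(3)[of z] up[of D C z] up[of E C' z]
      by (simp add: distrib_right)
    then show "\<exists>h C. h holomorphic_on UNIV \<and> (\<forall>t. h (of_real t) = of_real (f (mexp (t *\<^sub>R Z)) + g (mexp (t *\<^sub>R Z)))) \<and>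
      (\<forall>z. norm (h z) \<le> C * exp (max D E * norm Z * norm z))"
      using h(1,2) k(1,2) by (intro exI[of _ "\<lambda>z. h z + k z"] exI[of _ "\<bar>C\<bar> + \<bar>C'\<bar>"]) (auto intro!: holomorphic_intros)
  qed (use D(1) in simp)
next
  case (mult f g)
  then obtain D E where D: "D \<ge> 0" "\<And>Z. \<exists>h C. h holomorphic_on UNIV \<and> (\<forall>t. h (of_real t) = of_real (f (mexp (t *\<^sub>R Z)))) \<and>
    (\<forall>z. norm (h z) \<le> C * exp (D * norm Z * norm z))"
    and E: "E \<ge> 0" "\<And>Z. \<exists>h C. h holomorphic_on UNIV \<and> (\<forall>t. h (of_real t) = of_real (g (mexp (t *\<^sub>R Z)))) \<and>
    (\<forall>z. norm (h z) \<le> C * exp (E * norm Z * norm z))" by blast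
  show ?case
  proof (intro exI[of _ "D + E"] conjI allI)
    fix Z :: "complex^'a^'a"
    obtain h C where h: "h holomorphic_on UNIV" "\<And>t. h (of_real t) = of_real (f (mexp (t *\<^sub>R Z)))"
      "\<And>z. norm (h z) \<le> C * exp (D * norm Z * norm z)" using D(2)[of Z] by blast
    obtain k C' where k: "k holomorphic_on UNIV" "\<And>t. k (of_real t) = of_real (g (mexp (t *\<^sub>R Z)))"
      "\<And>z. norm (k z) \<le> C' * exp (E * norm Z * norm z)" using E(2)[of Z] by blast
    have "norm (h z * k z) \<le> (C * C') * exp ((D + E) * norm Z * norm z)" for z
    proof -
      have "norm (h z * k z) \<le> (C * exp (D * norm Z * norm z)) * (C' * exp (E * norm Z * norm z))"
        unfolding norm_mult using h(3)[of z] k(3)[of z] order_trans[OF norm_ge_zero h(3)[of z]] by (intro mult_mono) auto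
      also have "\<dots> = (C * C') * exp ((D + E) * norm Z * norm z)" by (simp add: exp_add[symmetric] algebra_simps)
      finally show ?thesis .
    qed
    then show "\<exists>h C. h holomorphic_on UNIV \<and> (\<forall>t. h (of_real t) = of_real (f (mexp (t *\<^sub>R Z)) * g (mexp (t *\<^sub>R Z)))) \<and>
      (\<forall>z. norm (h z) \<le> C * exp ((D + E) * norm Z * norm z))"
      using h(1,2) k(1,2) by (intro exI[of _ "\<lambda>z. h z * k z"] exI[of _ "C * C'"]) (auto intro!: holomorphic_intros)
  qed (use D(1) E(1) in simp)
qed

text \<open>The powers of \<open>exp Z\<close> satisfy the equation, so the entire function that extends
  \<open>t \<mapsto> p (exp (t Z))\<close> vanishes at the natural numbers; for small \<open>Z\<close> it is of small type.\<close>

lemma small_element_in_one_parameter_group: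
  fixes p :: "complex^'a^'a \<Rightarrow> real"
  assumes p: "real_polynomial_function p" and one: "p (mat 1) = 0"
    and mult: "\<And>A B. p A = 0 \<Longrightarrow> p B = 0 \<Longrightarrow> p (A ** B) = 0"
  shows "\<exists>\<delta>>0. \<forall>Z. norm Z < \<delta> \<longrightarrow> p (mexp Z) = 0 \<longrightarrow> (\<forall>t. p (mexp (t *\<^sub>R Z)) = 0)"
proof -
  obtain D where D: "D \<ge> 0" "\<And>Z. \<exists>h C. h holomorphic_on UNIV \<and> (\<forall>t. h (of_real t) = of_real (p (mexp (t *\<^sub>R Z)))) \<and>
    (\<forall>z. norm (h z) \<le> C * exp (D * norm Z * norm z))"
    using polynomial_along_group[OF p] by blast
  \<comment> \<open>This is the condition on the type in \<open>zero_if_small_type\<close>, with \<open>D + 1\<close> to avoid a zero denominator.\<close>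
  define \<delta> where "\<delta> = ln (3 / 2) / (4 * (D + 1))"
  have \<delta>: "\<delta> > 0" using D(1) by (simp add: \<delta>_def)
  have "p (mexp (t *\<^sub>R Z)) = 0" if Z: "norm Z < \<delta>" and Z0: "p (mexp Z) = 0" for Z t
  proof -
    obtain h C where h: "h holomorphic_on UNIV" "\<And>t. h (of_real t) = of_real (p (mexp (t *\<^sub>R Z)))"
      "\<And>z. norm (h z) \<le> C * exp (D * norm Z * norm z)" using D(2)[of Z] by blast
    have pw: "p (mpow (mexp Z) k) = 0" for k by (induction k) (simp_all add: one mult Z0)
    have hk: "h (of_nat k) = 0" for k
      using h(2)[of "real k"] pw[of k] by (simp add: mexp_of_nat)
    have "4 * (D * norm Z) \<le> 4 * (D + 1) * norm Z" by (simp add: algebra_simps)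
    also have "\<dots> < 4 * (D + 1) * \<delta>" using Z D(1) by (intro mult_strict_left_mono) auto
    also have "\<dots> = ln (3 / 2)"
    proof -
      have "4 * (D + 1) \<noteq> 0" using D(1) by simp
      then show ?thesis unfolding \<delta>_def by simp
    qed
    finally have "exp (4 * (D * norm Z)) < exp (ln (3 / 2))" by (simp only: exp_less_cancel_iff)
    then have "exp (4 * (D * norm Z)) < 3 / 2" by simp
    from zero_if_small_type[OF h(1) hk h(3) _ this, of "of_real t"]
    have "h (of_real t) = 0" using D(1) by simp
    then show ?thesis using h(2)[of t] by simp
  qed
  then show ?thesis using \<delta> by blast
qed

text \<open>The Lie product formula. With \<open>c s = log (exp (s X) exp (s Y))\<close>, the sum \<open>X + Y\<close> is the limit
  of \<open>c (1 / k) * k\<close>, because the derivative of \<open>c\<close> at zero is \<open>X + Y\<close>. For large \<open>k\<close> the matrix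
  \<open>c (1 / k)\<close> is a small logarithm of an element of \<open>G\<close>, so by \<open>\<delta>\<close> it generates a one-parameter group
  in \<open>G\<close>, and \<open>G\<close> is closed.\<close>

lemma one_parameter_sum:
  fixes X Y :: "complex^'a^'a" and lg :: "complex^'a^'a \<Rightarrow> complex^'a^'a"
  assumes lg: "open V" "mat 1 \<in> V" "\<And>A. A \<in> V \<Longrightarrow> mexp (lg A) = A" "(lg has_derivative (\<lambda>H. H)) (at (mat 1))" "lg (mat 1) = 0"
    and G: "closed G" and \<delta>: "\<delta> > 0" "\<And>Z t. norm Z < \<delta> \<Longrightarrow> mexp Z \<in> G \<Longrightarrow> mexp (t *\<^sub>R Z) \<in> G"
    and mult: "\<And>A B. A \<in> G \<Longrightarrow> B \<in> G \<Longrightarrow> A ** B \<in> G"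
    and X: "\<And>t. mexp (t *\<^sub>R X) \<in> G" and Y: "\<And>t. mexp (t *\<^sub>R Y) \<in> G"
  shows "mexp (t *\<^sub>R (X + Y)) \<in> G"
proof -
  define m where "m s = mexp (s *\<^sub>R X) ** mexp (s *\<^sub>R Y)" for s
  define c where "c s = lg (m s)" for s
  define s where "s k = inverse (real (Suc k))" for k
  have m0: "m 0 = mat 1" by (simp add: m_def)
  have "(m has_vector_derivative (mexp (0 *\<^sub>R X) ** (Y ** mexp (0 *\<^sub>R Y)) + (X ** mexp (0 *\<^sub>R X)) ** mexp (0 *\<^sub>R Y))) (at 0)"
    unfolding m_def by (rule bounded_bilinear.has_vector_derivative[OF bounded_bilinear_matrix mexp_line_derivative mexp_line_derivative])
  then have dm: "(m has_derivative (\<lambda>h. h *\<^sub>R (X + Y))) (at 0)" by (simp add: has_vector_derivative_def add.commute)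
  have "(lg has_derivative (\<lambda>H. H)) (at (m 0))" using lg(4) by (simp add: m0)
  from diff_chain_at[OF dm this] have dc: "(c has_derivative (\<lambda>h. h *\<^sub>R (X + Y))) (at 0)"
    unfolding c_def by (simp add: o_def)
  have s0: "s \<longlonglongrightarrow> 0" unfolding s_def by (rule LIMSEQ_inverse_real_of_nat)
  have spos: "s k > 0" for k by (simp add: s_def)
  have mcont: "(\<lambda>k. m (s k)) \<longlonglongrightarrow> mat 1"
    using isCont_tendsto_compose[OF has_derivative_continuous[OF dm] s0] by (simp add: m0)
  have ccont: "(\<lambda>k. c (s k)) \<longlonglongrightarrow> 0"
    using isCont_tendsto_compose[OF has_derivative_continuous[OF dc] s0] by (simp add: c_def m0 lg(5))
  have ev1: "\<forall>\<^sub>F k in sequentially. m (s k) \<in> V" using topological_tendstoD[OF mcont lg(1,2)] .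
  have ev2: "\<forall>\<^sub>F k in sequentially. norm (c (s k)) < \<delta>"
    using tendstoD[OF ccont \<delta>(1)] by (simp add: dist_norm)
  have lim: "(\<lambda>k. real (Suc k) *\<^sub>R c (s k)) \<longlonglongrightarrow> X + Y"
  proof (rule Lim_null[THEN iffD2], rule tendsto_norm_zero_cancel)
    have "((\<lambda>h. norm (c (0 + h) - c 0 - h *\<^sub>R (X + Y)) / norm h) \<longlongrightarrow> 0) (at 0)"
      using dc unfolding has_derivative_at by blast
    moreover have "filterlim s (at 0) sequentially" using s0 spos by (simp add: filterlim_at less_imp_neq[symmetric])
    ultimately have "(\<lambda>k. norm (c (0 + s k) - c 0 - s k *\<^sub>R (X + Y)) / norm (s k)) \<longlonglongrightarrow> 0"
      by (rule filterlim_compose)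
    moreover have "norm (c (0 + s k) - c 0 - s k *\<^sub>R (X + Y)) / norm (s k) = norm (real (Suc k) *\<^sub>R c (s k) - (X + Y))" for k
    proof -
      have c0: "c 0 = 0" by (simp add: c_def m0 lg(5))
      have "real (Suc k) *\<^sub>R c (s k) - (X + Y) = real (Suc k) *\<^sub>R (c (s k) - s k *\<^sub>R (X + Y))"
        by (simp add: scaleR_diff_right s_def del: of_nat_Suc)
      then have "norm (real (Suc k) *\<^sub>R c (s k) - (X + Y)) = real (Suc k) * norm (c (s k) - s k *\<^sub>R (X + Y))" by simp
      moreover have "norm (s k) = inverse (real (Suc k))" using spos[of k] by (simp add: s_def)
      ultimately show ?thesis by (simp add: c0 divide_inverse mult.commute)
    qed
    ultimately show "(\<lambda>k. norm (real (Suc k) *\<^sub>R c (s k) - (X + Y))) \<longlonglongrightarrow> 0" by simp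
  qed
  have lim': "(\<lambda>k. mexp (t *\<^sub>R (real (Suc k) *\<^sub>R c (s k)))) \<longlonglongrightarrow> mexp (t *\<^sub>R (X + Y))"
    by (rule isCont_tendsto_compose[OF has_derivative_continuous[OF mexp_has_derivative]])
      (intro tendsto_scaleR tendsto_const lim)
  have ev3: "\<forall>\<^sub>F k in sequentially. mexp (t *\<^sub>R (real (Suc k) *\<^sub>R c (s k))) \<in> G"
    using ev1 ev2
  proof eventually_elim
    case (elim k)
    have "mexp (c (s k)) = m (s k)" unfolding c_def by (rule lg(3)[OF elim(1)])
    moreover have "m (s k) \<in> G" unfolding m_def by (rule mult[OF X Y])
    ultimately have "mexp (c (s k)) \<in> G" by simp
    from \<delta>(2)[OF elim(2) this, of "t * real (Suc k)"] show ?case by simp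
  qed
  show ?thesis by (rule Lim_in_closed_set[OF G ev3 _ lim']) simp
qed

section \<open>The special unitary group near the identity\<close>

lemma adjoint_mult: "adjoint_mat (A ** B) = adjoint_mat B ** adjoint_mat A"
  by (simp add: adjoint_mat_def matrix_matrix_mult_def vec_eq_iff mult.commute)

lemma adjoint_mat1: "adjoint_mat (mat 1) = mat 1"
  by (simp add: adjoint_mat_def mat_def vec_eq_iff)

lemma bounded_linear_adjoint: "bounded_linear (adjoint_mat :: 'n::finite hmat \<Rightarrow> 'n hmat)"
  by (rule linear_conv_bounded_linear[THEN iffD1], rule linearI) (simp_all add: adjoint_mat_def vec_eq_iff)

lemma mexp_adjoint: "adjoint_mat (mexp X) = mexp (adjoint_mat X)"
proof (rule mexp_map[OF bounded_linear_adjoint])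
  show "adjoint_mat (mpow X k) = mpow (adjoint_mat X) k" for k
  proof (induction k)
    case (Suc k)
    have "adjoint_mat (mpow X (Suc k)) = mpow (adjoint_mat X) k ** adjoint_mat X" by (simp add: adjoint_mult Suc)
    also have "\<dots> = adjoint_mat X ** mpow (adjoint_mat X) k" by (rule mpow_commute) simp
    finally show ?case by simp
  qed (simp add: adjoint_mat1)
qed

lemma mexp_sig: "sig_mat ** mexp X ** sig_mat = mexp (sig_mat ** X ** sig_mat)"
proof (rule mexp_map)
  show "bounded_linear (\<lambda>X :: 'a hmat. sig_mat ** X ** sig_mat)"
    by (intro bounded_linear_compose[OF bounded_linear_matrix_left bounded_linear_matrix_right])
  show "sig_mat ** mpow X k ** sig_mat = mpow (sig_mat ** X ** sig_mat) k" for k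
  proof (induction k)
    case (Suc k)
    have "sig_mat ** mpow X (Suc k) ** sig_mat = (sig_mat ** X ** sig_mat) ** (sig_mat ** mpow X k ** sig_mat)"
      by (metis matrix_mul_assoc matrix_mul_rid mpow.simps(2) sig_sig)
    then show ?case by (simp add: Suc)
  qed (simp add: sig_sig)
qed

text \<open>In this form the condition on the adjoint can be exponentiated.\<close>

lemma su_n1_iff: "X \<in> su_n1 \<longleftrightarrow> trace X = 0 \<and> adjoint_mat X = sig_mat ** (- X) ** sig_mat"
proof -
  have "adjoint_mat X ** sig_mat + sig_mat ** X = 0 \<longleftrightarrow> adjoint_mat X = sig_mat ** (- X) ** sig_mat"
  proof
    assume "adjoint_mat X ** sig_mat + sig_mat ** X = 0"
    then have "adjoint_mat X ** sig_mat = sig_mat ** (- X)" by (simp add: matrix_neg_mult eq_neg_iff_add_eq_0)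
    then have "adjoint_mat X ** sig_mat ** sig_mat = sig_mat ** (- X) ** sig_mat" by simp
    then show "adjoint_mat X = sig_mat ** (- X) ** sig_mat" by (simp add: matrix_mul_assoc[symmetric] sig_sig)
  next
    assume "adjoint_mat X = sig_mat ** (- X) ** sig_mat"
    then have "adjoint_mat X ** sig_mat = sig_mat ** (- X)" by (simp add: matrix_mul_assoc[symmetric] sig_sig)
    then show "adjoint_mat X ** sig_mat + sig_mat ** X = 0" by (simp add: matrix_neg_mult)
  qed
  then show ?thesis by (auto simp: su_n1_def)
qed

lemma mexp_su: "X \<in> su_n1 \<Longrightarrow> mexp X \<in> SU_n1"
proof -
  assume "X \<in> su_n1"
  then have X: "trace X = 0" "adjoint_mat X = sig_mat ** (- X) ** sig_mat" by (simp_all add: su_n1_iff)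
  have "adjoint_mat (mexp X) ** sig_mat ** mexp X = sig_mat ** mexp (- X) ** (sig_mat ** sig_mat) ** mexp X"
    unfolding mexp_adjoint X(2) mexp_sig[symmetric] by (simp add: matrix_mul_assoc)
  also have "\<dots> = sig_mat ** (mexp (- X) ** mexp X)" unfolding sig_sig by (simp add: matrix_mul_assoc)
  also have "\<dots> = sig_mat" by (simp add: mexp_minus)
  finally show ?thesis by (simp add: SU_n1_def det_mexp X(1))
qed

lemma norm_adjoint: "norm (adjoint_mat X) = norm X"
proof -
  have "(norm (adjoint_mat X))\<^sup>2 = (norm X)\<^sup>2"
    unfolding norm_matrix_power2 by (subst sum.swap) (simp add: adjoint_mat_def)
  then show ?thesis by (simp add: power2_eq_iff_nonneg)
qed

lemma norm_sig: "norm (sig_mat ** X ** sig_mat) = norm X"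
proof -
  have "norm ((sig_mat ** X ** sig_mat) $ i $ j) = norm (X $ i $ j)" for i j
    unfolding sig_entry by (simp add: norm_mult sg_def)
  then have "(norm (sig_mat ** X ** sig_mat))\<^sup>2 = (norm X)\<^sup>2" unfolding norm_matrix_power2 by simp
  then show ?thesis by (simp add: power2_eq_iff_nonneg)
qed

lemma norm_trace: "norm (trace X) \<le> real CARD('a) * norm (X :: complex^'a^'a)"
proof -
  have "norm (X $ i $ i) \<le> norm X" for i
    using Finite_Cartesian_Product.norm_nth_le order_trans by metis
  then have "norm (trace X) \<le> (\<Sum>i\<in>(UNIV :: 'a set). norm X)" unfolding trace_def by (intro sum_norm_le) simp
  then show ?thesis by simp
qed

text \<open>The defining equation of the group says that the small matrices \<open>X\<^sup>*\<close> and \<open>- \<sigma> X \<sigma>\<close>, where \<open>\<sigma>\<close>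
  is \<^term>\<open>sig_mat\<close>, have the same exponential, so they agree. The trace is a multiple of \<open>2 \<pi> \<i>\<close>, and it
  is small.\<close>

lemma mexp_SU_small:
  fixes X :: "'n::finite hmat"
  assumes inj: "inj_on mexp (ball (0 :: 'n hmat) \<epsilon>)" and X: "norm X < \<epsilon>" and small: "real CARD('n option) * norm X < 1"
    and SU: "mexp X \<in> SU_n1"
  shows "X \<in> su_n1"
proof -
  have det: "exp (trace X) = 1" and A: "adjoint_mat (mexp X) ** sig_mat ** mexp X = sig_mat"
    using SU by (simp_all add: SU_n1_def det_mexp)
  have n: "norm (trace X) < 1" using norm_trace[of X] small by linarith
  have tr: "trace X = 0"
  proof -
    obtain k :: int where k: "Re (trace X) = 0" "Im (trace X) = of_int (2 * k) * pi"
      using det unfolding exp_eq_1 by blast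
    have "\<bar>of_int (2 * k) * pi\<bar> < 1" using abs_Im_le_cmod[of "trace X"] n k(2) by linarith
    moreover have "\<bar>of_int (2 * k) * pi\<bar> \<ge> 1" if "k \<noteq> 0"
    proof -
      have "1 \<le> \<bar>real_of_int (2 * k)\<bar>" using that by linarith
      moreover have "1 \<le> pi" using pi_gt3 by linarith
      ultimately have "1 * 1 \<le> \<bar>real_of_int (2 * k)\<bar> * pi" by (intro mult_mono) auto
      then show ?thesis by (simp add: abs_mult)
    qed
    ultimately have "k = 0" by linarith
    then show ?thesis using k by (simp add: complex_eq_iff)
  qed
  have "adjoint_mat (mexp X) = adjoint_mat (mexp X) ** sig_mat ** (mexp X ** mexp (- X)) ** sig_mat"
    unfolding mexp_minus by (simp add: matrix_mul_assoc[symmetric] sig_sig)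
  also have "\<dots> = (adjoint_mat (mexp X) ** sig_mat ** mexp X) ** mexp (- X) ** sig_mat" by (simp add: matrix_mul_assoc)
  also have "\<dots> = sig_mat ** mexp (- X) ** sig_mat" unfolding A ..
  finally have "mexp (adjoint_mat X) = mexp (sig_mat ** (- X) ** sig_mat)" unfolding mexp_adjoint mexp_sig .
  moreover have "adjoint_mat X \<in> ball 0 \<epsilon>" "sig_mat ** (- X) ** sig_mat \<in> ball 0 \<epsilon>"
    using X by (simp_all add: norm_adjoint norm_sig)
  ultimately have "adjoint_mat X = sig_mat ** (- X) ** sig_mat" using inj by (meson inj_onD)
  then show ?thesis using tr by (simp add: su_n1_iff)
qed

subsection \<open>The kernel of the action\<close>

text \<open>Every vector \<^term>\<open>homog z\<close> is an eigenvector of \<open>C\<close>. The points \<open>0\<close> and \<open>\<plusminus> 1 / 2\<close> on the coordinate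
  axes suffice to determine the entries.\<close>

lemma ball_action_identity_scalar:
  fixes C :: "'n::finite hmat"
  assumes C: "herm_isometry sg C" and id: "\<And>z. z \<in> \<bbbB> \<Longrightarrow> ball_action C z = z"
  shows "\<exists>c. C = mat c"
proof -
  define c where "c z = (C *v homog z) $ None" for z
  have ev: "(C *v homog z) $ i = c z * homog z $ i" if z: "z \<in> \<bbbB>" for z i
    using homog_ball_action[OF C z] unfolding id[OF z] c_def[symmetric] by (metis vector_smult_component)
  have zero: "(0 :: complex^'n) \<in> \<bbbB>" by simp
  have col0: "C $ i $ None = c 0 * (if i = None then 1 else 0)" for i
    using ev[OF zero, of i] unfolding homog_affine by (cases i) (simp_all add: homog_def)
  have pt: "axis k t \<in> \<bbbB>" if "norm t < 1" for k :: 'n and t :: complex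
  proof -
    have "(\<Sum>j\<in>UNIV. (norm ((axis k t :: complex^'n) $ j))\<^sup>2) = (\<Sum>j\<in>UNIV. if j = k then (norm t)\<^sup>2 else 0)"
      by (rule sum.cong) (auto simp: axis_def)
    then have "(norm (axis k t :: complex^'n))\<^sup>2 = (norm t)\<^sup>2"
      unfolding norm_vec_def L2_set_def by (simp add: sum_nonneg)
    then have "norm (axis k t :: complex^'n) = norm t" by (simp add: power2_eq_iff_nonneg)
    then show ?thesis using that by simp
  qed
  have ax: "C $ i $ None + C $ i $ Some k * t = c (axis k t) * homog (axis k t) $ i" if "norm t < 1" for i k t
  proof -
    have "(\<Sum>j\<in>UNIV. C $ i $ Some j * axis k t $ j) = (\<Sum>j\<in>UNIV. if j = k then C $ i $ Some k * t else 0)"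
      by (rule sum.cong) (auto simp: axis_def)
    then show ?thesis using ev[OF pt[OF that], of k i] unfolding homog_affine by simp
  qed
  have hs: "homog (axis k t) $ Some l = (if l = k then t else 0)" "homog (axis k t) $ None = 1" for k l t
    by (simp_all add: homog_def axis_def)
  define t where "t = (1 / 2 :: complex)"
  have t: "norm t < 1" "norm (- t) < 1" "t \<noteq> 0" by (simp_all add: t_def)
  have diag: "C $ Some l $ Some k = (if l = k then c (axis k t) else 0)" for k l
    using ax[OF t(1), of "Some l" k] col0[of "Some l"] t(3) unfolding hs by (simp split: if_splits)
  have diag': "C $ Some k $ Some k = c (axis k (- t))" for k
    using ax[OF t(2), of "Some k" k] col0[of "Some k"] t(3) unfolding hs by simp
  have cc: "c (axis k (- t)) = c (axis k t)" for k using diag[of k k] diag'[of k] by simp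
  have "C $ None $ Some k * t = 0 \<and> c (axis k t) = c 0" for k
  proof -
    have "a + b = d \<Longrightarrow> a - b = d \<Longrightarrow> b = 0 \<and> d = a" for a b d :: complex
      by (simp add: complex_eq_iff)
    moreover have "c 0 + C $ None $ Some k * t = c (axis k t)" "c 0 - C $ None $ Some k * t = c (axis k t)"
      using ax[OF t(1), of None k] ax[OF t(2), of None k] cc[of k] col0[of None] unfolding hs by simp_all
    ultimately show ?thesis by blast
  qed
  then have row0: "C $ None $ Some k = 0" and cax: "c (axis k t) = c 0" for k using t(3) by auto
  have "C $ i $ j = (mat (c 0) :: 'n hmat) $ i $ j" for i j
  proof (cases j)
    case None then show ?thesis using col0[of i] by (simp add: mat_def)
  next
    case (Some k)
    then show ?thesis using row0[of k] diag[of _ k] cax[of k] by (cases i) (auto simp: mat_def)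
  qed
  then show ?thesis by (intro exI[of _ "c 0"]) (simp add: vec_eq_iff)
qed

section \<open>Group structure\<close>

lemma SU_n1_mult: "A \<in> SU_n1 \<Longrightarrow> B \<in> SU_n1 \<Longrightarrow> A ** B \<in> SU_n1"
  by (simp add: SU_n1_iff det_mul herm_isometry_mult)

lemma SU_n1_one: "mat 1 \<in> SU_n1"
  by (simp add: SU_n1_iff)

lemma SU_n1_inverse:
  assumes A: "A \<in> SU_n1"
  obtains B where "B \<in> SU_n1" "A ** B = mat 1" "B ** A = mat 1"
proof -
  have iA: "herm_isometry sg A" "det A = 1" using A by (simp_all add: SU_n1_iff)
  obtain B where B: "herm_isometry sg B \<and> A ** B = mat 1 \<and> B ** A = mat 1"
    using herm_isometry_inverse[OF iA(1)] by auto
  have "det A * det B = 1" using B by (metis det_I det_mul)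
  then have "B \<in> SU_n1" using B iA by (simp add: SU_n1_iff)
  then show thesis using that B by blast
qed

lemma ball_action_SU_aut: "A \<in> SU_n1 \<Longrightarrow> ball_action A \<in> ball_aut"
  by (simp add: SU_n1_iff ball_action_aut)

lemma ball_action_SU_mult:
  assumes "A \<in> SU_n1" "B \<in> SU_n1"
  shows "ball_action (A ** B) = ball_action A \<otimes>\<^bsub>Ball_Aut\<^esub> ball_action B"
proof -
  have "ball_action (A ** B) = compose \<bbbB> (ball_action A) (ball_action B)"
  proof (rule extensionalityI[where A = \<bbbB>])
    show "ball_action (A ** B) \<in> extensional \<bbbB>" by (simp add: ball_action_def)
    show "compose \<bbbB> (ball_action A) (ball_action B) \<in> extensional \<bbbB>" by simp
    fix z :: "complex^'a" assume z: "z \<in> \<bbbB>"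
    show "ball_action (A ** B) z = compose \<bbbB> (ball_action A) (ball_action B) z"
      unfolding compose_eq[OF z] using assms by (intro ball_action_mult z) (simp_all add: SU_n1_iff)
  qed
  then show ?thesis using assms by (simp add: mult_Ball_Aut ball_action_SU_aut)
qed

lemma ball_action_SU_one: "ball_action (mat 1) = \<one>\<^bsub>Ball_Aut\<^esub>"
proof (rule extensionalityI[where A = \<bbbB>])
  show "ball_action (mat 1) \<in> extensional \<bbbB>" by (simp add: ball_action_def)
  show "\<one>\<^bsub>Ball_Aut\<^esub> \<in> extensional (\<bbbB> :: (complex^'a) set)" by (simp add: Ball_Aut_def BijGroup_def)
  fix z :: "complex^'a" assume z: "z \<in> \<bbbB>"
  show "ball_action (mat 1) z = \<one>\<^bsub>Ball_Aut\<^esub> z"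
    using ball_action_mat1[OF z] z by (simp add: Ball_Aut_def BijGroup_def)
qed

lemma one_Ball_Aut: "z \<in> \<bbbB> \<Longrightarrow> \<one>\<^bsub>Ball_Aut\<^esub> z = z"
  by (simp add: Ball_Aut_def BijGroup_def)

lemma hermitian_invariant_subgroup:
  fixes f :: "complex^'n \<Rightarrow> complex^'m"
  assumes fB: "\<And>z. z \<in> \<bbbB> \<Longrightarrow> f z \<in> \<bbbB>"
  shows "subgroup (hermitian_invariant_group f) Ball_Aut"
proof -
  let ?H = "hermitian_invariant_group f"
  interpret N: group "Ball_Aut :: (complex^'n \<Rightarrow> complex^'n) monoid" by (rule group_Ball_Aut)
  interpret M: group "Ball_Aut :: (complex^'m \<Rightarrow> complex^'m) monoid" by (rule group_Ball_Aut)
  have mem: "\<gamma> \<in> ?H \<longleftrightarrow> \<gamma> \<in> ball_aut \<and> (\<exists>\<psi>\<in>ball_aut. \<forall>z\<in>\<bbbB>. f (\<gamma> z) = \<psi> (f z))" for \<gamma>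
    by (simp add: hermitian_invariant_group_def)
  show ?thesis
  proof (rule N.subgroupI)
    show "?H \<subseteq> carrier Ball_Aut" by (auto simp: mem)
    have "f (\<one>\<^bsub>Ball_Aut\<^esub> z) = \<one>\<^bsub>Ball_Aut\<^esub> (f z)" if "z \<in> \<bbbB>" for z
      unfolding one_Ball_Aut[OF that] one_Ball_Aut[OF fB[OF that]] ..
    moreover have "\<one>\<^bsub>Ball_Aut\<^esub> \<in> (ball_aut :: (complex^'n \<Rightarrow> complex^'n) set)"
      "\<one>\<^bsub>Ball_Aut\<^esub> \<in> (ball_aut :: (complex^'m \<Rightarrow> complex^'m) set)"
      using N.one_closed M.one_closed by simp_all
    ultimately have "\<one>\<^bsub>Ball_Aut\<^esub> \<in> ?H" unfolding mem by blast
    then show "?H \<noteq> {}" by blast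
  next
    fix \<gamma> assume "\<gamma> \<in> ?H"
    then obtain \<psi> where g: "\<gamma> \<in> ball_aut" and \<psi>: "\<psi> \<in> ball_aut" and eq: "\<And>z. z \<in> \<bbbB> \<Longrightarrow> f (\<gamma> z) = \<psi> (f z)"
      unfolding mem by blast
    let ?g = "inv\<^bsub>Ball_Aut\<^esub> \<gamma>" and ?\<psi> = "inv\<^bsub>Ball_Aut\<^esub> \<psi>"
    have ic: "?g \<in> ball_aut" "?\<psi> \<in> ball_aut"
      using N.inv_closed[of \<gamma>] M.inv_closed[of \<psi>] g \<psi> by simp_all
    have r: "compose \<bbbB> \<gamma> ?g = \<one>\<^bsub>Ball_Aut\<^esub>" using N.r_inv[of \<gamma>] g ic by (simp add: mult_Ball_Aut)
    have l: "compose \<bbbB> ?\<psi> \<psi> = \<one>\<^bsub>Ball_Aut\<^esub>" using M.l_inv[of \<psi>] \<psi> ic by (simp add: mult_Ball_Aut)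
    have "f (?g z) = ?\<psi> (f z)" if z: "z \<in> \<bbbB>" for z
    proof -
      have gz: "?g z \<in> \<bbbB>" by (rule ball_aut_mem[OF ic(1) z])
      have "\<gamma> (?g z) = z" using fun_cong[OF r, of z] unfolding compose_eq[OF z] one_Ball_Aut[OF z] .
      then have "f z = \<psi> (f (?g z))" using eq[OF gz] by simp
      moreover have "?\<psi> (\<psi> (f (?g z))) = f (?g z)"
        using fun_cong[OF l, of "f (?g z)"] unfolding compose_eq[OF fB[OF gz]] one_Ball_Aut[OF fB[OF gz]] .
      ultimately show ?thesis by simp
    qed
    then show "?g \<in> ?H" unfolding mem using ic by blast
  next
    fix \<gamma> \<delta> assume "\<gamma> \<in> ?H" "\<delta> \<in> ?H"
    then obtain \<psi> \<theta> where g: "\<gamma> \<in> ball_aut" "\<delta> \<in> ball_aut" and p: "\<psi> \<in> ball_aut" "\<theta> \<in> ball_aut"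
      and eq: "\<And>z. z \<in> \<bbbB> \<Longrightarrow> f (\<gamma> z) = \<psi> (f z)" "\<And>z. z \<in> \<bbbB> \<Longrightarrow> f (\<delta> z) = \<theta> (f z)"
      unfolding mem by blast
    have "f ((\<gamma> \<otimes>\<^bsub>Ball_Aut\<^esub> \<delta>) z) = (\<psi> \<otimes>\<^bsub>Ball_Aut\<^esub> \<theta>) (f z)" if z: "z \<in> \<bbbB>" for z
      unfolding mult_Ball_Aut[OF g] mult_Ball_Aut[OF p] compose_eq[OF z] compose_eq[OF fB[OF z]]
      using eq(1)[OF ball_aut_mem[OF g(2) z]] eq(2)[OF z] by simp
    moreover have "\<gamma> \<otimes>\<^bsub>Ball_Aut\<^esub> \<delta> \<in> ball_aut" "\<psi> \<otimes>\<^bsub>Ball_Aut\<^esub> \<theta> \<in> ball_aut"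
      using N.m_closed[of \<gamma> \<delta>] M.m_closed[of \<psi> \<theta>] g p by simp_all
    ultimately show "\<gamma> \<otimes>\<^bsub>Ball_Aut\<^esub> \<delta> \<in> ?H" unfolding mem by blast
  qed
qed

lemma mat_mult_mat: "mat a ** mat b = (mat (a * b) :: complex^'a^'a)"
  by (simp add: vec_eq_iff mat_i_component) (simp add: mat_def)

lemma unit_scalar_SU:
  assumes "\<zeta> ^ CARD('n::finite option) = 1" "A \<in> SU_n1"
  shows "mat \<zeta> ** A \<in> (SU_n1 :: 'n hmat set)" and "ball_action (mat \<zeta> ** A) = ball_action (A :: 'n hmat)"
proof -
  have "norm \<zeta> ^ CARD('n option) = 1 ^ CARD('n option)" using assms(1) by (metis norm_one norm_power power_one)
  then have n: "norm \<zeta> = 1" by (rule power_eq_imp_eq_base) simp_all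
  have "herm_isometry sg (mat \<zeta> ** A)"
    using assms(2) unfolding SU_n1_iff by (intro herm_isometry_unit_scalar n) simp
  moreover have "det (mat \<zeta> ** A) = 1" using assms by (simp only: det_mul det_mat SU_n1_iff) simp
  ultimately show "mat \<zeta> ** A \<in> SU_n1" by (simp add: SU_n1_iff)
  show "ball_action (mat \<zeta> ** A) = ball_action A" by (rule ball_action_scale) (use n in auto)
qed

text \<open>The fibres of the action are the cosets of the scalar matrices in \<^const>\<open>SU_n1\<close>.\<close>

lemma ball_action_SU_eq:
  fixes A B :: "'n::finite hmat"
  assumes A: "A \<in> SU_n1" and B: "B \<in> SU_n1" and eq: "ball_action A = ball_action B"
  shows "\<exists>\<zeta>. \<zeta> ^ CARD('n option) = 1 \<and> A = mat \<zeta> ** B"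
proof -
  obtain B' where B': "B' \<in> SU_n1" "B ** B' = mat 1" "B' ** B = mat 1" using SU_n1_inverse[OF B] .
  have iB': "herm_isometry sg B'" and iA: "herm_isometry sg A" and iB: "herm_isometry sg B"
    using A B B'(1) by (simp_all add: SU_n1_iff)
  have C: "B' ** A \<in> SU_n1" by (rule SU_n1_mult[OF B'(1) A])
  have "ball_action (B' ** A) z = z" if z: "z \<in> \<bbbB>" for z
  proof -
    have "ball_action (B' ** A) z = ball_action B' (ball_action B z)" unfolding eq[symmetric] by (rule ball_action_mult[OF iB' iA z])
    also have "\<dots> = ball_action (B' ** B) z" by (rule ball_action_mult[symmetric, OF iB' iB z])
    also have "\<dots> = z" unfolding B'(3) by (rule ball_action_mat1[OF z])
    finally show ?thesis .
  qed
  then obtain \<zeta> where \<zeta>: "B' ** A = mat \<zeta>"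
    using ball_action_identity_scalar[of "B' ** A"] C unfolding SU_n1_iff by blast
  have "\<zeta> ^ CARD('n option) = 1" using C unfolding \<zeta> SU_n1_iff det_mat by blast
  moreover have "A = mat \<zeta> ** B"
  proof -
    have "A = B ** (B' ** A)" by (simp add: matrix_mul_assoc B'(2))
    then show ?thesis unfolding \<zeta> by (simp add: mat_commute)
  qed
  ultimately show ?thesis by blast
qed

section \<open>Exponential charts\<close>

lemma root_of_unity_near_one:
  assumes "n > 0"
  shows "\<exists>d>0. \<forall>\<zeta>::complex. \<zeta> ^ n = 1 \<longrightarrow> norm (\<zeta> - 1) < d \<longrightarrow> \<zeta> = 1"
proof -
  have fin: "finite {\<zeta>::complex. \<zeta> ^ n = 1}" using assms by (intro finite_roots_unity) simp
  then obtain d where "d > 0" "\<forall>\<zeta>\<in>{\<zeta>::complex. \<zeta> ^ n = 1}. \<zeta> \<noteq> 1 \<longrightarrow> d \<le> dist 1 \<zeta>"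
    using finite_set_avoid by blast
  then show ?thesis by (intro exI[of _ d]) (force simp: dist_norm norm_minus_commute)
qed

lemma subspace_su_n1: "subspace (su_n1 :: 'n::finite hmat set)"
proof -
  have lin: "bounded_linear (\<lambda>X :: 'n hmat. adjoint_mat X ** sig_mat + sig_mat ** X)"
    by (intro bounded_linear_add bounded_linear_matrix_right bounded_linear_compose[OF bounded_linear_matrix_left bounded_linear_adjoint])
  have tr: "linear (trace :: 'n hmat \<Rightarrow> complex)"
    by (rule linearI) (simp_all add: trace_def sum.distrib scaleR_sum_right)
  have eq: "su_n1 = {X :: 'n hmat. trace X = 0} \<inter> {X. adjoint_mat X ** sig_mat + sig_mat ** X = 0}"
    by (auto simp: su_n1_def)
  show ?thesis unfolding eq
    by (intro subspace_inter linear_subspace_kernel[OF tr] linear_subspace_kernel[OF bounded_linear.linear[OF lin]])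
qed

text \<open>One radius \<open>\<epsilon>\<close> serves all purposes. The space \<open>L\<close> consists of the generators of one-parameter groups
  in the zero set of \<open>p\<close>, the Lie algebra of this group. By the last property the ball is so small that
  exponentials of its elements never differ by a nontrivial scalar from the kernel of the action.\<close>

lemma exponential_coordinates:
  fixes p :: "'n::finite hmat \<Rightarrow> real"
  assumes p: "real_polynomial_function p" and one: "p (mat 1) = 0"
    and mult: "\<And>A B. p A = 0 \<Longrightarrow> p B = 0 \<Longrightarrow> p (A ** B) = 0"
    and SU: "\<And>A. p A = 0 \<Longrightarrow> A \<in> SU_n1"
  obtains \<epsilon> V L and lg :: "'n hmat \<Rightarrow> 'n hmat" where "\<epsilon> > 0" "open V"
    "\<And>X :: 'n hmat. norm X < \<epsilon> \<Longrightarrow> mexp X \<in> V \<and> lg (mexp X) = X"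
    "\<And>A :: 'n hmat. A \<in> V \<Longrightarrow> norm (lg A) < \<epsilon> \<and> mexp (lg A) = A"
    "\<And>A :: 'n hmat. A \<in> V \<Longrightarrow> \<exists>D. (lg has_derivative D) (at A) \<and> (\<forall>H. D (mat \<i> ** H) = mat \<i> ** D H)"
    "\<And>X :: 'n hmat. norm X < \<epsilon> \<Longrightarrow> mexp X \<in> SU_n1 \<longleftrightarrow> X \<in> su_n1"
    "\<And>X :: 'n hmat. norm X < \<epsilon> \<Longrightarrow> p (mexp X) = 0 \<longleftrightarrow> X \<in> L"
    "subspace L" "L \<subseteq> su_n1"
    "\<And>(X :: 'n hmat) Y \<zeta>. norm X < \<epsilon> \<Longrightarrow> norm Y < \<epsilon> \<Longrightarrow> \<zeta> ^ CARD('n option) = 1 \<Longrightarrow> mexp X = mat \<zeta> ** mexp Y \<Longrightarrow> \<zeta> = 1"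
proof (rule mexp_local_inverse)
  fix U V and lg :: "'n hmat \<Rightarrow> 'n hmat"
  assume U: "open U" "0 \<in> U" and V: "open V" "mat 1 \<in> V"
    and ml: "\<And>X. X \<in> U \<Longrightarrow> mexp X \<in> V \<and> lg (mexp X) = X"
    and lm: "\<And>A. A \<in> V \<Longrightarrow> lg A \<in> U \<and> mexp (lg A) = A"
    and D: "\<And>A. A \<in> V \<Longrightarrow> \<exists>D. (lg has_derivative D) (at A) \<and> (\<forall>H. D (mat \<i> ** H) = mat \<i> ** D H)"
    and D1: "(lg has_derivative (\<lambda>H. H)) (at (mat 1))"
  let ?N = "CARD('n option)"
  obtain \<delta> where \<delta>: "\<delta> > 0" "\<And>Z t. norm Z < \<delta> \<Longrightarrow> p (mexp Z) = 0 \<Longrightarrow> p (mexp (t *\<^sub>R Z)) = 0"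
    using small_element_in_one_parameter_group[OF p one mult] by blast
  obtain d where d: "d > 0" "\<And>\<zeta>::complex. \<zeta> ^ ?N = 1 \<Longrightarrow> norm (\<zeta> - 1) < d \<Longrightarrow> \<zeta> = 1"
    using root_of_unity_near_one[of ?N] by auto
  \<comment> \<open>If two matrices within \<open>\<eta>\<close> of the identity differ by a factor \<open>\<zeta>\<close>, then \<open>\<bar>\<zeta> - 1\<bar> < 4 * \<eta>\<close>.\<close>
  define \<eta> where "\<eta> = min (1 / 2) (d / 8)"
  have \<eta>: "\<eta> > 0" using d(1) by (simp add: \<eta>_def)
  obtain e1 where e1: "e1 > 0" "ball 0 e1 \<subseteq> U" using U open_contains_ball by blast
  have "isCont mexp (0 :: 'n hmat)" by (rule has_derivative_continuous[OF mexp_has_derivative])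
  then obtain e2 where e2: "e2 > 0" "\<And>X :: 'n hmat. norm X < e2 \<Longrightarrow> norm (mexp X - mat 1) < \<eta>"
    using \<eta> unfolding continuous_at_eps_delta by (metis diff_zero dist_norm mexp_0)
  define \<epsilon> where "\<epsilon> = Min {e1, e2, \<delta>, 1 / real ?N}"
  have \<epsilon>: "\<epsilon> > 0" "\<epsilon> \<le> e1" "\<epsilon> \<le> e2" "\<epsilon> \<le> \<delta>" "\<epsilon> \<le> 1 / real ?N"
    using e1 e2 \<delta>(1) unfolding \<epsilon>_def by (simp_all del: card_option)
  have inU: "X \<in> U" if "norm X < \<epsilon>" for X using e1(2) \<epsilon>(2) that by (auto simp: subset_iff)
  define V' where "V' = lg -` ball 0 \<epsilon> \<inter> V"
  have "continuous_on V lg"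
  proof (rule continuous_at_imp_continuous_on, rule ballI)
    fix A assume "A \<in> V"
    then obtain D' where "(lg has_derivative D') (at A)" using D by blast
    then show "isCont lg A" by (rule has_derivative_continuous)
  qed
  then have V': "open V'" unfolding V'_def using V(1) by (simp add: continuous_on_open_vimage)
  define L where "L = {Z. \<forall>t. p (mexp (t *\<^sub>R Z)) = 0}"
  have ml': "mexp X \<in> V' \<and> lg (mexp X) = X" if "norm X < \<epsilon>" for X
    using ml[OF inU[OF that]] that by (simp add: V'_def)
  have lm': "norm (lg A) < \<epsilon> \<and> mexp (lg A) = A" if "A \<in> V'" for A
    using lm that by (simp add: V'_def)
  have D': "\<exists>D. (lg has_derivative D) (at A) \<and> (\<forall>H. D (mat \<i> ** H) = mat \<i> ** D H)" if "A \<in> V'" for A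
    by (rule D) (use that in \<open>simp add: V'_def\<close>)
  have inj: "inj_on mexp (ball (0 :: 'n hmat) \<epsilon>)"
  proof (rule inj_onI)
    fix X Y :: "'n hmat" assume X: "X \<in> ball 0 \<epsilon>" and Y: "Y \<in> ball 0 \<epsilon>" and e: "mexp X = mexp Y"
    have "norm X < \<epsilon>" "norm Y < \<epsilon>" using X Y by simp_all
    then have "lg (mexp X) = X" "lg (mexp Y) = Y" using ml' by blast+
    then show "X = Y" unfolding e by (rule trans[OF sym])
  qed
  have su: "mexp X \<in> SU_n1 \<longleftrightarrow> X \<in> su_n1" if X: "norm X < \<epsilon>" for X :: "'n hmat"
  proof
    have "norm X < 1 / real ?N" using X \<epsilon>(5) by linarith
    then have "real ?N * norm X < 1" by (simp add: field_simps del: card_option)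
    then show "mexp X \<in> SU_n1 \<Longrightarrow> X \<in> su_n1" by (rule mexp_SU_small[OF inj X])
  qed (rule mexp_su)
  have L: "p (mexp X) = 0 \<longleftrightarrow> X \<in> L" if X: "norm X < \<epsilon>" for X
  proof
    assume "p (mexp X) = 0"
    then show "X \<in> L" unfolding L_def using \<delta>(2)[of X] X \<epsilon>(4) by auto
  next
    assume "X \<in> L"
    then have "p (mexp (1 *\<^sub>R X)) = 0" unfolding L_def by blast
    then show "p (mexp X) = 0" by simp
  qed
  have cont: "continuous_on UNIV p"
    using p by (simp add: continuous_on_polymonial_function flip: real_polynomial_function_eq)
  have closed: "closed {A. p A = 0}" by (intro closed_Collect_eq cont continuous_on_const)
  have lg1: "lg (mat 1) = 0" using ml[OF U(2)] by simp
  have sub: "subspace L"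
  proof (rule subspaceI)
    show "0 \<in> L" by (simp add: L_def one)
  next
    fix X Y assume XY: "X \<in> L" "Y \<in> L"
    have "mexp (t *\<^sub>R (X + Y)) \<in> {A. p A = 0}" for t
      by (rule one_parameter_sum[OF V _ D1 lg1 closed \<delta>(1)]) (use lm \<delta>(2) mult XY in \<open>auto simp: L_def\<close>)
    then show "X + Y \<in> L" by (simp add: L_def)
  next
    fix c X assume "X \<in> L"
    then have "p (mexp ((t * c) *\<^sub>R X)) = 0" for t unfolding L_def by blast
    then show "c *\<^sub>R X \<in> L" by (simp add: L_def)
  qed
  have Lsu: "L \<subseteq> su_n1"
  proof
    fix Z assume Z: "Z \<in> L"
    \<comment> \<open>A multiple of \<open>Z\<close> in the ball.\<close>
    define t where "t = \<epsilon> / (2 * (norm Z + 1))"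
    have q: "norm Z + 1 > 0" by (simp add: add_nonneg_pos)
    have t: "t > 0" using \<epsilon>(1) q by (simp add: t_def)
    have "a / (2 * b) * b = a / 2" if "b > 0" for a b :: real using that by simp
    from this[OF q] have tq: "t * (norm Z + 1) = \<epsilon> / 2" unfolding t_def .
    have "norm (t *\<^sub>R Z) = t * norm Z" using t by simp
    also have "\<dots> \<le> t * (norm Z + 1)" using t by (intro mult_left_mono) auto
    finally have n: "norm (t *\<^sub>R Z) < \<epsilon>" using \<epsilon>(1) tq by linarith
    have "p (mexp (t *\<^sub>R Z)) = 0" using Z unfolding L_def by blast
    then have "t *\<^sub>R Z \<in> su_n1" using su[OF n] SU by blast
    then show "Z \<in> su_n1" using subspace_scale[OF subspace_su_n1, of "t *\<^sub>R Z" "inverse t"] t by simp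
  qed
  have kern: "\<zeta> = 1" if X: "norm X < \<epsilon>" and Y: "norm Y < \<epsilon>" and r: "\<zeta> ^ ?N = 1" and e: "mexp X = mat \<zeta> ** mexp Y"
    for X Y :: "'n hmat" and \<zeta>
  proof (rule d(2)[OF r])
    let ?i = "None :: 'n option"
    have ent: "norm (M $ ?i $ ?i) \<le> norm M" for M :: "'n hmat"
      using Finite_Cartesian_Product.norm_nth_le order_trans by metis
    have x: "norm (mexp X $ ?i $ ?i - 1) < \<eta>" using ent[of "mexp X - mat 1"] e2(2)[of X] X \<epsilon>(3) by (simp add: mat_def)
    have y: "norm (mexp Y $ ?i $ ?i - 1) < \<eta>" using ent[of "mexp Y - mat 1"] e2(2)[of Y] Y \<epsilon>(3) by (simp add: mat_def)
    let ?y = "mexp Y $ ?i $ ?i"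
    have xy: "mexp X $ ?i $ ?i = \<zeta> * ?y" unfolding e mat_i_component ..
    have "norm ((\<zeta> - 1) * ?y) = norm ((\<zeta> * ?y - 1) - (?y - 1))" by (simp add: algebra_simps)
    also have "\<dots> < 2 * \<eta>" using norm_triangle_ineq4[of "\<zeta> * ?y - 1" "?y - 1"] x y unfolding xy by linarith
    finally have 1: "norm (\<zeta> - 1) * norm ?y < 2 * \<eta>" by (simp add: norm_mult)
    have "norm (1 :: complex) \<le> norm ?y + norm (?y - 1)" using norm_triangle_ineq4[of ?y "?y - 1"] by simp
    then have "norm ?y \<ge> 1 / 2" using y unfolding \<eta>_def by simp
    then have "norm (\<zeta> - 1) * (1 / 2) \<le> norm (\<zeta> - 1) * norm ?y" by (rule mult_left_mono) simp
    then have "norm (\<zeta> - 1) < 4 * \<eta>" using 1 by linarith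
    also have "4 * \<eta> \<le> d" using d(1) by (simp add: \<eta>_def min_def)
    finally show "norm (\<zeta> - 1) < d" .
  qed
  show thesis
  proof (rule that)
    show "\<epsilon> > 0" by (rule \<epsilon>(1))
    show "open V'" by (rule V')
    show "mexp X \<in> V' \<and> lg (mexp X) = X" if "norm X < \<epsilon>" for X by (rule ml'[OF that])
    show "norm (lg A) < \<epsilon> \<and> mexp (lg A) = A" if "A \<in> V'" for A by (rule lm'[OF that])
    show "\<exists>D. (lg has_derivative D) (at A) \<and> (\<forall>H. D (mat \<i> ** H) = mat \<i> ** D H)" if "A \<in> V'" for A
      by (rule D'[OF that])
    show "mexp X \<in> SU_n1 \<longleftrightarrow> X \<in> su_n1" if "norm X < \<epsilon>" for X :: "'n hmat" by (rule su[OF that])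
    show "p (mexp X) = 0 \<longleftrightarrow> X \<in> L" if "norm X < \<epsilon>" for X by (rule L[OF that])
    show "subspace L" by (rule sub)
    show "L \<subseteq> su_n1" by (rule Lsu)
    show "\<zeta> = 1" if "norm X < \<epsilon>" "norm Y < \<epsilon>" "\<zeta> ^ ?N = 1" "mexp X = mat \<zeta> ** mexp Y" for X Y :: "'n hmat" and \<zeta>
      by (rule kern[OF that])
  qed
qed

text \<open>The chart is the logarithm of \<open>A0\<^sup>-\<^sup>1 A\<close>. The preimage of its domain in \<^const>\<open>SU_n1\<close> is the union of
  sheets, one for each scalar \<open>\<zeta>\<close> in the kernel of the action. On the sheet of \<open>\<zeta>\<close> the chart lifts to
  \<open>A \<mapsto> lg (\<zeta>\<^sup>-\<^sup>1 A0\<^sup>-\<^sup>1 A)\<close>, which is defined and complex differentiable on an open set of matrices and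
  has the inverse \<open>X \<mapsto> \<zeta> A0 exp X\<close>.\<close>

lemma Ball_Aut_exponential_chart:
  fixes A0 :: "'n::finite hmat"
  assumes A0: "A0 \<in> SU_n1" and \<epsilon>: "\<epsilon> > 0" and V: "open V"
    and ml: "\<And>X :: 'n hmat. norm X < \<epsilon> \<Longrightarrow> mexp X \<in> V \<and> lg (mexp X) = X"
    and lm: "\<And>A. A \<in> V \<Longrightarrow> norm (lg A) < \<epsilon> \<and> mexp (lg A) = A"
    and D: "\<And>A. A \<in> V \<Longrightarrow> \<exists>D. (lg has_derivative D) (at A) \<and> (\<forall>H. D (mat \<i> ** H) = mat \<i> ** D H)"
    and su: "\<And>X :: 'n hmat. norm X < \<epsilon> \<Longrightarrow> mexp X \<in> SU_n1 \<longleftrightarrow> X \<in> su_n1"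
    and kern: "\<And>(X :: 'n hmat) Y \<zeta>. norm X < \<epsilon> \<Longrightarrow> norm Y < \<epsilon> \<Longrightarrow> \<zeta> ^ CARD('n option) = 1 \<Longrightarrow> mexp X = mat \<zeta> ** mexp Y \<Longrightarrow> \<zeta> = 1"
  obtains U \<phi> where "(U, \<phi>) \<in> Ball_Aut_charts" "U = (\<lambda>X. ball_action (A0 ** mexp X)) ` (ball 0 \<epsilon> \<inter> su_n1)"
    "\<And>X. X \<in> ball 0 \<epsilon> \<inter> su_n1 \<Longrightarrow> \<phi> (ball_action (A0 ** mexp X)) = X"
proof -
  let ?N = "CARD('n option)" and ?W = "ball 0 \<epsilon> \<inter> (su_n1 :: 'n hmat set)"
  define E where "E X = ball_action (A0 ** mexp X)" for X
  obtain B0 where B0: "B0 \<in> SU_n1" "A0 ** B0 = mat 1" "B0 ** A0 = mat 1" using SU_n1_inverse[OF A0] .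
  have inSU: "A0 ** mexp X \<in> SU_n1" if "X \<in> ?W" for X using that by (intro SU_n1_mult A0 mexp_su) simp
  have inj: "inj_on E ?W"
  proof (rule inj_onI)
    fix X Y assume X: "X \<in> ?W" and Y: "Y \<in> ?W" and e: "E X = E Y"
    obtain \<zeta> where \<zeta>: "\<zeta> ^ ?N = 1" "A0 ** mexp X = mat \<zeta> ** (A0 ** mexp Y)"
      using ball_action_SU_eq[OF inSU[OF X] inSU[OF Y]] e unfolding E_def by blast
    have "mexp X = B0 ** (A0 ** mexp X)" by (simp add: matrix_mul_assoc B0(3))
    also have "\<dots> = B0 ** (A0 ** (mat \<zeta> ** mexp Y))"
      unfolding \<zeta>(2) by (simp only: matrix_mul_assoc mat_commute[of \<zeta> A0])
    also have "\<dots> = mat \<zeta> ** mexp Y" unfolding matrix_mul_assoc[of B0] B0(3) by simp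
    finally have eq: "mexp X = mat \<zeta> ** mexp Y" .
    have n: "norm X < \<epsilon>" "norm Y < \<epsilon>" using X Y by simp_all
    have "\<zeta> = 1" by (rule kern[OF n \<zeta>(1) eq])
    then have "mexp X = mexp Y" using eq by simp
    moreover have "lg (mexp X) = X" "lg (mexp Y) = Y" using ml n by blast+
    ultimately show "X = Y" by metis
  qed
  define U where "U = E ` ?W"
  define \<phi> where "\<phi> = the_inv_into ?W E"
  have \<phi>E: "\<phi> (E X) = X" if "X \<in> ?W" for X unfolding \<phi>_def by (rule the_inv_into_f_f[OF inj that])
  define sheet where "sheet \<zeta> = {A \<in> SU_n1. (mat (inverse \<zeta>) ** B0) ** A \<in> V}" for \<zeta>
  have sheet_lg: "(mat (inverse \<zeta>) ** B0) ** (mat \<zeta> ** (A0 ** M)) = M" if r: "\<zeta> ^ ?N = 1" for \<zeta> and M :: "'n hmat"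
  proof -
    have \<zeta>0: "\<zeta> \<noteq> 0" using r by (auto simp: power_0_left)
    have "(mat (inverse \<zeta>) ** B0) ** (mat \<zeta> ** (A0 ** M)) = mat (inverse \<zeta>) ** (B0 ** mat \<zeta>) ** (A0 ** M)"
      by (simp only: matrix_mul_assoc)
    also have "B0 ** mat \<zeta> = mat \<zeta> ** B0" by (simp only: mat_commute)
    also have "mat (inverse \<zeta>) ** (mat \<zeta> ** B0) ** (A0 ** M) = (mat (inverse \<zeta>) ** mat \<zeta>) ** ((B0 ** A0) ** M)"
      by (simp only: matrix_mul_assoc)
    also have "\<dots> = M" using \<zeta>0 by (simp add: mat_mult_mat B0(3))
    finally show ?thesis .
  qed
  have sheet: "A \<in> sheet \<zeta> \<longleftrightarrow> (\<exists>X\<in>?W. A = mat \<zeta> ** (A0 ** mexp X))" if r: "\<zeta> ^ ?N = 1" for \<zeta> A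
  proof
    have \<zeta>0: "\<zeta> \<noteq> 0" using r by (auto simp: power_0_left)
    have inv: "mat \<zeta> ** (A0 ** ((mat (inverse \<zeta>) ** B0) ** A)) = A" for A
    proof -
      have "mat \<zeta> ** (A0 ** ((mat (inverse \<zeta>) ** B0) ** A)) = mat \<zeta> ** (A0 ** mat (inverse \<zeta>)) ** (B0 ** A)"
        by (simp only: matrix_mul_assoc)
      also have "A0 ** mat (inverse \<zeta>) = mat (inverse \<zeta>) ** A0" by (simp only: mat_commute)
      also have "mat \<zeta> ** (mat (inverse \<zeta>) ** A0) ** (B0 ** A) = (mat \<zeta> ** mat (inverse \<zeta>)) ** ((A0 ** B0) ** A)"
        by (simp only: matrix_mul_assoc)
      also have "\<dots> = A" using \<zeta>0 by (simp add: mat_mult_mat B0(2))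
      finally show ?thesis .
    qed
    {
      assume "A \<in> sheet \<zeta>"
      then have A: "A \<in> SU_n1" and v: "(mat (inverse \<zeta>) ** B0) ** A \<in> V" by (simp_all add: sheet_def)
      define X where "X = lg ((mat (inverse \<zeta>) ** B0) ** A)"
      have X: "norm X < \<epsilon>" "mexp X = (mat (inverse \<zeta>) ** B0) ** A" using lm[OF v] by (simp_all add: X_def)
      have "inverse \<zeta> ^ ?N = 1" using r by (simp add: power_inverse del: card_option)
      then have "mexp X \<in> SU_n1" unfolding X(2) by (intro SU_n1_mult unit_scalar_SU(1) B0(1) A)
      then have "X \<in> ?W" using su[OF X(1)] X(1) by simp
      moreover have "A = mat \<zeta> ** (A0 ** mexp X)" unfolding X(2) by (rule inv[symmetric])
      ultimately show "\<exists>X\<in>?W. A = mat \<zeta> ** (A0 ** mexp X)" by blast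
    next
      assume "\<exists>X\<in>?W. A = mat \<zeta> ** (A0 ** mexp X)"
      then obtain X where X: "X \<in> ?W" "A = mat \<zeta> ** (A0 ** mexp X)" by blast
      have "A \<in> SU_n1" unfolding X(2) by (rule unit_scalar_SU(1)[OF r inSU[OF X(1)]])
      moreover have "(mat (inverse \<zeta>) ** B0) ** A = mexp X" unfolding X(2) by (rule sheet_lg[OF r])
      moreover have "mexp X \<in> V" using ml[of X] X(1) by simp
      ultimately show "A \<in> sheet \<zeta>" by (simp add: sheet_def)
    }
  qed
  have actU: "ball_action (mat \<zeta> ** (A0 ** mexp X)) = E X" if "\<zeta> ^ ?N = 1" "X \<in> ?W" for \<zeta> X
    unfolding E_def by (rule unit_scalar_SU(2)[OF that(1) inSU[OF that(2)]])
  have preimage: "{A \<in> SU_n1. ball_action A \<in> U} = (\<Union>\<zeta>\<in>{\<zeta>. \<zeta> ^ ?N = 1}. sheet \<zeta>)"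
  proof (intro equalityI subsetI)
    fix A assume "A \<in> {A \<in> SU_n1. ball_action A \<in> U}"
    then obtain X where A: "A \<in> SU_n1" and X: "X \<in> ?W" "ball_action A = ball_action (A0 ** mexp X)"
      by (auto simp: U_def E_def)
    obtain \<zeta> where "\<zeta> ^ ?N = 1" "A = mat \<zeta> ** (A0 ** mexp X)" using ball_action_SU_eq[OF A inSU[OF X(1)] X(2)] by blast
    then show "A \<in> (\<Union>\<zeta>\<in>{\<zeta>. \<zeta> ^ ?N = 1}. sheet \<zeta>)" using sheet X(1) by blast
  next
    fix A assume "A \<in> (\<Union>\<zeta>\<in>{\<zeta>. \<zeta> ^ ?N = 1}. sheet \<zeta>)"
    then obtain \<zeta> where r: "\<zeta> ^ ?N = 1" and A: "A \<in> sheet \<zeta>" by blast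
    then obtain X where X: "X \<in> ?W" "A = mat \<zeta> ** (A0 ** mexp X)" using sheet by blast
    have "ball_action A \<in> U" unfolding X(2) actU[OF r X(1)] U_def using X(1) by blast
    moreover have "A \<in> SU_n1" using A by (simp add: sheet_def)
    ultimately show "A \<in> {A \<in> SU_n1. ball_action A \<in> U}" by blast
  qed
  have sheet_open: "openin (top_of_set SU_n1) (sheet \<zeta>)" for \<zeta>
  proof -
    have "continuous_on UNIV (\<lambda>A :: 'n hmat. (mat (inverse \<zeta>) ** B0) ** A)"
      by (rule linear_continuous_on[OF bounded_linear_matrix_right])
    then have "open ((\<lambda>A :: 'n hmat. (mat (inverse \<zeta>) ** B0) ** A) -` V)" using V by (simp add: continuous_on_open_vimage)
    moreover have "sheet \<zeta> = SU_n1 \<inter> ((\<lambda>A :: 'n hmat. (mat (inverse \<zeta>) ** B0) ** A) -` V)" by (auto simp: sheet_def)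
    ultimately show ?thesis by (simp add: openin_open_Int)
  qed
  have "openin Ball_Aut_topology U" unfolding openin_Ball_Aut_topology preimage
  proof
    show "U \<subseteq> carrier Ball_Aut"
      unfolding U_def E_def carrier_Ball_Aut by (rule image_subsetI, rule ball_action_SU_aut, erule inSU)
    show "openin (top_of_set SU_n1) (\<Union>\<zeta>\<in>{\<zeta>. \<zeta> ^ ?N = 1}. sheet \<zeta>)" using sheet_open by blast
  qed
  moreover have "inj_on \<phi> U"
  proof (rule inj_onI)
    fix g h assume "g \<in> U" "h \<in> U" "\<phi> g = \<phi> h"
    then show "g = h" unfolding U_def using \<phi>E by force
  qed
  moreover have "\<exists>S. A \<in> S \<and> ball_action ` S \<subseteq> U \<and> (S, \<phi> \<circ> ball_action) \<in> SU_charts" if A: "A \<in> SU_n1" "ball_action A \<in> U" for A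
  proof -
    obtain \<zeta> where r: "\<zeta> ^ ?N = 1" and A\<zeta>: "A \<in> sheet \<zeta>" using preimage A by blast
    let ?C = "mat (inverse \<zeta>) ** B0" and ?M = "mat \<zeta> ** A0"
    have sub: "ball_action ` sheet \<zeta> \<subseteq> U" using preimage r by blast
    have val: "(\<phi> \<circ> ball_action) (?M ** mexp X) = X" if "X \<in> ?W" for X
      using \<phi>E[OF that] actU[OF r that] by (simp add: matrix_mul_assoc)
    have shM: "B \<in> sheet \<zeta> \<longleftrightarrow> (\<exists>X\<in>?W. B = ?M ** mexp X)" for B
      using sheet[OF r, of B] by (simp add: matrix_mul_assoc)
    have bij: "bij_betw (\<phi> \<circ> ball_action) (sheet \<zeta>) ?W"
    proof (rule bij_betw_byWitness[where f' = "\<lambda>X :: 'n hmat. ?M ** mexp X"])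
      show "\<forall>B\<in>sheet \<zeta>. ?M ** mexp ((\<phi> \<circ> ball_action) B) = B"
      proof
        fix B assume "B \<in> sheet \<zeta>"
        then obtain X where X: "X \<in> ?W" "B = ?M ** mexp X" unfolding shM by (rule bexE)
        show "?M ** mexp ((\<phi> \<circ> ball_action) B) = B" unfolding X(2) val[OF X(1)] by (rule refl)
      qed
      show "\<forall>X\<in>?W. (\<phi> \<circ> ball_action) (?M ** mexp X) = X" using val by blast
      show "(\<phi> \<circ> ball_action) ` sheet \<zeta> \<subseteq> ?W"
      proof (rule image_subsetI)
        fix B assume "B \<in> sheet \<zeta>"
        then obtain X where X: "X \<in> ?W" "B = ?M ** mexp X" unfolding shM by (rule bexE)
        show "(\<phi> \<circ> ball_action) B \<in> ?W" unfolding X(2) val[OF X(1)] by (rule X(1))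
      qed
      show "(\<lambda>X :: 'n hmat. ?M ** mexp X) ` ?W \<subseteq> sheet \<zeta>"
      proof (rule image_subsetI)
        fix X assume "X \<in> ?W"
        then show "?M ** mexp X \<in> sheet \<zeta>" unfolding shM by (rule bexI[where x = X, OF refl])
      qed
    qed
    have img: "(\<phi> \<circ> ball_action) ` sheet \<zeta> = ?W" using bij by (rule bij_betw_imp_surj_on)
    have sm1: "smooth_on (sheet \<zeta>) (\<phi> \<circ> ball_action)"
    proof (rule smooth_onI[where W = "(\<lambda>A :: 'n hmat. ?C ** A) -` V" and g = "\<lambda>A :: 'n hmat. lg (?C ** A)"])
      have "continuous_on UNIV (\<lambda>A :: 'n hmat. ?C ** A)" by (rule linear_continuous_on[OF bounded_linear_matrix_right])
      then show op: "open ((\<lambda>A :: 'n hmat. ?C ** A) -` V)" using V by (simp add: continuous_on_open_vimage)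
      show "sheet \<zeta> \<subseteq> (\<lambda>A :: 'n hmat. ?C ** A) -` V" by (auto simp: sheet_def)
      show "lg (?C ** B) = (\<phi> \<circ> ball_action) B" if B: "B \<in> sheet \<zeta>" for B
      proof -
        obtain X where X: "X \<in> ?W" "B = mat \<zeta> ** (A0 ** mexp X)" using B unfolding sheet[OF r] by (rule bexE)
        have "lg (?C ** B) = X" unfolding X(2) sheet_lg[OF r] using ml[of X] X(1) by simp
        moreover have "(\<phi> \<circ> ball_action) B = X" unfolding X(2) using val[OF X(1)] by (simp add: matrix_mul_assoc)
        ultimately show ?thesis by simp
      qed
      show "Ck_on k ((\<lambda>A :: 'n hmat. ?C ** A) -` V) (\<lambda>A :: 'n hmat. lg (?C ** A))" for k
      proof (rule complex_derivative_Ck[OF op])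
        fix A assume "A \<in> (\<lambda>A :: 'n hmat. ?C ** A) -` V"
        then obtain D' where D': "(lg has_derivative D') (at (?C ** A))" "\<And>H. D' (mat \<i> ** H) = mat \<i> ** D' H" using D by blast
        have "((\<lambda>A :: 'n hmat. ?C ** A) has_derivative (\<lambda>H. ?C ** H)) (at A)"
          by (rule bounded_linear_imp_has_derivative[OF bounded_linear_matrix_right])
        from diff_chain_at[OF this D'(1)] have "((\<lambda>A :: 'n hmat. lg (?C ** A)) has_derivative (\<lambda>H. D' (?C ** H))) (at A)" by (simp add: o_def)
        moreover have "D' (?C ** (mat \<i> ** H)) = mat \<i> ** D' (?C ** H)" for H
        proof -
          have "?C ** (mat \<i> ** H) = mat \<i> ** (?C ** H)" by (metis matrix_mul_assoc mat_commute)
          then show ?thesis using D'(2) by simp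
        qed
        ultimately show "\<exists>D. ((\<lambda>A :: 'n hmat. lg (?C ** A)) has_derivative D) (at A) \<and> (\<forall>H. D (mat \<i> ** H) = mat \<i> ** D H)" by blast
      qed
    qed
    have sm2: "smooth_on ?W (inv_into (sheet \<zeta>) (\<phi> \<circ> ball_action))"
    proof (rule smooth_onI[where W = UNIV and g = "\<lambda>X :: 'n hmat. ?M ** mexp X"])
      show "?M ** mexp X = inv_into (sheet \<zeta>) (\<phi> \<circ> ball_action) X" if "X \<in> ?W" for X
      proof (rule inv_into_f_eq[symmetric, OF bij_betw_imp_inj_on[OF bij] _ val[OF that]])
        show "?M ** mexp X \<in> sheet \<zeta>" using shM that by blast
      qed
      show "Ck_on k UNIV (\<lambda>X :: 'n hmat. ?M ** mexp X)" for k
      proof (rule complex_derivative_Ck[OF open_UNIV])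
        fix X :: "'n hmat"
        have "((\<lambda>X :: 'n hmat. ?M ** mexp X) has_derivative (\<lambda>H. ?M ** dexp X H)) (at X)"
          by (rule bounded_linear.has_derivative[OF bounded_linear_matrix_right mexp_has_derivative])
        moreover have "?M ** dexp X (mat \<i> ** H) = mat \<i> ** (?M ** dexp X H)" for H
          unfolding dexp_complex_linear by (metis matrix_mul_assoc mat_commute)
        ultimately show "\<exists>D. ((\<lambda>X :: 'n hmat. ?M ** mexp X) has_derivative D) (at X) \<and> (\<forall>H. D (mat \<i> ** H) = mat \<i> ** D H)" by blast
      qed
    qed simp_all
    have "openin (top_of_set su_n1) ?W" by (simp add: Int_commute openin_open_Int)
    then have "(sheet \<zeta>, \<phi> \<circ> ball_action) \<in> SU_charts"
      unfolding SU_charts_def diffeomorphism_on_def mem_Collect_eq prod.case img using sheet_open bij sm1 sm2 by blast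
    then show ?thesis using A\<zeta> sub by blast
  qed
  ultimately have "(U, \<phi>) \<in> Ball_Aut_charts" by (simp add: Ball_Aut_charts_def)
  then show thesis
  proof (rule that)
    show "U = (\<lambda>X. ball_action (A0 ** mexp X)) ` ?W" unfolding U_def E_def ..
    show "\<phi> (ball_action (A0 ** mexp X)) = X" if "X \<in> ?W" for X using \<phi>E[OF that] unfolding E_def .
  qed
qed

section \<open>The invariant group as a Lie subgroup\<close>

text \<open>Each component contains a member of the cover that meets it, and is therefore determined by that
  member.\<close>

lemma finite_components_of_finite_connected_cover:
  assumes "finite P" "\<And>C. C \<in> P \<Longrightarrow> connectedin X C" "topspace X \<subseteq> \<Union>P"
  shows "finite (connected_components_of X)"
proof (rule finite_subset)
  let ?F = "\<lambda>C. connected_component_of_set X (SOME x. x \<in> C)"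
  show "finite (?F ` P)" using assms(1) by simp
  show "connected_components_of X \<subseteq> ?F ` P"
  proof
    fix K assume "K \<in> connected_components_of X"
    then obtain x where x: "x \<in> topspace X" "K = connected_component_of_set X x"
      by (auto simp: connected_components_of_def)
    then obtain C where C: "C \<in> P" "x \<in> C" using assms(3) by blast
    have "(SOME y. y \<in> C) \<in> C" using C(2) by (rule someI)
    then have "connected_component_of X x (SOME y. y \<in> C)"
      unfolding connected_component_of_def using assms(2)[OF C(1)] C(2) by blast
    then have "K = ?F C" unfolding x(2) by (simp add: connected_component_of_equiv)
    then show "K \<in> ?F ` P" using C(1) by blast
  qed
qed

lemma continuous_map_ball_action:
  "continuous_map (top_of_set (SU_n1 :: 'n::finite hmat set)) Ball_Aut_topology ball_action"
proof -
  have car: "topspace (Ball_Aut_topology :: (complex^'n \<Rightarrow> complex^'n) topology) = ball_aut"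
  proof
    show "topspace (Ball_Aut_topology :: (complex^'n \<Rightarrow> complex^'n) topology) \<subseteq> ball_aut"
      using openin_topspace[of "Ball_Aut_topology :: (complex^'n \<Rightarrow> complex^'n) topology"]
      unfolding openin_Ball_Aut_topology by simp
    have "{A \<in> SU_n1. ball_action A \<in> (ball_aut :: (complex^'n \<Rightarrow> complex^'n) set)} = SU_n1"
      using ball_action_SU_aut by blast
    then have "openin Ball_Aut_topology (ball_aut :: (complex^'n \<Rightarrow> complex^'n) set)"
      unfolding openin_Ball_Aut_topology by simp
    then show "(ball_aut :: (complex^'n \<Rightarrow> complex^'n) set) \<subseteq> topspace Ball_Aut_topology" by (rule openin_subset)
  qed
  show ?thesis unfolding continuous_map car
  proof (intro conjI allI impI)
    show "ball_action ` topspace (top_of_set (SU_n1 :: 'n hmat set)) \<subseteq> ball_aut"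
      using ball_action_SU_aut by auto
    fix U :: "(complex^'n \<Rightarrow> complex^'n) set" assume "openin Ball_Aut_topology U"
    then show "openin (top_of_set SU_n1) {A \<in> topspace (top_of_set SU_n1). ball_action A \<in> U}"
      unfolding openin_Ball_Aut_topology by simp
  qed
qed

text \<open>Since \<open>A0\<close> lies over an element of \<open>\<Gamma>\<close>, the image of \<open>A0 exp X\<close> lies in \<open>\<Gamma>\<close> if and only if that of
  \<open>exp X\<close> does, and in exponential coordinates this is the linear condition \<open>X \<in> L\<close>. All charts use
  the same \<open>L\<close>, so the dimension is constant.\<close>

lemma embedded_submanifold_invariant_group:
  fixes f :: "complex^'n \<Rightarrow> complex^'m" and p :: "'n hmat \<Rightarrow> real"
  assumes fB: "\<And>z. z \<in> \<bbbB> \<Longrightarrow> f z \<in> \<bbbB>" and p: "real_polynomial_function p"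
    and zero: "{A. p A = 0} = {A \<in> SU_n1. ball_action A \<in> hermitian_invariant_group f}"
  shows "embedded_submanifold su_n1 Ball_Aut_charts (hermitian_invariant_group f)"
proof -
  let ?\<Gamma> = "hermitian_invariant_group f"
  interpret group "Ball_Aut :: (complex^'n \<Rightarrow> complex^'n) monoid" by (rule group_Ball_Aut)
  have sg: "subgroup ?\<Gamma> Ball_Aut" by (rule hermitian_invariant_subgroup[OF fB])
  have p0: "p A = 0 \<longleftrightarrow> A \<in> SU_n1 \<and> ball_action A \<in> ?\<Gamma>" for A using zero by blast
  have car: "?\<Gamma> \<subseteq> ball_aut" using subgroup.subset[OF sg] by simp
  have one: "p (mat 1) = 0" unfolding p0 ball_action_SU_one using SU_n1_one subgroup.one_closed[OF sg] by blast
  have mult: "p (A ** B) = 0" if "p A = 0" "p B = 0" for A B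
    using that subgroup.m_closed[OF sg] unfolding p0 by (metis SU_n1_mult ball_action_SU_mult)
  have SU: "A \<in> SU_n1" if "p A = 0" for A using that p0 by blast
  show ?thesis
  proof (rule exponential_coordinates[OF p one mult SU])
    fix \<epsilon> and V L :: "'n hmat set" and lg :: "'n hmat \<Rightarrow> 'n hmat"
    assume e: "\<epsilon> > 0" and V: "open V"
      and ml: "\<And>X. norm X < \<epsilon> \<Longrightarrow> mexp X \<in> V \<and> lg (mexp X) = X"
      and lm: "\<And>A. A \<in> V \<Longrightarrow> norm (lg A) < \<epsilon> \<and> mexp (lg A) = A"
      and D: "\<And>A. A \<in> V \<Longrightarrow> \<exists>D. (lg has_derivative D) (at A) \<and> (\<forall>H. D (mat \<i> ** H) = mat \<i> ** D H)"
      and su: "\<And>X :: 'n hmat. norm X < \<epsilon> \<Longrightarrow> mexp X \<in> SU_n1 \<longleftrightarrow> X \<in> su_n1"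
      and L: "\<And>X. norm X < \<epsilon> \<Longrightarrow> p (mexp X) = 0 \<longleftrightarrow> X \<in> L"
      and sub: "subspace L" "L \<subseteq> su_n1"
      and kern: "\<And>(X :: 'n hmat) Y \<zeta>. norm X < \<epsilon> \<Longrightarrow> norm Y < \<epsilon> \<Longrightarrow> \<zeta> ^ CARD('n option) = 1 \<Longrightarrow> mexp X = mat \<zeta> ** mexp Y \<Longrightarrow> \<zeta> = 1"
    have "\<exists>(U, \<phi>)\<in>Ball_Aut_charts. g \<in> U \<and> (\<exists>L'. subspace L' \<and> L' \<subseteq> su_n1 \<and> dim L' = dim L \<and> \<phi> ` (U \<inter> ?\<Gamma>) = \<phi> ` U \<inter> L')"
      if g: "g \<in> ?\<Gamma>" for g
    proof -
      obtain A0 where A0: "A0 \<in> SU_n1" "g = ball_action A0" using g car ball_aut_eq by blast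
      let ?W = "ball 0 \<epsilon> \<inter> (su_n1 :: 'n hmat set)"
      show ?thesis
      proof (rule Ball_Aut_exponential_chart[OF A0(1) e V ml lm D su kern])
        fix U and \<phi> :: "(complex^'n \<Rightarrow> complex^'n) \<Rightarrow> 'n hmat"
        assume ch: "(U, \<phi>) \<in> Ball_Aut_charts" and U: "U = (\<lambda>X. ball_action (A0 ** mexp X)) ` ?W"
          and \<phi>: "\<And>X. X \<in> ?W \<Longrightarrow> \<phi> (ball_action (A0 ** mexp X)) = X"
        have W0: "0 \<in> ?W" using e subspace_0[OF subspace_su_n1] by simp
        have "g = ball_action (A0 ** mexp 0)" unfolding A0(2) mexp_0 by simp
        then have gU: "g \<in> U" unfolding U using W0 by (rule image_eqI)
        have \<phi>U: "\<phi> ` U = ?W" unfolding U using \<phi> by force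
        have iff: "ball_action (A0 ** mexp X) \<in> ?\<Gamma> \<longleftrightarrow> X \<in> L" if X: "X \<in> ?W" for X
        proof -
          have n: "norm X < \<epsilon>" and SX: "mexp X \<in> SU_n1" using X su[of X] by simp_all
          have c: "ball_action (mexp X) \<in> ball_aut" "g \<in> ball_aut" using ball_action_SU_aut SX g car by blast+
          have "ball_action (A0 ** mexp X) = g \<otimes>\<^bsub>Ball_Aut\<^esub> ball_action (mexp X)"
            unfolding A0(2) by (rule ball_action_SU_mult[OF A0(1) SX])
          moreover have "g \<otimes>\<^bsub>Ball_Aut\<^esub> ball_action (mexp X) \<in> ?\<Gamma> \<longleftrightarrow> ball_action (mexp X) \<in> ?\<Gamma>"
          proof
            assume "ball_action (mexp X) \<in> ?\<Gamma>"
            then show "g \<otimes>\<^bsub>Ball_Aut\<^esub> ball_action (mexp X) \<in> ?\<Gamma>" by (rule subgroup.m_closed[OF sg g])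
          next
            assume "g \<otimes>\<^bsub>Ball_Aut\<^esub> ball_action (mexp X) \<in> ?\<Gamma>"
            then have "inv\<^bsub>Ball_Aut\<^esub> g \<otimes>\<^bsub>Ball_Aut\<^esub> (g \<otimes>\<^bsub>Ball_Aut\<^esub> ball_action (mexp X)) \<in> ?\<Gamma>"
              by (rule subgroup.m_closed[OF sg subgroup.m_inv_closed[OF sg g]])
            moreover have "inv\<^bsub>Ball_Aut\<^esub> g \<otimes>\<^bsub>Ball_Aut\<^esub> (g \<otimes>\<^bsub>Ball_Aut\<^esub> ball_action (mexp X)) = ball_action (mexp X)"
              by (subst inv_solve_left') (use c m_closed[of g "ball_action (mexp X)"] in simp_all)
            ultimately show "ball_action (mexp X) \<in> ?\<Gamma>" by simp
          qed
          moreover have "ball_action (mexp X) \<in> ?\<Gamma> \<longleftrightarrow> X \<in> L" using L[OF n] SX unfolding p0 by blast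
          ultimately show ?thesis by simp
        qed
        have "\<phi> ` (U \<inter> ?\<Gamma>) = \<phi> ` U \<inter> L"
        proof (intro equalityI subsetI)
          fix Y assume "Y \<in> \<phi> ` (U \<inter> ?\<Gamma>)"
          then obtain X where X: "X \<in> ?W" "ball_action (A0 ** mexp X) \<in> ?\<Gamma>" "Y = \<phi> (ball_action (A0 ** mexp X))"
            unfolding U by blast
          then show "Y \<in> \<phi> ` U \<inter> L" unfolding \<phi>U using iff[OF X(1)] \<phi>[OF X(1)] by simp
        next
          fix X assume "X \<in> \<phi> ` U \<inter> L"
          then have X: "X \<in> ?W" "X \<in> L" unfolding \<phi>U by blast+
          then have "ball_action (A0 ** mexp X) \<in> U \<inter> ?\<Gamma>" unfolding U using iff[OF X(1)] by blast
          then show "X \<in> \<phi> ` (U \<inter> ?\<Gamma>)" using \<phi>[OF X(1)] by force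
        qed
        then show ?thesis using ch gU sub by blast
      qed
    qed
    then show ?thesis unfolding embedded_submanifold_def by blast
  qed
qed

theorem theorem3p1:
  fixes f :: "complex^'n \<Rightarrow> complex^'m"
  assumes "rational_proper_map f"
  shows "Lie_subgroup_of_Ball_Aut (hermitian_invariant_group f) \<and>
         finite (connected_components_of
           (subtopology Ball_Aut_topology (hermitian_invariant_group f)))"
proof
  let ?\<Gamma> = "hermitian_invariant_group f"
  have hol: "holomorphic_map_on f \<bbbB>" and proper: "proper_map (top_of_set \<bbbB>) (top_of_set \<bbbB>) f"
    and rat: "\<And>j. rational_on_ball (\<lambda>z. f z $ j)"
    using assms by (auto simp: rational_proper_map_def)
  have cont: "continuous_on \<bbbB> f" by (rule holomorphic_map_continuous[OF hol])
  have fB: "f z \<in> \<bbbB>" if "z \<in> \<bbbB>" for z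
    using proper_map_imp_subset_topspace[OF proper] that by auto
  obtain p where p: "real_polynomial_function p" "\<And>A. p A \<ge> 0"
    and zero: "{A. p A = 0} = {A \<in> SU_n1. ball_action A \<in> ?\<Gamma>}"
    using invariant_group_algebraic[OF cont fB rat] by blast
  have sg: "subgroup ?\<Gamma> Ball_Aut" by (rule hermitian_invariant_subgroup[OF fB])
  show "Lie_subgroup_of_Ball_Aut ?\<Gamma>"
    using sg embedded_submanifold_invariant_group[OF fB p(1) zero] by (simp add: Lie_subgroup_of_Ball_Aut_def)
  obtain P where P: "finite P" "\<forall>C\<in>P. connected C" "\<Union>P = {A. p A = 0}"
    using finite_connected_cover_of_algebraic_set[OF p] by blast
  have PSU: "C \<subseteq> SU_n1" and P\<Gamma>: "ball_action ` C \<subseteq> ?\<Gamma>" if "C \<in> P" for C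
    using that P(3) zero by blast+
  show "finite (connected_components_of (subtopology Ball_Aut_topology ?\<Gamma>))"
  proof (rule finite_components_of_finite_connected_cover)
    show "finite ((`) ball_action ` P)" using P(1) by simp
    show "connectedin (subtopology Ball_Aut_topology ?\<Gamma>) C'" if C': "C' \<in> (`) ball_action ` P" for C'
    proof -
      obtain C where C: "C \<in> P" "C' = ball_action ` C" using C' by blast
      have "connectedin (top_of_set SU_n1) C"
        using P(2) C(1) PSU[OF C(1)] by (simp add: connectedin_subtopology)
      then have "connectedin Ball_Aut_topology C'"
        unfolding C(2) by (rule connectedin_continuous_map_image[OF continuous_map_ball_action])
      then show ?thesis using P\<Gamma>[OF C(1)] by (simp add: connectedin_subtopology C(2))
    qed
    have "?\<Gamma> \<subseteq> ball_action ` {A. p A = 0}"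
    proof
      fix g assume g: "g \<in> ?\<Gamma>"
      then have "g \<in> ball_aut" using subgroup.subset[OF sg] by auto
      then obtain A where A: "A \<in> SU_n1" "g = ball_action A" using ball_aut_eq by blast
      then show "g \<in> ball_action ` {A. p A = 0}" unfolding zero using g by blast
    qed
    then have "?\<Gamma> \<subseteq> \<Union> ((`) ball_action ` P)" unfolding P(3)[symmetric] image_Union .
    then show "topspace (subtopology Ball_Aut_topology ?\<Gamma>) \<subseteq> \<Union> ((`) ball_action ` P)"
      unfolding topspace_subtopology by (rule le_infI2)
  qed
qed

end
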